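(* Let $(M,g)$ and $(N,h)$ be closed oriented hyperbolic surfaces, $p>2$, and let $u$ be a minimizer of $J_p$ in a given homotopy class of maps $M\to N$. Let $T=(Q(du)^{p-2}du\otimes du)^\sharp-\frac1p\mathrm{Tr}\,Q(du)^p\,g$ and $W=*T\times id$. Then, with respect to the flat connection $d$ on $ad(F)$, $W$ is closed in the distribution sense, i.e. $dW=0$.
   Context: $J_p(u)=\int_M\mathrm{Tr}\,Q(du)^p*1$, $Q(du)=(du\,du^T)^{1/2}$. $T$ is a symmetric $(0,2)$-tensor on $M$, with $(Q(du)^{p-2}du\otimes du)^\sharp(a,b)=\langle Q(du)^{p-2}du(a),du(b)\rangle_{TN}$. $\mathbb R^{2,1}$ carries $(X,Y)^\sharp=X_1Y_1+X_2Y_2-X_3Y_3=X^\sharp Y$, $X^\sharp=(\mathrm{diag}(1,1,-1)X)^T$; $\mathbb H=\{(X,X)^\sharp=-1,X_3\ge1\}$; $\mathfrak g=so(2,1)$; $X\times Y=YX^\sharp-XY^\sharp\in\mathfrak g$. Let $\sigma:\pi_1(M)\to SO^+(2,1)$ define the hyperbolic structure on $M$ (so $\tilde M=\mathbb H$); $F=\tilde M\times_\sigma\mathbb R^{2,1}$ and $ad(F)=\tilde M\times_{Ad(\sigma)}\mathfrak g$ are flat bundles. The identity $\tilde M=\mathbb H\subset\mathbb R^{2,1}$ defines a section $id$ of $F$, and $TM\subset F$. Identifying $T^*M\otimes T^*M$ with $T^*M\otimes TM\subset T^*M\otimes F$ via $g$, $*T\times id$ is the $ad(F)$-valued 1-form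 obtained by applying the Hodge star to the $T^*M$ factor and $v\mapsto v\times id$ to the values. *)

theory Defs
  imports "HOL-Analysis.Analysis"
begin

section \<open>Minkowski space, the hyperboloid and so(2,1)\<close>

definition lor_diag :: "real^3^3" where
  "lor_diag = (\<chi> i j. if i = j then (if i = 3 then - 1 else 1) else 0)"

definition lor :: "real^3 \<Rightarrow> real^3 \<Rightarrow> real" where
  "lor X Y = X$1 * Y$1 + X$2 * Y$2 - X$3 * Y$3"

definition hyp :: "(real^3) set" where
  "hyp = {X. lor X X = - 1 \<and> X$3 \<ge> 1}"

definition tangent :: "real^3 \<Rightarrow> (real^3) set" where
  "tangent x = {v. lor v x = 0}"

definition SO_plus :: "(real^3^3) set" where
  "SO_plus = {A. (\<forall>X Y. lor (A *v X) (A *v Y) = lor X Y) \<and> det A = 1 \<and> A$3$3 > 0}"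

definition so21 :: "(real^3^3) set" where
  "so21 = {A. \<forall>X Y. lor (A *v X) Y + lor X (A *v Y) = 0}"

text \<open>The product \<open>X \<times> Y = Y X\<^sup>\<sharp> - X Y\<^sup>\<sharp>\<close>, where \<open>X\<^sup>\<sharp>\<close> is the row vector
  \<open>(lor_diag X)\<^sup>T\<close>; its values are in \<open>so21\<close>.\<close>
definition lor_cross :: "real^3 \<Rightarrow> real^3 \<Rightarrow> real^3^3" where
  "lor_cross X Y = (\<chi> i j. Y$i * (lor_diag *v X)$j - X$i * (lor_diag *v Y)$j)"

text \<open>Rotation by +90 degrees on the tangent plane at \<open>x \<in> hyp\<close>. The orientation is the one for
  which the projection to the first two coordinates preserves orientation; it is
  \<open>SO_plus\<close>-invariant, hence it orients every quotient of \<open>hyp\<close>.\<close>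
definition rot :: "real^3 \<Rightarrow> real^3 \<Rightarrow> real^3" where
  "rot x v = lor_diag *v (cross3 x v)"

text \<open>An oriented global chart of \<open>hyp\<close>. The area form of \<open>hyp\<close> is
  \<open>dy\<^sub>1 \<and> dy\<^sub>2 / sqrt (1 + |y|\<^sup>2)\<close> in this chart.\<close>
definition chart :: "real^2 \<Rightarrow> real^3" where
  "chart y = vector [y$1, y$2, sqrt (1 + (norm y)\<^sup>2)]"

section \<open>Closed oriented hyperbolic surfaces\<close>

text \<open>A closed oriented hyperbolic surface \<open>M\<close>, given by its universal covering
  \<open>\<pi> : hyp \<rightarrow> M\<close> and the image \<open>\<Gamma>\<close> in \<open>SO_plus\<close> of the holonomy representation
  \<open>\<sigma>\<close> of the fundamental group. The fibres of \<open>\<pi>\<close> being the \<open>\<Gamma>\<close>-orbits,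
  \<open>\<Gamma>\<close> is the deck group; it acts freely and properly discontinuously because \<open>\<pi>\<close> is a
  covering. Metric, orientation and smooth structure of \<open>M\<close> are those of \<open>hyp\<close>.\<close>
definition closed_hyperbolic_surface ::
    "'m::t2_space set \<Rightarrow> (real^3 \<Rightarrow> 'm) \<Rightarrow> (real^3^3) set \<Rightarrow> bool" where
  "closed_hyperbolic_surface M \<pi> \<Gamma> \<longleftrightarrow>
     compact M \<and>
     \<Gamma> \<subseteq> SO_plus \<and> mat 1 \<in> \<Gamma> \<and>
     (\<forall>A\<in>\<Gamma>. \<forall>B\<in>\<Gamma>. A ** B \<in> \<Gamma>) \<and> (\<forall>A\<in>\<Gamma>. matrix_inv A \<in> \<Gamma>) \<and>
     covering_space hyp \<pi> M \<and>
     (\<forall>x\<in>hyp. \<forall>y\<in>hyp. \<pi> x = \<pi> y \<longleftrightarrow> (\<exists>A\<in>\<Gamma>. y = A *v x))"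

text \<open>The Dirichlet fundamental domain of \<open>\<Gamma>\<close> centred at \<open>e = (0,0,1)\<close>: since
  \<open>x$3 = cosh (dist x e)\<close>, it consists of the points which are closest to \<open>e\<close> in their orbit.
  Its translates cover \<open>hyp\<close> and overlap in null sets only, so the integral over \<open>M\<close> of an
  invariant object on \<open>hyp\<close> is the integral over this set.\<close>
definition dirichlet :: "(real^3^3) set \<Rightarrow> (real^3) set" where
  "dirichlet \<Gamma> = {x \<in> hyp. \<forall>A\<in>\<Gamma>. x$3 \<le> (A *v x)$3}"

text \<open>The integral over \<open>M\<close> of a function which is given by its \<open>\<Gamma>\<close>-invariant lift to
  \<open>hyp\<close>, with respect to the hyperbolic area.\<close>
definition surface_nn_integral :: "(real^3^3) set \<Rightarrow> (real^3 \<Rightarrow> real) \<Rightarrow> ennreal" where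
  "surface_nn_integral \<Gamma> F =
     (\<integral>\<^sup>+ y. ennreal (F (chart y) / sqrt (1 + (norm y)\<^sup>2)) * indicator (dirichlet \<Gamma>) (chart y) \<partial>lborel)"

section \<open>Smooth functions and weak differentials\<close>

definition partial :: "2 \<Rightarrow> (real^2 \<Rightarrow> 'b::real_normed_vector) \<Rightarrow> real^2 \<Rightarrow> 'b" where
  "partial i f y = frechet_derivative f (at y) (axis i 1)"

text \<open>Coinductive, so that all iterated partial derivatives exist and are differentiable.\<close>
coinductive smooth :: "(real^2 \<Rightarrow> 'b::real_normed_vector) \<Rightarrow> bool" where
  "(\<forall>y. f differentiable (at y)) \<Longrightarrow> (\<forall>i. smooth (partial i f)) \<Longrightarrow> smooth f"

definition weak_partial :: "2 \<Rightarrow> (real^2 \<Rightarrow> real^3) \<Rightarrow> (real^2 \<Rightarrow> real^3) \<Rightarrow> bool" where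
  "weak_partial i f w \<longleftrightarrow>
     (\<forall>K. compact K \<longrightarrow> set_integrable lborel K f \<and> set_integrable lborel K w) \<and>
     (\<forall>\<eta>::real^2 \<Rightarrow> real. smooth \<eta> \<and> bounded {y. \<eta> y \<noteq> 0} \<longrightarrow>
        (LINT y|lborel. partial i \<eta> y *\<^sub>R f y) = - (LINT y|lborel. \<eta> y *\<^sub>R w y))"

text \<open>A linear map from the tangent plane at \<open>x\<close> to the tangent plane at \<open>z\<close> is encoded as the
  3 by 3 matrix which extends it by \<open>0\<close> on \<open>x\<close>. With this encoding, \<open>du\<close> is a weak
  differential of \<open>u : hyp \<rightarrow> hyp\<close>.\<close>
definition weak_differential :: "(real^3 \<Rightarrow> real^3) \<Rightarrow> (real^3 \<Rightarrow> real^3^3) \<Rightarrow> bool" where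
  "weak_differential u du \<longleftrightarrow>
     (\<forall>x\<in>hyp. du x *v x = 0 \<and> (\<forall>v. du x *v v \<in> tangent (u x))) \<and>
     (\<forall>i. weak_partial i (\<lambda>y. u (chart y)) (\<lambda>y. du (chart y) *v partial i chart y))"

text \<open>\<open>ut\<close> is a lift to the universal coverings of the continuous map \<open>u : M \<rightarrow> N\<close>.\<close>
definition lift_of ::
    "(real^3 \<Rightarrow> 'm) \<Rightarrow> (real^3 \<Rightarrow> 'n) \<Rightarrow> ('m \<Rightarrow> 'n) \<Rightarrow> (real^3 \<Rightarrow> real^3) \<Rightarrow> bool" where
  "lift_of \<pi>M \<pi>N u ut \<longleftrightarrow>
     continuous_on hyp ut \<and> ut ` hyp \<subseteq> hyp \<and> (\<forall>x\<in>hyp. \<pi>N (ut x) = u (\<pi>M x))"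

section \<open>The functional\<close>

text \<open>The adjoint of \<open>L\<close> with respect to \<open>lor\<close>. If \<open>L\<close> encodes a linear map between tangent
  planes, then this encodes its transpose.\<close>
definition adj :: "real^3^3 \<Rightarrow> real^3^3" where
  "adj L = lor_diag ** transpose L ** lor_diag"

text \<open>The power \<open>A\<^sup>s\<close> of a diagonalizable matrix \<open>A\<close> with eigenvalues \<open>\<ge> 0\<close>. Since
  \<open>0 powr s = 0\<close>, it vanishes on the kernel of \<open>A\<close>; in particular the normal line added by the
  encoding contributes nothing to traces.\<close>
definition mat_powr :: "real^3^3 \<Rightarrow> real \<Rightarrow> real^3^3" where
  "mat_powr A s = (THE B. \<forall>v c. A *v v = c *\<^sub>R v \<longrightarrow> B *v v = (c powr s) *\<^sub>R v)"

definition Q :: "real^3^3 \<Rightarrow> real^3^3" where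
  "Q L = mat_powr (L ** adj L) (1/2)"

definition energy :: "real \<Rightarrow> (real^3^3) set \<Rightarrow> (real^3 \<Rightarrow> real^3^3) \<Rightarrow> ennreal" where
  "energy p \<Gamma> du = surface_nn_integral \<Gamma> (\<lambda>x. trace (mat_powr (Q (du x)) p))"

text \<open>Continuous maps of class \<open>W\<^sup>1\<^sup>,\<^sup>p\<close>; for \<open>p > 2\<close> every Sobolev map between surfaces has a
  continuous representative. Here \<open>trace (du ** adj du)\<close> is the squared norm \<open>|du|\<^sup>2\<close>.\<close>
definition sobolev_map ::
    "real \<Rightarrow> (real^3^3) set \<Rightarrow> (real^3 \<Rightarrow> 'm) \<Rightarrow> (real^3 \<Rightarrow> 'n) \<Rightarrow> ('m \<Rightarrow> 'n) \<Rightarrow> bool" where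
  "sobolev_map p \<Gamma> \<pi>M \<pi>N u \<longleftrightarrow>
     (\<exists>ut du. lift_of \<pi>M \<pi>N u ut \<and> weak_differential ut du \<and>
        surface_nn_integral \<Gamma> (\<lambda>x. trace (du x ** adj (du x)) powr (p/2)) < \<infinity>)"

text \<open>The energy depends neither on the lift nor on the representative of its weak differential,
  so the infimum is over a single value; it is \<open>\<infinity>\<close> if there is no weak differential.\<close>
definition J :: "real \<Rightarrow> (real^3^3) set \<Rightarrow> (real^3 \<Rightarrow> 'm) \<Rightarrow> (real^3 \<Rightarrow> 'n) \<Rightarrow> ('m \<Rightarrow> 'n) \<Rightarrow> ennreal" where
  "J p \<Gamma> \<pi>M \<pi>N u =
     Inf {energy p \<Gamma> du |ut du. lift_of \<pi>M \<pi>N u ut \<and> weak_differential ut du}"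

text \<open>\<open>u\<close> minimizes \<open>J p\<close> in the homotopy class of \<open>f\<close>.\<close>
definition minimizer ::
    "real \<Rightarrow> (real^3^3) set \<Rightarrow> 'm::t2_space set \<Rightarrow> (real^3 \<Rightarrow> 'm) \<Rightarrow> 'n::t2_space set \<Rightarrow> (real^3 \<Rightarrow> 'n) \<Rightarrow>
     ('m \<Rightarrow> 'n) \<Rightarrow> ('m \<Rightarrow> 'n) \<Rightarrow> bool" where
  "minimizer p \<Gamma> M \<pi>M N \<pi>N f u \<longleftrightarrow>
     sobolev_map p \<Gamma> \<pi>M \<pi>N u \<and> homotopic_with_canon (\<lambda>_. True) M N f u \<and>
     (\<forall>v. sobolev_map p \<Gamma> \<pi>M \<pi>N v \<and> homotopic_with_canon (\<lambda>_. True) M N f v \<longrightarrow>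
        J p \<Gamma> \<pi>M \<pi>N u \<le> J p \<Gamma> \<pi>M \<pi>N v)"

section \<open>The tensor T and the form W\<close>

text \<open>The metric on tangent planes is the restriction of \<open>lor\<close>.\<close>
definition T_tensor :: "real \<Rightarrow> real^3^3 \<Rightarrow> real^3 \<Rightarrow> real^3 \<Rightarrow> real" where
  "T_tensor p L a b =
     lor (mat_powr (Q L) (p - 2) *v (L *v a)) (L *v b) - (1/p) * trace (mat_powr (Q L) p) * lor a b"

text \<open>The identification of a bilinear form on the tangent plane at \<open>x\<close> with a tangent-valued
  1-form by means of the metric.\<close>
definition raise_index :: "real^3 \<Rightarrow> (real^3 \<Rightarrow> real^3 \<Rightarrow> real) \<Rightarrow> real^3 \<Rightarrow> real^3" where
  "raise_index x B a = (THE v. v \<in> tangent x \<and> (\<forall>b\<in>tangent x. lor v b = B a b))"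

text \<open>Hodge star of vector-valued 1-forms on an oriented surface, i.e. \<open>*dx = dy\<close> and
  \<open>*dy = - dx\<close> in oriented orthonormal coordinates.\<close>
definition hodge :: "real^3 \<Rightarrow> (real^3 \<Rightarrow> real^3) \<Rightarrow> real^3 \<Rightarrow> real^3" where
  "hodge x \<alpha> a = - \<alpha> (rot x a)"

text \<open>The lift of \<open>W = *T \<times> id\<close> to \<open>hyp\<close>, where \<open>id x = x\<close>.\<close>
definition W_form :: "real \<Rightarrow> (real^3 \<Rightarrow> real^3^3) \<Rightarrow> real^3 \<Rightarrow> real^3 \<Rightarrow> real^3^3" where
  "W_form p du x a = lor_cross (hodge x (raise_index x (T_tensor p (du x))) a) x"

section \<open>Distributional closedness in the flat bundle ad(F)\<close>

text \<open>Smooth sections of \<open>ad(F)\<close>, as equivariant maps on the universal covering; in this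
  description the flat connection is the componentwise differential.\<close>
definition smooth_section :: "(real^3^3) set \<Rightarrow> (real^3 \<Rightarrow> real^3^3) \<Rightarrow> bool" where
  "smooth_section \<Gamma> \<phi> \<longleftrightarrow>
     (\<forall>x\<in>hyp. \<phi> x \<in> so21) \<and>
     (\<forall>A\<in>\<Gamma>. \<forall>x\<in>hyp. \<phi> (A *v x) = A ** \<phi> x ** matrix_inv A) \<and>
     smooth (\<lambda>y. \<phi> (chart y))"

text \<open>The coefficient of \<open>tr (W \<and> d\<phi>)\<close> with respect to \<open>dy\<^sub>1 \<and> dy\<^sub>2\<close> in the chart. The trace form
  is an invariant nondegenerate pairing on \<open>so21\<close>, so sections of \<open>ad(F)\<close> serve as test
  sections of the dual bundle.\<close>
definition wedge_d :: "(real^3 \<Rightarrow> real^3 \<Rightarrow> real^3^3) \<Rightarrow> (real^3 \<Rightarrow> real^3^3) \<Rightarrow> real^2 \<Rightarrow> real" where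
  "wedge_d W \<phi> y =
     trace (W (chart y) (partial 1 chart y) ** partial 2 (\<lambda>y. \<phi> (chart y)) y)
   - trace (W (chart y) (partial 2 chart y) ** partial 1 (\<lambda>y. \<phi> (chart y)) y)"

text \<open>\<open>dW = 0\<close> in the distribution sense on \<open>M\<close>: the integral over \<open>M\<close> of \<open>tr (W \<and> d\<phi>)\<close>
  exists and vanishes for all test sections \<open>\<phi>\<close>.\<close>
definition weakly_closed :: "(real^3^3) set \<Rightarrow> (real^3 \<Rightarrow> real^3 \<Rightarrow> real^3^3) \<Rightarrow> bool" where
  "weakly_closed \<Gamma> W \<longleftrightarrow>
     (\<forall>\<phi>. smooth_section \<Gamma> \<phi> \<longrightarrow>
        has_bochner_integral lborel (\<lambda>y. indicator (dirichlet \<Gamma>) (chart y) * wedge_d W \<phi> y) 0)"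

end

theory Submission
  imports Defs
begin

text \<open>
  The statement is the Euler-Lagrange equation for variations of the domain, tested on a smooth
  \<open>\<Gamma>\<close>-equivariant \<open>\<phi>\<close> with values in \<open>so(2,1)\<close>. Such a \<open>\<phi>\<close> defines the
  equivariant tangent field \<open>X x = \<phi> x x\<close> on the hyperboloid, and
  \<open>\<theta>\<^sub>t x = \<surd>(1 + t\<^sup>2 \<langle>X x, X x\<rangle>) x + t X x\<close> is, for small \<open>t\<close>, an equivariant diffeomorphism
  isotopic to the identity. Hence \<open>u \<circ> \<theta>\<^sub>t\<^sup>-\<^sup>1\<close> is homotopic to \<open>u\<close>. Changing variables, its
  energy becomes the integral over \<open>M\<close> of the density formed with the metric \<open>\<theta>\<^sub>t\<^sup>* g\<close> and the
  unchanged form \<open>u\<^sup>* h\<close>, so only the smooth dependence on \<open>t\<close> of the metric has to be differentiated.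
  Although \<open>Tr Q\<^sup>p\<close> is not smooth where the eigenvalues of \<open>u\<^sup>* h\<close> vanish or coincide, it is
  differentiable at \<open>t = 0\<close> in every direction that moves the metric, with derivative \<open>p/2\<close> times
  the density of \<open>tr (W \<and> d\<phi>)\<close>, and its difference quotients are bounded by a multiple of the
  density of \<open>u\<close> itself. Dominated convergence and minimality give that the integral of
  \<open>tr (W \<and> d\<phi>)\<close> is zero.
\<close>

section \<open>Smooth functions\<close>

text \<open>Only the domain is varied because \<open>u\<close> is merely weakly differentiable,
  while \<open>T\<close> is, up to a constant, the derivative of the energy density with respect to
  the metric of \<open>M\<close>. The form W appears through d(\<phi> x) = (d\<phi>) x + \<phi> dx.
  The second term is an infinitesimal isometry and does not change the metric to first order; the
  first is what tr (W \<and> d\<phi>) sees, because tr ((v \<times> x) B) = 2 <v, B x> for B in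
  so(2,1). Testing with a section of ad(F) thus amounts to testing with a vector field. The closed
  formula for \<theta> replaces the flow of that field: the square root is the factor that keeps
  points on the hyperboloid, and the dependence on t is explicit. The price is that invertibility
  has to be proved by hand. A further obstacle is that \<theta> does not preserve the fundamental
  domain on which all integrals are taken, so its preimage is moved back by \<Gamma> piece by piece.
  An inequality is enough there, since minimality only calls for an upper bound of the energy of the
  competitor.\<close>

lemma partial_eqI: "(f has_derivative f') (at y) \<Longrightarrow> partial i f y = f' (axis i 1)"
  unfolding partial_def by (metis frechet_derivative_at)

lemma has_derivative_partial:
  assumes "f differentiable (at y)"
  shows "(f has_derivative (\<lambda>v. \<Sum>i\<in>UNIV. v$i *\<^sub>R partial i f y)) (at y)"
proof -
  let ?D = "frechet_derivative f (at y)"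
  have D: "(f has_derivative ?D) (at y)" using assms frechet_derivative_works by blast
  have "?D v = (\<Sum>i\<in>UNIV. v$i *\<^sub>R partial i f y)" for v
  proof -
    have lin: "linear ?D" using D has_derivative_linear by blast
    have "?D v = ?D (\<Sum>i\<in>UNIV. v$i *\<^sub>R axis i 1)"
      using basis_expansion[of v] by (simp add: scalar_mult_eq_scaleR)
    also have "\<dots> = (\<Sum>i\<in>UNIV. v$i *\<^sub>R partial i f y)"
      by (simp add: linear_sum[OF lin] linear_cmul[OF lin] partial_def)
    finally show ?thesis .
  qed
  then show ?thesis using D by (metis (no_types, lifting) ext)
qed

text \<open>Closure properties are proved for finitely many derivatives, by induction on the order:
  the partial derivatives of a product or a composite are sums of products, which leads out of the
  shape that a direct coinduction on \<open>smooth\<close> would need.\<close>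

primrec Ck :: "nat \<Rightarrow> (real^2 \<Rightarrow> 'b::real_normed_vector) \<Rightarrow> bool" where
  "Ck 0 f = True"
| "Ck (Suc k) f = ((\<forall>y. f differentiable (at y)) \<and> (\<forall>i. Ck k (partial i f)))"

lemma smooth_imp_Ck: "smooth f \<Longrightarrow> Ck k f"
  by (induction k arbitrary: f) (auto elim: smooth.cases)

lemma smooth_iff_Ck: "smooth f \<longleftrightarrow> (\<forall>k. Ck k f)"
proof
  assume "\<forall>k. Ck k f"
  then show "smooth f"
  proof (coinduction arbitrary: f)
    case smooth
    then have "\<forall>k. Ck (Suc k) f" by blast
    then show ?case by auto
  qed
qed (simp add: smooth_imp_Ck)

lemma smooth_differentiable: "smooth f \<Longrightarrow> f differentiable (at y)"
  by (auto elim: smooth.cases)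

lemma smooth_partial: "smooth f \<Longrightarrow> smooth (partial i f)"
  by (auto elim: smooth.cases)

lemma smooth_has_derivative:
  "smooth f \<Longrightarrow> (f has_derivative (\<lambda>v. \<Sum>i\<in>UNIV. v$i *\<^sub>R partial i f y)) (at y)"
  by (simp add: has_derivative_partial smooth_differentiable)

lemma smooth_continuous: "smooth f \<Longrightarrow> continuous_on S f"
  by (meson continuous_at_imp_continuous_on differentiable_imp_continuous_within smooth_differentiable)

lemma Ck_mono: "Ck (Suc k) f \<Longrightarrow> Ck k f"
  by (induction k arbitrary: f) auto

lemma Ck_const: "Ck k (\<lambda>y. c)"
proof (induction k arbitrary: c)
  case (Suc k)
  have "partial i (\<lambda>y. c) = (\<lambda>y. 0)" for i
    by (rule ext, rule partial_eqI) (rule has_derivative_const)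
  then show ?case using Suc by simp
qed simp

lemma smooth_const [intro]: "smooth (\<lambda>y. c)"
  by (simp add: smooth_iff_Ck Ck_const)

lemma partial_add:
  assumes "f differentiable (at y)" "g differentiable (at y)"
  shows "partial i (\<lambda>y. f y + g y) y = partial i f y + partial i g y"
  using partial_eqI[OF has_derivative_add[OF assms[unfolded frechet_derivative_works]]]
  by (simp add: partial_def)

lemma Ck_add: "Ck k f \<Longrightarrow> Ck k g \<Longrightarrow> Ck k (\<lambda>y. f y + g y)"
proof (induction k arbitrary: f g)
  case (Suc k)
  have "partial i (\<lambda>y. f y + g y) = (\<lambda>y. partial i f y + partial i g y)" for i
    using Suc.prems by (auto simp: partial_add)
  then show ?case using Suc by simp
qed simp

lemma smooth_add [intro]: "smooth f \<Longrightarrow> smooth g \<Longrightarrow> smooth (\<lambda>y. f y + g y)"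
  by (simp add: smooth_iff_Ck Ck_add)

lemma partial_linear:
  assumes "bounded_linear L" "f differentiable (at y)"
  shows "partial i (\<lambda>y. L (f y)) y = L (partial i f y)"
  using partial_eqI[OF bounded_linear.has_derivative[OF assms(1) assms(2)[unfolded frechet_derivative_works]]]
  by (simp add: partial_def)

lemma Ck_linear: "bounded_linear L \<Longrightarrow> Ck k f \<Longrightarrow> Ck k (\<lambda>y. L (f y))"
proof (induction k arbitrary: f)
  case (Suc k)
  have "partial i (\<lambda>y. L (f y)) = (\<lambda>y. L (partial i f y))" for i
    using Suc.prems by (auto simp: partial_linear)
  moreover have "(\<lambda>y. L (f y)) differentiable at y" for y
    using Suc.prems bounded_linear_imp_differentiable differentiable_chain_at[of f y L]
    by (auto simp: o_def)
  ultimately show ?case using Suc by simp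
qed simp

lemma smooth_linear: "bounded_linear L \<Longrightarrow> smooth f \<Longrightarrow> smooth (\<lambda>y. L (f y))"
  by (simp add: smooth_iff_Ck Ck_linear)

lemma smooth_nth [intro]: "smooth f \<Longrightarrow> smooth (\<lambda>y. f y $ j)"
  by (rule smooth_linear[OF bounded_linear_vec_nth])

lemma smooth_minus [intro]: "smooth f \<Longrightarrow> smooth (\<lambda>y. - f y)"
  by (rule smooth_linear[of uminus]) (auto intro: bounded_linear_minus bounded_linear_ident)

lemma smooth_diff [intro]: "smooth f \<Longrightarrow> smooth g \<Longrightarrow> smooth (\<lambda>y. f y - g y)"
  using smooth_add[of f "\<lambda>y. - g y"] by auto

lemma smooth_sum [intro]: "(\<And>i. i \<in> I \<Longrightarrow> smooth (f i)) \<Longrightarrow> smooth (\<lambda>y. \<Sum>i\<in>I. f i y)"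
  by (induction I rule: infinite_finite_induct) auto

lemma partial_bilinear:
  assumes "bounded_bilinear b" "f differentiable (at y)" "g differentiable (at y)"
  shows "partial i (\<lambda>y. b (f y) (g y)) y = b (f y) (partial i g y) + b (partial i f y) (g y)"
  using partial_eqI[OF bounded_bilinear.FDERIV[OF assms(1) assms(2,3)[unfolded frechet_derivative_works]]]
  by (simp add: partial_def)

lemma Ck_bilinear:
  assumes "bounded_bilinear b"
  shows "Ck k f \<Longrightarrow> Ck k g \<Longrightarrow> Ck k (\<lambda>y. b (f y) (g y))"
proof (induction k arbitrary: f g)
  case (Suc k)
  have "partial i (\<lambda>y. b (f y) (g y)) = (\<lambda>y. b (f y) (partial i g y) + b (partial i f y) (g y))" for i
    using Suc.prems by (auto simp: partial_bilinear[OF assms])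
  moreover have "(\<lambda>y. b (f y) (g y)) differentiable at y" for y
  proof -
    have "f differentiable at y" "g differentiable at y" using Suc.prems by auto
    from bounded_bilinear.FDERIV[OF assms this[unfolded frechet_derivative_works]]
    show ?thesis unfolding differentiable_def by blast
  qed
  moreover have "Ck k f" "Ck k g" using Suc.prems Ck_mono by blast+
  ultimately show ?case using Suc by (auto intro!: Ck_add)
qed simp

lemma smooth_bilinear: "bounded_bilinear b \<Longrightarrow> smooth f \<Longrightarrow> smooth g \<Longrightarrow> smooth (\<lambda>y. b (f y) (g y))"
  by (simp add: smooth_iff_Ck Ck_bilinear)

lemma smooth_mult [intro]: "smooth f \<Longrightarrow> smooth g \<Longrightarrow> smooth (\<lambda>y. f y * g y :: real)"
  by (rule smooth_bilinear[OF bounded_bilinear_mult])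

lemma smooth_scaleR [intro]: "smooth f \<Longrightarrow> smooth g \<Longrightarrow> smooth (\<lambda>y. f y *\<^sub>R g y)"
  by (rule smooth_bilinear[OF bounded_bilinear_scaleR])

lemma vec_expansion: "(\<Sum>j\<in>UNIV. (v $ j) *\<^sub>R axis j (1::real)) = v"
  using basis_expansion[of v] by (simp add: scalar_mult_eq_scaleR)

lemma smooth_vec:
  fixes f :: "real^2 \<Rightarrow> real^'n"
  assumes "\<And>j. smooth (\<lambda>y. f y $ j)"
  shows "smooth f"
proof -
  have "smooth (\<lambda>y. \<Sum>j\<in>UNIV. (f y $ j) *\<^sub>R (axis j 1 :: real^'n))"
    using assms by (intro smooth_sum smooth_scaleR smooth_const)
  moreover have "(\<lambda>y. \<Sum>j\<in>UNIV. (f y $ j) *\<^sub>R (axis j 1 :: real^'n)) = f"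
    by (rule ext) (rule vec_expansion)
  ultimately show ?thesis by simp
qed

lemma partial_nth:
  "f differentiable (at y) \<Longrightarrow> partial i (\<lambda>y. f y $ j) y = partial i f y $ j"
  by (rule partial_linear[OF bounded_linear_vec_nth])

lemma partial_compose:
  fixes \<Theta> :: "real^2 \<Rightarrow> real^2"
  assumes "g differentiable (at (\<Theta> y))" "\<Theta> differentiable (at y)"
  shows "partial i (\<lambda>y. g (\<Theta> y)) y = (\<Sum>j\<in>UNIV. (partial i \<Theta> y $ j) *\<^sub>R partial j g (\<Theta> y))"
    "((\<lambda>y. g (\<Theta> y)) differentiable (at y))"
proof -
  have D: "((\<lambda>y. g (\<Theta> y)) has_derivative
      (\<lambda>v. \<Sum>j\<in>UNIV. (frechet_derivative \<Theta> (at y) v $ j) *\<^sub>R partial j g (\<Theta> y))) (at y)"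
    using has_derivative_compose[OF assms(2)[unfolded frechet_derivative_works] has_derivative_partial[OF assms(1)]] .
  show "partial i (\<lambda>y. g (\<Theta> y)) y = (\<Sum>j\<in>UNIV. (partial i \<Theta> y $ j) *\<^sub>R partial j g (\<Theta> y))"
    using partial_eqI[OF D] by (simp add: partial_def)
  show "((\<lambda>y. g (\<Theta> y)) differentiable (at y))"
    using D differentiable_def by blast
qed

lemma Ck_sum: "(\<And>i. i \<in> I \<Longrightarrow> Ck k (f i)) \<Longrightarrow> Ck k (\<lambda>y. \<Sum>i\<in>I. f i y)"
  by (induction I rule: infinite_finite_induct) (auto simp: Ck_const Ck_add)

lemma Ck_compose:
  fixes \<Theta> :: "real^2 \<Rightarrow> real^2"
  shows "Ck k g \<Longrightarrow> smooth \<Theta> \<Longrightarrow> Ck k (\<lambda>y. g (\<Theta> y))"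
proof (induction k arbitrary: g)
  case (Suc k)
  have d: "\<Theta> differentiable (at y)" for y using Suc.prems smooth_differentiable by blast
  have "partial i (\<lambda>y. g (\<Theta> y)) = (\<lambda>y. \<Sum>j\<in>UNIV. (partial i \<Theta> y $ j) *\<^sub>R partial j g (\<Theta> y))" for i
    using Suc.prems d by (auto simp: partial_compose)
  moreover have "Ck k (\<lambda>y. \<Sum>j\<in>UNIV. (partial i \<Theta> y $ j) *\<^sub>R partial j g (\<Theta> y))" for i
  proof (intro Ck_sum Ck_bilinear[OF bounded_bilinear_scaleR])
    show "Ck k (\<lambda>y. partial i \<Theta> y $ j)" for j
      using Suc.prems by (intro smooth_imp_Ck smooth_nth smooth_partial)
    show "Ck k (\<lambda>y. partial j g (\<Theta> y))" for j
      using Suc by simp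
  qed
  ultimately show ?case using Suc.prems d by (auto intro: partial_compose)
qed simp

lemma smooth_compose:
  "smooth g \<Longrightarrow> smooth \<Theta> \<Longrightarrow> smooth (\<lambda>y. g (\<Theta> y :: real^2))"
  by (simp add: smooth_iff_Ck Ck_compose)

lemma partial_compose_real:
  assumes "(g has_real_derivative g') (at (f y))" "f differentiable (at y)"
  shows "partial i (\<lambda>y. g (f y)) y = g' * partial i f y"
    "(\<lambda>y. g (f y)) differentiable (at y)"
proof -
  have D: "((\<lambda>y. g (f y)) has_derivative (\<lambda>v. g' * frechet_derivative f (at y) v)) (at y)"
    using has_derivative_compose[OF assms(2)[unfolded frechet_derivative_works] assms(1)[unfolded has_field_derivative_def]] .
  show "partial i (\<lambda>y. g (f y)) y = g' * partial i f y"
    using partial_eqI[OF D] by (simp add: partial_def)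
  show "(\<lambda>y. g (f y)) differentiable (at y)"
    using D differentiable_def by blast
qed

text \<open>A family \<open>g\<close> that is closed under differentiation up to finite linear
  combinations gives smooth composites in a single induction. Powers shift the exponent from r to r
  - 1, exp is its own derivative, and the functions \<open>flat\<close> raise their index.\<close>

lemma smooth_compose_real:
  fixes g :: "'i \<Rightarrow> real \<Rightarrow> real"
  assumes f: "smooth f" and fS: "\<And>y. f y \<in> S"
    and g: "\<And>n x. x \<in> S \<Longrightarrow> (g n has_real_derivative (\<Sum>m\<in>I n. c n m * g m x)) (at x)"
  shows "smooth (\<lambda>y. g n (f y))"
proof -
  have "Ck k (\<lambda>y. g n (f y))" for k
  proof (induction k arbitrary: n)
    case (Suc k)
    have d: "f differentiable (at y)" for y using f smooth_differentiable by blast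
    have "partial i (\<lambda>y. g n (f y)) = (\<lambda>y. (\<Sum>m\<in>I n. c n m * g m (f y)) * partial i f y)" for i
      using partial_compose_real[OF g[OF fS] d] by blast
    moreover have "Ck k (\<lambda>y. (\<Sum>m\<in>I n. c n m * g m (f y)) * partial i f y)" for i
      using Suc f by (intro Ck_bilinear[OF bounded_bilinear_mult] Ck_sum Ck_const)
        (auto intro: smooth_imp_Ck smooth_partial)
    ultimately show ?case using partial_compose_real[OF g[OF fS] d] by simp
  qed simp
  then show ?thesis by (simp add: smooth_iff_Ck)
qed

lemma smooth_powr:
  fixes f :: "real^2 \<Rightarrow> real"
  assumes "smooth f" "\<And>y. f y > 0"
  shows "smooth (\<lambda>y. f y powr r)"
  by (rule smooth_compose_real[where g = "\<lambda>r x. x powr r" and S = "{0<..}" and I = "\<lambda>r. {r - 1}"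
        and c = "\<lambda>r _. r" and n = r and f = f])
    (use assms in \<open>auto intro: has_real_derivative_powr\<close>)

lemma smooth_sqrt: "smooth f \<Longrightarrow> (\<And>y. f y > 0) \<Longrightarrow> smooth (\<lambda>y. sqrt (f y))"
  using smooth_powr[of f "1/2"] by (simp add: powr_half_sqrt less_imp_le)

lemma smooth_exp: "smooth f \<Longrightarrow> smooth (\<lambda>y. exp (f y :: real))"
  by (rule smooth_compose_real[where g = "\<lambda>_::unit. exp" and S = UNIV and I = "\<lambda>_. {()}" and c = "\<lambda>_ _. 1"])
    auto

text \<open>\<open>flat 0\<close> is the function exp(-1/x) extended by 0. The powers of 1/x are
  included because its derivatives are linear combinations of the functions
  \<open>flat n\<close>.\<close>

definition flat :: "nat \<Rightarrow> real \<Rightarrow> real" where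
  "flat n x = (if x > 0 then inverse x ^ n * exp (- inverse x) else 0)"

lemma flat_tendsto_0: "(flat n \<longlongrightarrow> 0) (at 0)"
proof -
  have "((\<lambda>x. x ^ n / exp x) \<longlongrightarrow> (0::real)) at_top"
    by (rule tendsto_power_div_exp_0)
  then have "((\<lambda>x. inverse x ^ n / exp (inverse x)) \<longlongrightarrow> (0::real)) (at_right 0)"
    by (rule filterlim_compose) (rule filterlim_inverse_at_top_right)
  then have 1: "(flat n \<longlongrightarrow> 0) (at_right 0)"
    by (rule Lim_transform_eventually)
      (auto simp: flat_def eventually_at_filter exp_minus divide_inverse)
  have "((\<lambda>_. 0) \<longlongrightarrow> (0::real)) (at_left 0)" by simp
  then have 2: "(flat n \<longlongrightarrow> 0) (at_left 0)"
    by (rule Lim_transform_eventually) (auto simp: flat_def eventually_at_filter)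
  show ?thesis using 1 2 by (simp add: filterlim_split_at_real)
qed

lemma flat_has_derivative:
  "(flat n has_real_derivative (\<Sum>m\<in>{n+1,n+2}. (if m = n+1 then - real n else 1) * flat m x)) (at x)"
proof -
  have s: "(\<Sum>m\<in>{n+1,n+2}. (if m = n+1 then - real n else 1) * flat m x) = - real n * flat (n+1) x + flat (n+2) x"
    by simp
  consider "x > 0" | "x < 0" | "x = 0" by linarith
  then show ?thesis
  proof cases
    case 1
    have "((\<lambda>x. inverse x ^ n * exp (- inverse x)) has_real_derivative - real n * flat (n+1) x + flat (n+2) x) (at x)"
    proof -
      have "((\<lambda>x. inverse x ^ n * exp (- inverse x)) has_real_derivative
          (real n * (- (inverse x * inverse x) * inverse x ^ (n - 1))) * exp (- inverse x)
           + exp (- inverse x) * (inverse x * inverse x) * inverse x ^ n) (at x)"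
        using 1 by (auto intro!: derivative_eq_intros)
      then show ?thesis using 1 by (cases n) (simp_all add: flat_def algebra_simps)
    qed
    moreover have ev: "eventually (\<lambda>z. inverse z ^ n * exp (- inverse z) = flat n z) (nhds x)"
      using eventually_nhds_in_open[of "{0<..}" x] 1 by (auto elim!: eventually_mono simp: flat_def)
    ultimately show ?thesis unfolding s using DERIV_cong_ev[OF refl ev refl] by simp
  next
    case 2
    have ev: "eventually (\<lambda>z. 0 = flat n z) (nhds x)"
      using eventually_nhds_in_open[of "{..<0}" x] 2 by (auto elim!: eventually_mono simp: flat_def)
    moreover have "- real n * flat (n+1) x + flat (n+2) x = 0" using 2 by (simp add: flat_def)
    ultimately show ?thesis unfolding s using DERIV_cong_ev[OF refl ev refl, of 0] by simp
  next
    case 3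
    \<comment> \<open>The difference quotient of \<open>flat n\<close> at 0 is
      \<open>flat (Suc n)\<close>.\<close>
    have "((\<lambda>h. (flat n (0 + h) - flat n 0) / h) \<longlongrightarrow> 0) (at 0)"
      by (rule Lim_transform_eventually[OF flat_tendsto_0[of "Suc n"]])
        (auto simp: flat_def eventually_at_filter field_simps)
    then have "(flat n has_real_derivative 0) (at 0)" by (simp add: DERIV_def)
    moreover have "- real n * flat (n+1) x + flat (n+2) x = 0" using 3 by (simp add: flat_def)
    ultimately show ?thesis unfolding s using 3 by simp
  qed
qed

lemma smooth_flat: "smooth f \<Longrightarrow> smooth (\<lambda>y. flat n (f y))"
  by (rule smooth_compose_real[where g = flat and S = UNIV and I = "\<lambda>n. {n+1,n+2}"
        and c = "\<lambda>n m. if m = n+1 then - real n else 1"])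
    (auto intro: flat_has_derivative[simplified])

lemma smooth_id: "smooth (\<lambda>y. y)"
proof (rule smooth.intros)
  show "\<forall>i. smooth (partial i (\<lambda>y. y))"
  proof
    fix i
    have "partial i (\<lambda>y. y) = (\<lambda>y. axis i 1)"
      by (rule ext, rule partial_eqI) (rule has_derivative_ident)
    then show "smooth (partial i (\<lambda>y. y))" by auto
  qed
qed auto

lemma smooth_coord [intro]: "smooth (\<lambda>y. y $ j)"
  by (rule smooth_nth[OF smooth_id])

lemma smooth_partial_continuous: "smooth f \<Longrightarrow> continuous_on S (partial i f)"
  by (intro smooth_continuous smooth_partial)

section \<open>Symmetry of second partial derivatives\<close>

lemma has_vector_derivative_along_axis:
  fixes f :: "real^2 \<Rightarrow> real"
  assumes "smooth f"
  shows "((\<lambda>s. f (y + s *\<^sub>R axis i 1)) has_real_derivative partial i f (y + s *\<^sub>R axis i 1)) (at s)"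
proof -
  have "((\<lambda>s. y + s *\<^sub>R axis i (1::real)) has_derivative (\<lambda>s. s *\<^sub>R axis i 1)) (at s)"
    by (auto intro!: derivative_eq_intros)
  from has_derivative_compose[OF this smooth_has_derivative[OF assms]]
  show ?thesis unfolding has_field_derivative_def
    by (rule has_derivative_eq_rhs) (auto simp: fun_eq_iff UNIV_2 axis_def exhaust_2[of i] forall_2 split: if_splits intro!: exhaust_2[of i, THEN disjE])
qed

text \<open>The mean value theorem is applied to the second difference twice, in direction
  \<open>i\<close> and then in direction \<open>j\<close>. The left side is symmetric in the two
  directions while the right side is not; this yields Schwarz's theorem below.\<close>

lemma mixed_difference_quotient:
  fixes f :: "real^2 \<Rightarrow> real"
  assumes "smooth f" "h > 0"
  shows "\<exists>a b. 0 < a \<and> a < h \<and> 0 < b \<and> b < h \<and>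
    f (y + h *\<^sub>R axis i 1 + h *\<^sub>R axis j 1) - f (y + h *\<^sub>R axis i 1) - f (y + h *\<^sub>R axis j 1) + f y
      = h\<^sup>2 * partial j (partial i f) (y + a *\<^sub>R axis i 1 + b *\<^sub>R axis j 1)"
proof -
  let ?g = "\<lambda>s. f ((y + h *\<^sub>R axis j 1) + s *\<^sub>R axis i 1) - f (y + s *\<^sub>R axis i 1)"
  have "\<exists>z. 0 < z \<and> z < h \<and> ?g h - ?g 0 = (h - 0) *
      (partial i f ((y + h *\<^sub>R axis j 1) + z *\<^sub>R axis i 1) - partial i f (y + z *\<^sub>R axis i 1))"
    by (rule MVT2) (use assms in \<open>auto intro!: DERIV_diff has_vector_derivative_along_axis\<close>)
  then obtain a where a: "0 < a" "a < h" "?g h - ?g 0 = (h - 0) *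
      (partial i f ((y + h *\<^sub>R axis j 1) + a *\<^sub>R axis i 1) - partial i f (y + a *\<^sub>R axis i 1))"
    by blast
  let ?k = "\<lambda>s. partial i f ((y + a *\<^sub>R axis i 1) + s *\<^sub>R axis j 1)"
  have "\<exists>z. 0 < z \<and> z < h \<and> ?k h - ?k 0 = (h - 0) *
      (partial j (partial i f) ((y + a *\<^sub>R axis i 1) + z *\<^sub>R axis j 1))"
    by (rule MVT2) (use assms in \<open>auto intro!: has_vector_derivative_along_axis smooth_partial\<close>)
  then obtain b where b: "0 < b" "b < h" "?k h - ?k 0 = (h - 0) *
      (partial j (partial i f) ((y + a *\<^sub>R axis i 1) + b *\<^sub>R axis j 1))"
    by blast
  have "?g h - ?g 0 = h * (?k h - ?k 0)" using a(3) by (simp add: add_ac)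
  then have "?g h - ?g 0 = h * (h * partial j (partial i f) ((y + a *\<^sub>R axis i 1) + b *\<^sub>R axis j 1))"
    using b(3) by simp
  then have "f (y + h *\<^sub>R axis i 1 + h *\<^sub>R axis j 1) - f (y + h *\<^sub>R axis i 1) - f (y + h *\<^sub>R axis j 1) + f y
      = h\<^sup>2 * partial j (partial i f) (y + a *\<^sub>R axis i 1 + b *\<^sub>R axis j 1)"
    by (simp add: power2_eq_square add_ac)
  then show ?thesis using a(1,2) b(1,2) by blast
qed

text \<open>For every small \<open>h\<close> the two mixed derivatives take equal values at two
  points near \<open>y\<close>. By continuity both values are closer than \<open>e\<close>, half of
  the supposed gap, to those at \<open>y\<close>, which is absurd.\<close>

lemma partial_commute_real:
  fixes f :: "real^2 \<Rightarrow> real"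
  assumes "smooth f"
  shows "partial i (partial j f) y = partial j (partial i f) y"
proof (rule ccontr)
  let ?A = "partial i (partial j f)" and ?B = "partial j (partial i f)"
  assume ne: "?A y \<noteq> ?B y"
  define e where "e = \<bar>?A y - ?B y\<bar> / 2"
  have e: "e > 0" using ne by (simp add: e_def)
  have "isCont ?A y" "isCont ?B y"
    by (intro differentiable_imp_continuous_within smooth_differentiable smooth_partial assms)+
  then obtain d1 d2 where d: "d1 > 0" "d2 > 0" "\<And>x. dist x y < d1 \<Longrightarrow> dist (?A x) (?A y) < e"
      "\<And>x. dist x y < d2 \<Longrightarrow> dist (?B x) (?B y) < e"
    using e unfolding continuous_at_eps_delta by blast
  define h where "h = min d1 d2 / 2"
  have h: "h > 0" using d by (simp add: h_def)
  have near: "dist (y + a *\<^sub>R axis k 1 + b *\<^sub>R axis l 1) y < min d1 d2"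
    if "0 < a" "a < h" "0 < b" "b < h" for a b :: real and k l :: 2
  proof -
    have "norm (a *\<^sub>R (axis k 1 :: real^2) + b *\<^sub>R axis l 1) \<le> a + b"
      using norm_triangle_ineq[of "a *\<^sub>R (axis k 1 :: real^2)" "b *\<^sub>R axis l 1"] that by simp
    then show ?thesis using that by (simp add: dist_norm h_def add.assoc)
  qed
  obtain a b where 1: "0 < a" "a < h" "0 < b" "b < h"
    "f (y + h *\<^sub>R axis i 1 + h *\<^sub>R axis j 1) - f (y + h *\<^sub>R axis i 1) - f (y + h *\<^sub>R axis j 1) + f y
      = h\<^sup>2 * ?B (y + a *\<^sub>R axis i 1 + b *\<^sub>R axis j 1)"
    using mixed_difference_quotient[OF assms h, of y i j] by blast
  obtain a' b' where 2: "0 < a'" "a' < h" "0 < b'" "b' < h"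
    "f (y + h *\<^sub>R axis j 1 + h *\<^sub>R axis i 1) - f (y + h *\<^sub>R axis j 1) - f (y + h *\<^sub>R axis i 1) + f y
      = h\<^sup>2 * ?A (y + a' *\<^sub>R axis j 1 + b' *\<^sub>R axis i 1)"
    using mixed_difference_quotient[OF assms h, of y j i] by blast
  have "h\<^sup>2 * ?B (y + a *\<^sub>R axis i 1 + b *\<^sub>R axis j 1) = h\<^sup>2 * ?A (y + a' *\<^sub>R axis j 1 + b' *\<^sub>R axis i 1)"
    using 1(5) 2(5) by (simp only: add.assoc add.commute[of "h *\<^sub>R axis i 1" "h *\<^sub>R axis j 1"])
  then have "?B (y + a *\<^sub>R axis i 1 + b *\<^sub>R axis j 1) = ?A (y + a' *\<^sub>R axis j 1 + b' *\<^sub>R axis i 1)"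
    using h by simp
  moreover have "dist (?B (y + a *\<^sub>R axis i 1 + b *\<^sub>R axis j 1)) (?B y) < e"
    using d(4)[of "y + a *\<^sub>R axis i 1 + b *\<^sub>R axis j 1"] near[OF 1(1-4)] by simp
  moreover have "dist (?A (y + a' *\<^sub>R axis j 1 + b' *\<^sub>R axis i 1)) (?A y) < e"
    using d(3)[of "y + a' *\<^sub>R axis j 1 + b' *\<^sub>R axis i 1"] near[OF 2(1-4)] by simp
  ultimately show False unfolding e_def dist_real_def by argo
qed

section \<open>Diffeomorphisms and change of variables\<close>

definition jac :: "(real^2 \<Rightarrow> real^2) \<Rightarrow> real^2 \<Rightarrow> real^2^2" where
  "jac \<Theta> y = (\<chi> j i. partial i \<Theta> y $ j)"

text \<open>Smoothness of the inverse is not part of the notion: the variations below are inverted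
  by injectivity and surjectivity alone. Continuity of \<open>\<Psi>\<close> follows from invariance
  of domain, and the rules for weak derivatives never differentiate it. The positive determinant
  avoids absolute values.\<close>

definition diffeo :: "(real^2 \<Rightarrow> real^2) \<Rightarrow> (real^2 \<Rightarrow> real^2) \<Rightarrow> bool" where
  "diffeo \<Theta> \<Psi> \<longleftrightarrow> smooth \<Theta> \<and> (\<forall>y. \<Theta> (\<Psi> y) = y) \<and> (\<forall>y. \<Psi> (\<Theta> y) = y) \<and> (\<forall>y. det (jac \<Theta> y) > 0)"

lemma diffeo_continuous_inverse:
  assumes "diffeo \<Theta> \<Psi>"
  shows "continuous_on UNIV \<Psi>"
proof -
  have "continuous_on (\<Theta> ` UNIV) \<Psi>"
    using assms by (intro continuous_on_inverse_open) (auto simp: diffeo_def smooth_continuous)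
  moreover have "\<Theta> ` UNIV = UNIV"
    using assms unfolding diffeo_def by (metis surjI)
  ultimately show ?thesis by simp
qed

lemma matrix_derivative_eq_jac:
  "matrix (\<lambda>v. \<Sum>i\<in>UNIV. v$i *\<^sub>R partial i \<Theta> y) = jac \<Theta> y"
proof -
  have "(\<Sum>i\<in>UNIV. axis k 1 $ i *\<^sub>R partial i \<Theta> y) = partial k \<Theta> y" for k :: 2
    using exhaust_2[of k] by (auto simp: UNIV_2 axis_def)
  then show ?thesis
    by (simp add: matrix_def jac_def vec_eq_iff)
qed

lemma jac_continuous:
  assumes "smooth \<Theta>"
  shows "continuous_on S (\<lambda>y. det (jac \<Theta> y))"
  unfolding det_2 jac_def
  by (simp, intro continuous_intros smooth_partial_continuous assms)

text \<open>Lebesgue measure is determined by its values on boxes, so the change of variables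
  formula for the constant 1 on preimages of boxes gives it for all Borel functions.\<close>

lemma lborel_eq_distr_diffeo:
  assumes "diffeo \<Theta> \<Psi>"
  shows "lborel = distr (density lborel (\<lambda>z. ennreal (det (jac \<Theta> z)))) borel \<Theta>"
proof (rule lborel_eqI)
  have sm: "smooth \<Theta>" and inv: "\<And>y. \<Theta> (\<Psi> y) = y" "\<And>y. \<Psi> (\<Theta> y) = y" and pos: "\<And>y. det (jac \<Theta> y) > 0"
    using assms by (auto simp: diffeo_def)
  have cont: "continuous_on UNIV \<Theta>" using sm smooth_continuous by blast
  have [measurable]: "\<Theta> \<in> borel_measurable borel" "(\<lambda>y. det (jac \<Theta> y)) \<in> borel_measurable borel"
    using cont jac_continuous[OF sm] by (auto intro: borel_measurable_continuous_onI)
  fix l u :: "real^2" assume lu: "\<And>b. b \<in> Basis \<Longrightarrow> l \<bullet> b \<le> u \<bullet> b"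
  let ?B = "box l u" and ?S = "\<Theta> -` box l u"
  let ?D = "\<lambda>z. \<bar>det (matrix (\<lambda>v. \<Sum>i\<in>UNIV. v$i *\<^sub>R partial i \<Theta> z))\<bar> *\<^sub>R (1::real^1)"
  have "open ?S" using cont open_vimage by blast
  then have S: "?S \<in> sets lebesgue" by (simp add: borel_open)
  have im: "\<Theta> ` ?S = ?B" using inv by (auto simp: image_iff) metis
  have B: "((\<lambda>_. 1::real^1) absolutely_integrable_on ?B)"
    by (rule absolutely_integrable_on_const) simp
  have "?D absolutely_integrable_on ?S \<and> integral ?S ?D = integral ?B (\<lambda>_. 1::real^1)"
  proof -
    have "inj_on \<Theta> ?S" using inv by (intro inj_on_inverseI)
    from has_absolute_integral_change_of_variables[OF S has_derivative_at_withinI[OF smooth_has_derivative[OF sm]] this,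
        of "\<lambda>_. 1::real^1" "integral ?B (\<lambda>_. 1::real^1)"]
    show ?thesis using B unfolding im by simp
  qed
  then have D: "(?D has_integral integral ?B (\<lambda>_. 1::real^1)) ?S"
    using set_lebesgue_integral_eq_integral(1)[of ?S ?D] integrable_integral[of ?D ?S] by argo
  have I: "((\<lambda>z. ?D z $ 1) has_integral integral ?B (\<lambda>_. 1::real^1) $ 1) ?S"
    using has_integral_linear[OF D bounded_linear_vec_nth[of 1]] unfolding o_def .
  have B1: "((\<lambda>_. 1::real^1) has_integral integral ?B (\<lambda>_. 1::real^1)) ?B"
    using set_lebesgue_integral_eq_integral(1)[OF B] by (rule integrable_integral)
  have "((\<lambda>_. 1::real) has_integral integral ?B (\<lambda>_. 1::real^1) $ 1) ?B"
    using has_integral_linear[OF B1 bounded_linear_vec_nth[of 1]] by (simp add: o_def)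
  then have "integral ?B (\<lambda>_. 1::real^1) $ 1 = measure lebesgue ?B"
    using lmeasure_integral[of ?B] integral_unique[of "\<lambda>_. 1::real" _ ?B] by (metis lmeasurable_box)
  moreover have "measure lebesgue ?B = (\<Prod>b\<in>Basis. (u - l) \<bullet> b)"
    using lu by (simp add: measure_lborel_box)
  moreover have "(\<lambda>z. ?D z $ 1) = (\<lambda>z. det (jac \<Theta> z))"
    using pos by (auto simp: matrix_derivative_eq_jac less_imp_le)
  ultimately have "((\<lambda>z. det (jac \<Theta> z)) has_integral (\<Prod>b\<in>Basis. (u - l) \<bullet> b)) ?S"
    using I by simp
  then have "integral\<^sup>N lborel (\<lambda>z. ennreal (det (jac \<Theta> z)) * indicator ?S z) = ennreal (\<Prod>b\<in>Basis. (u - l) \<bullet> b)"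
    using pos by (intro nn_integral_has_integral_lebesgue') (auto simp: less_imp_le)
  then show "emeasure (distr (density lborel (\<lambda>z. ennreal (det (jac \<Theta> z)))) borel \<Theta>) ?B = (\<Prod>b\<in>Basis. (u - l) \<bullet> b)"
    using measurable_sets_borel[of \<Theta> borel ?B]
    by (simp add: emeasure_distr emeasure_density)
qed simp

lemma nn_integral_diffeo:
  assumes "diffeo \<Theta> \<Psi>" and [measurable]: "f \<in> borel_measurable borel"
  shows "(\<integral>\<^sup>+ y. f y \<partial>lborel) = (\<integral>\<^sup>+ z. ennreal (det (jac \<Theta> z)) * f (\<Theta> z) \<partial>lborel)"
proof -
  have sm: "smooth \<Theta>" using assms by (auto simp: diffeo_def)
  have [measurable]: "\<Theta> \<in> borel_measurable borel" "(\<lambda>y. det (jac \<Theta> y)) \<in> borel_measurable borel"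
    using smooth_continuous[OF sm] jac_continuous[OF sm] by (auto intro: borel_measurable_continuous_onI)
  show ?thesis
    by (subst lborel_eq_distr_diffeo[OF assms(1)])
      (simp add: nn_integral_distr nn_integral_density)
qed

lemma integral_diffeo:
  fixes f :: "real^2 \<Rightarrow> 'b::euclidean_space"
  assumes "diffeo \<Theta> \<Psi>" and [measurable]: "f \<in> borel_measurable borel"
  shows "(LINT y|lborel. f y) = (LINT z|lborel. det (jac \<Theta> z) *\<^sub>R f (\<Theta> z))"
    and "integrable lborel f \<longleftrightarrow> integrable lborel (\<lambda>z. det (jac \<Theta> z) *\<^sub>R f (\<Theta> z))"
proof -
  have sm: "smooth \<Theta>" and pos: "\<And>y. det (jac \<Theta> y) \<ge> 0" using assms by (auto simp: diffeo_def less_imp_le)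
  have [measurable]: "\<Theta> \<in> borel_measurable borel" "(\<lambda>y. det (jac \<Theta> y)) \<in> borel_measurable borel"
    using smooth_continuous[OF sm] jac_continuous[OF sm] by (auto intro: borel_measurable_continuous_onI)
  show "(LINT y|lborel. f y) = (LINT z|lborel. det (jac \<Theta> z) *\<^sub>R f (\<Theta> z))"
    by (subst lborel_eq_distr_diffeo[OF assms(1)])
      (simp add: integral_distr integral_density pos)
  show "integrable lborel f \<longleftrightarrow> integrable lborel (\<lambda>z. det (jac \<Theta> z) *\<^sub>R f (\<Theta> z))"
    by (subst lborel_eq_distr_diffeo[OF assms(1)])
      (simp add: integrable_distr_eq integrable_density pos)
qed

section \<open>Weak derivatives\<close>

definition locally_integrable :: "(real^2 \<Rightarrow> 'b::euclidean_space) \<Rightarrow> bool" where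
  "locally_integrable f \<longleftrightarrow> (\<forall>K. compact K \<longrightarrow> set_integrable lborel K f)"

lemma locally_integrable_measurable:
  assumes "locally_integrable f"
  shows "f \<in> borel_measurable borel"
proof (rule borel_measurable_LIMSEQ_metric)
  show "(\<lambda>y. indicat_real (cball 0 (real n)) y *\<^sub>R f y) \<in> borel_measurable borel" for n
    using assms borel_measurable_integrable[of lborel "\<lambda>y. indicat_real (cball 0 (real n)) y *\<^sub>R f y"]
    unfolding locally_integrable_def set_integrable_def by simp
  fix y :: "real^2"
  obtain N :: nat where N: "norm y \<le> N" using real_arch_simple by blast
  show "(\<lambda>n. indicat_real (cball 0 (real n)) y *\<^sub>R f y) \<longlonglongrightarrow> f y"
    by (rule tendsto_eventually)
      (use N in \<open>auto simp: eventually_sequentially intro!: exI[of _ N]\<close>)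
qed

lemma integrable_compact_mult:
  fixes f :: "real^2 \<Rightarrow> 'b::euclidean_space"
  assumes "locally_integrable f" "continuous_on UNIV c" "compact K"
  shows "integrable lborel (\<lambda>y. indicat_real K y *\<^sub>R c y *\<^sub>R f y)"
proof -
  have [measurable]: "f \<in> borel_measurable borel" "c \<in> borel_measurable borel" "K \<in> sets borel"
    using assms locally_integrable_measurable borel_measurable_continuous_onI borel_compact by auto
  have "bounded (c ` K)"
    using compact_imp_bounded[OF compact_continuous_image[OF continuous_on_subset[OF assms(2)] assms(3)]] by simp
  then obtain B where B: "\<And>y. y \<in> K \<Longrightarrow> \<bar>c y\<bar> \<le> B" by (auto simp: bounded_iff)
  have "integrable lborel (\<lambda>y. B *\<^sub>R indicat_real K y *\<^sub>R f y)"
    using assms unfolding locally_integrable_def set_integrable_def by (intro integrable_scaleR_right) blast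
  then show ?thesis
  proof (rule Bochner_Integration.integrable_bound)
    show "AE y in lborel. norm (indicat_real K y *\<^sub>R c y *\<^sub>R f y) \<le> norm (B *\<^sub>R indicat_real K y *\<^sub>R f y)"
    proof (intro AE_I2)
      fix y
      have "\<bar>c y\<bar> \<le> \<bar>B\<bar>" if "y \<in> K" using B[OF that] by linarith
      then show "norm (indicat_real K y *\<^sub>R c y *\<^sub>R f y) \<le> norm (B *\<^sub>R indicat_real K y *\<^sub>R f y)"
        by (auto simp: indicator_def intro!: mult_right_mono)
    qed
  qed simp
qed

lemma integrable_mult_bounded_support:
  fixes f :: "real^2 \<Rightarrow> 'b::euclidean_space"
  assumes "locally_integrable f" "continuous_on UNIV c" "bounded {y. c y \<noteq> 0}"
  shows "integrable lborel (\<lambda>y. c y *\<^sub>R f y)"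
proof -
  obtain R where R: "\<And>y. c y \<noteq> 0 \<Longrightarrow> norm y \<le> R" using assms(3) by (auto simp: bounded_iff)
  have "(\<lambda>y. indicat_real (cball 0 R) y *\<^sub>R c y *\<^sub>R f y) = (\<lambda>y. c y *\<^sub>R f y)"
    using R by (auto simp: indicator_def fun_eq_iff)
  then show ?thesis
    using integrable_compact_mult[OF assms(1,2) compact_cball[of 0 R]] by simp
qed

text \<open>The product of the flat functions is smooth and positive exactly on the open box. With
  this product in the exponent the functions stay between 0 and 1, vanish outside the box, and tend
  to its indicator as \<open>n\<close> grows.\<close>

definition bump :: "real^2 \<Rightarrow> real^2 \<Rightarrow> nat \<Rightarrow> real^2 \<Rightarrow> real" where
  "bump l u n y = 1 - exp (- real n * (\<Prod>i\<in>UNIV. flat 0 (y$i - l$i) * flat 0 (u$i - y$i)))"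

lemma smooth_bump: "smooth (bump l u n)"
proof -
  have "smooth (\<lambda>y::real^2. flat 0 (y$i - l$i) * flat 0 (u$i - y$i))" for i
    by (intro smooth_mult smooth_flat smooth_diff smooth_coord smooth_const)
  then have "smooth (\<lambda>y::real^2. \<Prod>i\<in>UNIV. flat 0 (y$i - l$i) * flat 0 (u$i - y$i))"
    unfolding UNIV_2 by auto
  then have "smooth (\<lambda>y. 1 - exp (- real n * (\<Prod>i\<in>UNIV. flat 0 (y$i - l$i) * flat 0 (u$i - y$i))))"
    by (intro smooth_diff smooth_const smooth_exp smooth_mult)
  then show ?thesis by (simp add: bump_def[abs_def])
qed

lemma flat_pos_iff: "flat n x > 0 \<longleftrightarrow> x > 0" and flat_nonneg: "flat n x \<ge> 0"
  by (auto simp: flat_def)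

lemma bump_bounds: "0 \<le> bump l u n y" "bump l u n y \<le> 1"
  by (auto simp: bump_def intro!: prod_nonneg mult_nonneg_nonneg flat_nonneg)

lemma mem_box_2: "y \<in> box l u \<longleftrightarrow> (\<forall>i. l$i < y$i \<and> y$i < u$i)" for y :: "real^2"
  by (auto simp: mem_box_cart)

lemma bump_outside: "y \<notin> box l u \<Longrightarrow> bump l u n y = 0"
proof -
  assume "y \<notin> box l u"
  then obtain i where "\<not> (l$i < y$i \<and> y$i < u$i)" by (auto simp: mem_box_2)
  then have "flat 0 (y$i - l$i) * flat 0 (u$i - y$i) = 0" by (auto simp: flat_def)
  then have "(\<Prod>i\<in>UNIV. flat 0 (y$i - l$i) * flat 0 (u$i - y$i)) = 0"
    by (intro prod_zero) auto
  then show ?thesis by (simp add: bump_def)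
qed

lemma bump_tendsto: "(\<lambda>n. bump l u n y) \<longlonglongrightarrow> indicator (box l u) y"
proof (cases "y \<in> box l u")
  case True
  define h where "h = (\<Prod>i\<in>UNIV. flat 0 (y$i - l$i) * flat 0 (u$i - y$i))"
  have "h > 0" unfolding h_def using True
    by (intro prod_pos) (auto simp: mem_box_2 flat_pos_iff)
  then have "filterlim (\<lambda>n. real n * h) at_top sequentially"
    by (intro filterlim_at_top_mult_tendsto_pos[OF tendsto_const] filterlim_real_sequentially)
  then have "(\<lambda>n. exp (- (real n * h))) \<longlonglongrightarrow> 0"
    by (intro filterlim_compose[OF exp_at_bot]) (simp add: filterlim_uminus_at_top[symmetric])
  then have "(\<lambda>n. 1 - exp (- (real n * h))) \<longlonglongrightarrow> 1 - 0"
    by (intro tendsto_intros)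
  then show ?thesis using True by (simp add: bump_def h_def)
qed (simp add: bump_outside)

lemma set_integral_box_eq_0:
  fixes g :: "real^2 \<Rightarrow> 'b::euclidean_space"
  assumes g: "locally_integrable g"
    and 0: "\<And>\<eta>. smooth \<eta> \<Longrightarrow> bounded {y. \<eta> y \<noteq> 0} \<Longrightarrow> (LINT y|lborel. \<eta> y *\<^sub>R g y) = 0"
  shows "(LINT y|lborel. indicat_real (box l u) y *\<^sub>R g y) = 0"
proof -
  have [measurable]: "g \<in> borel_measurable borel" using g locally_integrable_measurable by blast
  have [measurable]: "bump l u n \<in> borel_measurable borel" for n
    by (intro borel_measurable_continuous_onI smooth_continuous smooth_bump)
  have "(\<lambda>n. LINT y|lborel. bump l u n y *\<^sub>R g y) \<longlonglongrightarrow> (LINT y|lborel. indicat_real (box l u) y *\<^sub>R g y)"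
  proof (rule integral_dominated_convergence)
    show "integrable lborel (\<lambda>y. norm (indicat_real (cbox l u) y *\<^sub>R g y))"
      using g unfolding locally_integrable_def set_integrable_def by (intro integrable_norm) auto
    show "AE y in lborel. (\<lambda>n. bump l u n y *\<^sub>R g y) \<longlonglongrightarrow> indicat_real (box l u) y *\<^sub>R g y"
      by (intro AE_I2 tendsto_scaleR bump_tendsto tendsto_const)
    show "AE y in lborel. norm (bump l u n y *\<^sub>R g y) \<le> norm (indicat_real (cbox l u) y *\<^sub>R g y)" for n
    proof (intro AE_I2)
      fix y
      show "norm (bump l u n y *\<^sub>R g y) \<le> norm (indicat_real (cbox l u) y *\<^sub>R g y)"
        using bump_outside[of y l u n] bump_bounds[of l u n y] box_subset_cbox[of l u]
        by (cases "y \<in> box l u") (auto simp: indicator_def mult_left_le_one_le)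
    qed
  qed auto
  moreover have "(LINT y|lborel. bump l u n y *\<^sub>R g y) = 0" for n
  proof (rule 0[OF smooth_bump])
    have "{y. bump l u n y \<noteq> 0} \<subseteq> box l u" using bump_outside by blast
    then show "bounded {y. bump l u n y \<noteq> 0}" using bounded_box bounded_subset by blast
  qed
  ultimately show ?thesis by (simp add: LIMSEQ_const_iff)
qed

text \<open>The fundamental lemma of the calculus of variations. Bump functions give vanishing
  integrals over boxes, and since boxes form an intersection-stable generator this extends to all
  Borel sets. The truncation to growing boxes makes \<open>g\<close> integrable.\<close>

lemma AE_zero_if_tests_zero:
  fixes g :: "real^2 \<Rightarrow> 'b::euclidean_space"
  assumes g: "locally_integrable g"
    and 0: "\<And>\<eta>. smooth \<eta> \<Longrightarrow> bounded {y. \<eta> y \<noteq> 0} \<Longrightarrow> (LINT y|lborel. \<eta> y *\<^sub>R g y) = 0"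
  shows "AE y in lborel. g y = 0"
proof -
  have [measurable]: "g \<in> borel_measurable borel" using g locally_integrable_measurable by blast
  have sets_box: "sets lborel = sigma_sets UNIV (range (\<lambda>(a, b). box a b :: (real^2) set))"
    by (simp add: borel_eq_box)
  have "AE y in lborel. indicat_real (box (- vec (real N)) (vec (real N))) y *\<^sub>R g y = 0" for N :: nat
  proof (rule sigma_finite_measure.density_zero[OF lborel.sigma_finite_measure_axioms])
    let ?B = "box (- vec (real N)) (vec (real N)) :: (real^2) set"
    let ?g = "\<lambda>y. indicat_real ?B y *\<^sub>R g y"
    have "integrable lborel (\<lambda>y. indicat_real (cbox (- vec (real N)) (vec (real N))) y *\<^sub>R g y)"
      using g unfolding locally_integrable_def set_integrable_def by auto
    then show int: "integrable lborel ?g"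
      using box_subset_cbox[of "- vec (real N)" "vec (real N) :: real^2"]
      by (rule_tac Bochner_Integration.integrable_bound) (auto simp: indicator_def intro!: AE_I2)
    have boxes: "(LINT y|lborel. indicat_real (box l u) y *\<^sub>R ?g y) = 0" for l u
    proof -
      obtain l' u' where *: "box l u \<inter> ?B = box l' u'" using box_Int_box by blast
      have "indicat_real (box l u) y *\<^sub>R ?g y = indicat_real (box l' u') y *\<^sub>R g y" for y
        unfolding *[symmetric] by (simp add: indicator_inter_arith)
      then show ?thesis using set_integral_box_eq_0[OF assms, of l' u'] by presburger
    qed
    fix A :: "(real^2) set" assume "A \<in> sets lborel"
    then have A: "A \<in> sigma_sets UNIV (range (\<lambda>(a, b). box a b))"
      by (simp only: sets_box)
    have st: "Int_stable (range (\<lambda>(a, b). box a b :: (real^2) set))"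
      by (auto simp: Int_stable_def box_Int_box)
    have "range (\<lambda>(a, b). box a b :: (real^2) set) \<subseteq> Pow UNIV" by simp
    from st this A show "set_lebesgue_integral lborel A ?g = 0"
    proof (induction rule: sigma_sets_induct_disjoint)
      case (basic A)
      then show ?case using boxes by (auto simp: set_lebesgue_integral_def)
    next
      case empty
      then show ?case by (simp add: set_lebesgue_integral_def)
    next
      case (compl A)
      have A: "A \<in> sets lborel" using compl by (simp only: sets_box)
      have iA: "integrable lborel (\<lambda>y. indicat_real A y *\<^sub>R ?g y)"
        using integrable_mult_indicator[OF A int] .
      have tot: "(LINT y|lborel. ?g y) = 0"
        using set_integral_box_eq_0[OF assms] by simp
      have "(\<lambda>y. indicat_real (UNIV - A) y *\<^sub>R ?g y) = (\<lambda>y. ?g y - indicat_real A y *\<^sub>R ?g y)"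
        by (auto simp: indicator_def fun_eq_iff)
      then show ?case using compl tot int iA
        by (simp add: set_lebesgue_integral_def Bochner_Integration.integral_diff)
    next
      case (union A)
      have A: "A i \<in> sets lborel" for i
        using union(2) by (simp only: sets_box) blast
      have "(\<Union>i. A i) \<in> sets lborel" using A by (intro sets.countable_UN) blast
      then have "set_integrable lborel (\<Union>i. A i) ?g"
        unfolding set_integrable_def by (rule integrable_mult_indicator[OF _ int])
      then have "set_lebesgue_integral lborel (\<Union>i. A i) ?g = (\<Sum>i. set_lebesgue_integral lborel (A i) ?g)"
        using A union(1) by (intro lebesgue_integral_countable_add) (simp_all add: disjoint_family_on_def)
      then show ?case using union by simp
    qed
  qed
  then have "AE y in lborel. \<forall>N. indicat_real (box (- vec (real N)) (vec (real N))) y *\<^sub>R g y = 0"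
    unfolding AE_all_countable by blast
  then show ?thesis
  proof (rule AE_mp, intro AE_I2 impI)
    fix y :: "real^2" assume *: "\<forall>N. indicat_real (box (- vec (real N)) (vec (real N))) y *\<^sub>R g y = 0"
    obtain N :: nat where "norm y < N" using reals_Archimedean2 by blast
    then have "\<bar>y$i\<bar> < N" for i using component_le_norm_cart[of y i] by linarith
    then have "- real N < y$i \<and> y$i < real N" for i by (simp add: abs_less_iff minus_less_iff)
    then have "y \<in> box (- vec (real N)) (vec (real N))" by (simp add: mem_box_2)
    then show "g y = 0" using *[rule_format, of N] by simp
  qed
qed

section \<open>Uniqueness and transformation of weak derivatives\<close>

lemma weak_partial_locally_integrable:
  "weak_partial i f w \<Longrightarrow> locally_integrable f" "weak_partial i f w \<Longrightarrow> locally_integrable w"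
  by (auto simp: weak_partial_def locally_integrable_def)

lemma weak_partial_unique:
  assumes "weak_partial i f w" "weak_partial i f w'"
  shows "AE y in lborel. w y = w' y"
proof -
  have li: "locally_integrable w" "locally_integrable w'"
    using assms weak_partial_locally_integrable by blast+
  have "AE y in lborel. w y - w' y = 0"
  proof (rule AE_zero_if_tests_zero)
    show "locally_integrable (\<lambda>y. w y - w' y)"
      using li by (auto simp: locally_integrable_def)
    fix \<eta> :: "real^2 \<Rightarrow> real" assume \<eta>: "smooth \<eta>" "bounded {y. \<eta> y \<noteq> 0}"
    have "(LINT y|lborel. \<eta> y *\<^sub>R w y) = (LINT y|lborel. \<eta> y *\<^sub>R w' y)"
      using assms \<eta> unfolding weak_partial_def by auto
    then show "(LINT y|lborel. \<eta> y *\<^sub>R (w y - w' y)) = 0"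
      using integrable_mult_bounded_support[OF li(1) smooth_continuous \<eta>(2)]
        integrable_mult_bounded_support[OF li(2) smooth_continuous \<eta>(2)] \<eta>(1)
      by (simp add: scaleR_diff_right)
  qed
  then show ?thesis by (rule AE_mp) (auto intro!: AE_I2)
qed

lemma partial_bounded_support:
  fixes \<eta> :: "real^2 \<Rightarrow> real"
  assumes "bounded {y. \<eta> y \<noteq> 0}"
  shows "bounded {y. partial i \<eta> y \<noteq> 0}"
proof -
  have "partial i \<eta> y = 0" if "y \<notin> closure {y. \<eta> y \<noteq> 0}" for y
  proof (rule partial_eqI)
    have "eventually (\<lambda>z. z \<in> - closure {y. \<eta> y \<noteq> 0}) (nhds y)"
      using that by (intro eventually_nhds_in_open) auto
    then have "eventually (\<lambda>z. \<eta> z = 0) (nhds y)"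
      by (rule eventually_mono) (use closure_subset[of "{y. \<eta> y \<noteq> 0}"] in blast)
    then show "(\<eta> has_derivative (\<lambda>v. 0)) (at y)"
    proof -
      have "\<eta> y = 0" using \<open>eventually (\<lambda>z. \<eta> z = 0) (nhds y)\<close> by (rule eventually_nhds_x_imp_x)
      moreover have "eventually (\<lambda>z. 0 = \<eta> z) (at y)"
        using \<open>eventually (\<lambda>z. \<eta> z = 0) (nhds y)\<close> by (auto simp: eventually_at_filter elim: eventually_mono)
      ultimately show ?thesis
        using has_derivative_transform_eventually[of "\<lambda>_. 0" "\<lambda>_. 0" y UNIV \<eta>] by simp
    qed
  qed
  then have "{y. partial i \<eta> y \<noteq> 0} \<subseteq> closure {y. \<eta> y \<noteq> 0}" by blast
  then show ?thesis using assms bounded_closure bounded_subset by blast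
qed

lemma weak_partial_matrix:
  assumes "weak_partial i f w"
  shows "weak_partial i (\<lambda>y. B *v f y) (\<lambda>y. B *v w y)"
proof -
  have bl: "bounded_linear (\<lambda>v. B *v v)" by (rule matrix_vector_mul_bounded_linear)
  have li: "locally_integrable f" "locally_integrable w" using weak_partial_locally_integrable[OF assms] by auto
  have int: "(LINT y|lborel. c y *\<^sub>R (B *v h y)) = B *v (LINT y|lborel. c y *\<^sub>R h y)"
    if "locally_integrable h" "continuous_on UNIV c" "bounded {y. c y \<noteq> 0}" for c and h :: "real^2 \<Rightarrow> real^3"
    using integral_bounded_linear[OF bl integrable_mult_bounded_support[OF that]]
    by (simp add: matrix_vector_mult_scaleR)
  have loc: "set_integrable lborel K (\<lambda>y. B *v h y)" if "locally_integrable h" "compact K" for K and h :: "real^2 \<Rightarrow> real^3"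
    using integrable_bounded_linear[OF bl, of lborel "\<lambda>y. indicat_real K y *\<^sub>R h y"] that
    by (simp add: locally_integrable_def set_integrable_def matrix_vector_mult_scaleR)
  show ?thesis
    unfolding weak_partial_def
  proof (intro conjI allI impI)
    fix \<eta> :: "real^2 \<Rightarrow> real" assume \<eta>: "smooth \<eta> \<and> bounded {y. \<eta> y \<noteq> 0}"
    then show "(LINT y|lborel. partial i \<eta> y *\<^sub>R (B *v f y)) = - (LINT y|lborel. \<eta> y *\<^sub>R (B *v w y))"
      using assms by (simp add: int li smooth_continuous smooth_partial_continuous partial_bounded_support weak_partial_def
          linear_neg[OF matrix_vector_mul_linear])
  qed (use loc li in auto)
qed

text \<open>The Piola identity: the rows of the cofactor matrix of the Jacobian are divergence free
  because mixed partial derivatives commute. Hence a pulled back derivative times the Jacobian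
  determinant is a divergence, which a weak derivative can be tested with.\<close>

lemma jacobian_times_partial:
  fixes \<eta> :: "real^2 \<Rightarrow> real"
  assumes \<eta>: "smooth \<eta>" and \<Theta>: "smooth \<Theta>"
  shows "det (jac \<Theta> z) * partial 1 \<eta> (\<Theta> z)
      = partial 1 (\<lambda>z. \<eta> (\<Theta> z) * partial 2 \<Theta> z $ 2) z - partial 2 (\<lambda>z. \<eta> (\<Theta> z) * partial 1 \<Theta> z $ 2) z"
    and "det (jac \<Theta> z) * partial 2 \<eta> (\<Theta> z)
      = partial 2 (\<lambda>z. \<eta> (\<Theta> z) * partial 1 \<Theta> z $ 1) z - partial 1 (\<lambda>z. \<eta> (\<Theta> z) * partial 2 \<Theta> z $ 1) z"
proof -
  have [simp]: "(\<lambda>z. \<eta> (\<Theta> z)) differentiable (at z)" "(\<lambda>z. partial i \<Theta> z $ j) differentiable (at z)" for z i j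
    using smooth_compose[OF \<eta> \<Theta>] \<Theta> by (blast intro: smooth_differentiable smooth_partial)+
  have c: "partial i (\<lambda>z. \<eta> (\<Theta> z)) z = (\<Sum>j\<in>UNIV. (partial i \<Theta> z $ j) * partial j \<eta> (\<Theta> z))" for i
    using partial_compose(1)[of \<eta> \<Theta> z i] assms by (simp add: smooth_differentiable)
  have m: "partial i (\<lambda>z. \<eta> (\<Theta> z) * partial k \<Theta> z $ j) z
      = \<eta> (\<Theta> z) * partial i (\<lambda>z. partial k \<Theta> z $ j) z + partial i (\<lambda>z. \<eta> (\<Theta> z)) z * partial k \<Theta> z $ j" for i j k
    by (rule partial_bilinear[OF bounded_bilinear_mult]) auto
  have s: "partial 2 (\<lambda>z. partial 1 \<Theta> z $ j) z = partial 1 (\<lambda>z. partial 2 \<Theta> z $ j) z" for j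
  proof -
    have "(\<lambda>z. partial i \<Theta> z $ j) = partial i (\<lambda>z. \<Theta> z $ j)" for i
      using \<Theta> by (simp add: partial_nth smooth_differentiable fun_eq_iff)
    then show ?thesis using partial_commute_real[of "\<lambda>z. \<Theta> z $ j" 2 1 z] \<Theta> by auto
  qed
  show "det (jac \<Theta> z) * partial 1 \<eta> (\<Theta> z)
      = partial 1 (\<lambda>z. \<eta> (\<Theta> z) * partial 2 \<Theta> z $ 2) z - partial 2 (\<lambda>z. \<eta> (\<Theta> z) * partial 1 \<Theta> z $ 2) z"
    unfolding m c s by (simp add: UNIV_2 det_2 jac_def algebra_simps)
  show "det (jac \<Theta> z) * partial 2 \<eta> (\<Theta> z)
      = partial 2 (\<lambda>z. \<eta> (\<Theta> z) * partial 1 \<Theta> z $ 1) z - partial 1 (\<lambda>z. \<eta> (\<Theta> z) * partial 2 \<Theta> z $ 1) z"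
    unfolding m c s by (simp add: UNIV_2 det_2 jac_def algebra_simps)
qed

lemma diffeo_bounded_preimage:
  assumes "diffeo \<Theta> \<Psi>" "bounded S"
  shows "bounded (\<Theta> -` S)"
proof -
  have "compact (\<Psi> ` closure S)"
    using assms(2) by (intro compact_continuous_image continuous_on_subset[OF diffeo_continuous_inverse[OF assms(1)]])
      (auto simp: compact_closure)
  moreover have "\<Theta> -` S \<subseteq> \<Psi> ` closure S"
  proof
    fix z assume "z \<in> \<Theta> -` S"
    then have "\<Psi> (\<Theta> z) \<in> \<Psi> ` closure S" using closure_subset by auto
    then show "z \<in> \<Psi> ` closure S" using assms(1) by (simp add: diffeo_def)
  qed
  ultimately show ?thesis using bounded_subset compact_imp_bounded by blast
qed

text \<open>The chain rule for weak derivatives. \<open>w'\<close> is given implicitly by its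
  pull-back, so that only \<open>\<Theta>\<close> is differentiated; a test function \<eta> is
  replaced by \<eta> \<circ> \<Theta> times cofactors, and the Piola identity moves the
  derivative.\<close>

theorem weak_partial_diffeo:
  assumes diff: "diffeo \<Theta> \<Psi>" and w: "\<And>i. weak_partial i f (w i)"
    and w': "\<And>z i. w i z = (\<Sum>k\<in>UNIV. (partial i \<Theta> z $ k) *\<^sub>R w' k (\<Theta> z))"
  shows "weak_partial k (\<lambda>y. f (\<Psi> y)) (w' k)"
proof -
  have sm: "smooth \<Theta>" and inv: "\<And>y. \<Theta> (\<Psi> y) = y" "\<And>y. \<Psi> (\<Theta> y) = y" and pos: "\<And>y. det (jac \<Theta> y) > 0"
    using diff by (auto simp: diffeo_def)
  have c\<Psi>: "continuous_on UNIV \<Psi>" using diffeo_continuous_inverse[OF diff] .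
  have li: "locally_integrable f" "locally_integrable (w i)" for i
    using w weak_partial_locally_integrable by blast+
  have [measurable]: "\<Psi> \<in> borel_measurable borel" "f \<in> borel_measurable borel" "w i \<in> borel_measurable borel" for i
    using li c\<Psi> locally_integrable_measurable borel_measurable_continuous_onI by blast+
  have cp: "continuous_on UNIV (\<lambda>z. partial i \<Theta> z $ j)" for i j
    by (intro continuous_intros smooth_partial_continuous sm)
  have [measurable]: "(\<lambda>z. partial i \<Theta> z $ j) \<in> borel_measurable borel" for i j
    by (intro borel_measurable_continuous_onI cp)
  have [measurable]: "(\<lambda>z. det (jac \<Theta> z)) \<in> borel_measurable borel"
    using jac_continuous[OF sm] borel_measurable_continuous_onI by blast
  have cof: "det (jac \<Theta> z) *\<^sub>R w' 1 (\<Theta> z) = partial 2 \<Theta> z $ 2 *\<^sub>R w 1 z - partial 1 \<Theta> z $ 2 *\<^sub>R w 2 z"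
    "det (jac \<Theta> z) *\<^sub>R w' 2 (\<Theta> z) = partial 1 \<Theta> z $ 1 *\<^sub>R w 2 z - partial 2 \<Theta> z $ 1 *\<^sub>R w 1 z" for z
    unfolding w' by (simp_all add: UNIV_2 det_2 jac_def algebra_simps)
  \<comment> \<open>The entries of the cofactor matrix of \<open>jac \<Theta>\<close>, that is,
    Cramer's rule for solving the hypothesis on \<open>w'\<close>.\<close>
  define C where "C k i z = (if k = 1 then (if i = 1 then partial 2 \<Theta> z $ 2 else - partial 1 \<Theta> z $ 2)
     else (if i = 1 then - partial 2 \<Theta> z $ 1 else partial 1 \<Theta> z $ 1))" for k i :: 2 and z
  have cC: "continuous_on UNIV (C k i)" for k i
    unfolding C_def[abs_def] by (cases "k = 1"; cases "i = 1"; simp add: cp continuous_on_minus)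
  have [measurable]: "C k i \<in> borel_measurable borel" for k i
    by (intro borel_measurable_continuous_onI cC)
  have smC: "smooth (C k i)" for k i
    unfolding C_def[abs_def]
    by (cases "k = 1"; cases "i = 1"; simp; intro smooth_minus smooth_nth smooth_partial sm)
  have cofC: "det (jac \<Theta> z) *\<^sub>R w' k (\<Theta> z) = C k 1 z *\<^sub>R w 1 z + C k 2 z *\<^sub>R w 2 z" for k z
    using cof[of z] exhaust_2[of k] by (auto simp: C_def)
  have pC: "det (jac \<Theta> z) * partial k \<eta> (\<Theta> z)
      = partial 1 (\<lambda>z. \<eta> (\<Theta> z) * C k 1 z) z + partial 2 (\<lambda>z. \<eta> (\<Theta> z) * C k 2 z) z"
    if "smooth \<eta>" for k z and \<eta> :: "real^2 \<Rightarrow> real"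
  proof -
    have n: "partial i (\<lambda>z. \<eta> (\<Theta> z) * - partial j \<Theta> z $ l) z = - partial i (\<lambda>z. \<eta> (\<Theta> z) * partial j \<Theta> z $ l) z" for i j l
    proof -
      have "(\<lambda>z. \<eta> (\<Theta> z) * partial j \<Theta> z $ l) differentiable (at z)"
        using smooth_compose[OF that sm] sm by (intro smooth_differentiable smooth_mult smooth_nth smooth_partial)
      then show ?thesis
        using partial_linear[OF bounded_linear_minus[OF bounded_linear_ident], of "\<lambda>z. \<eta> (\<Theta> z) * partial j \<Theta> z $ l" z i]
        by simp
    qed
    show ?thesis using jacobian_times_partial[OF that sm, of z] exhaust_2[of k]
      by (auto simp: C_def n[simplified])
  qed
  \<comment> \<open>Solving for \<open>w'\<close> expresses it through measurable functions, which
    is how its measurability is obtained.\<close>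
  have m': "w' k y = (C k 1 (\<Psi> y) *\<^sub>R w 1 (\<Psi> y) + C k 2 (\<Psi> y) *\<^sub>R w 2 (\<Psi> y)) /\<^sub>R det (jac \<Theta> (\<Psi> y))" for y k
  proof -
    have "w' k y = (det (jac \<Theta> (\<Psi> y)) *\<^sub>R w' k (\<Theta> (\<Psi> y))) /\<^sub>R det (jac \<Theta> (\<Psi> y))"
      using pos[of "\<Psi> y"] by (simp add: inv)
    then show ?thesis by (simp only: cofC)
  qed
  have [measurable]: "w' k \<in> borel_measurable borel" for k
    unfolding m'[abs_def] by measurable
  have ft[simp]: "(\<lambda>z. f (\<Psi> (\<Theta> z))) = f" using inv by auto
  show ?thesis
    unfolding weak_partial_def
  proof (intro allI impI conjI)
    fix K :: "(real^2) set" assume K: "compact K"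
    have KP: "compact (\<Theta> -` K)"
    proof -
      have "\<Theta> -` K = \<Psi> ` K" using inv by (auto simp: image_iff) metis+
      then show ?thesis using compact_continuous_image[OF continuous_on_subset[OF c\<Psi>] K] by simp
    qed
    have Km[measurable]: "K \<in> sets borel" using K borel_compact by blast
    have i: "(\<lambda>z. indicat_real K (\<Theta> z)) = indicat_real (\<Theta> -` K)" by (auto simp: indicator_def)
    have "integrable lborel (\<lambda>z. indicat_real (\<Theta> -` K) z *\<^sub>R det (jac \<Theta> z) *\<^sub>R f z)"
      using integrable_compact_mult[OF li(1) jac_continuous[OF sm] KP] .
    then show "set_integrable lborel K (\<lambda>y. f (\<Psi> y))"
      unfolding set_integrable_def
      by (subst integral_diffeo(2)[OF diff]) (auto simp: inv i[THEN fun_cong] mult.commute)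
    have "integrable lborel (\<lambda>z. indicat_real (\<Theta> -` K) z *\<^sub>R C k 1 z *\<^sub>R w 1 z
        + indicat_real (\<Theta> -` K) z *\<^sub>R C k 2 z *\<^sub>R w 2 z)"
      using integrable_compact_mult[OF li(2) cC KP] by (intro Bochner_Integration.integrable_add)
    then have "integrable lborel (\<lambda>z. indicat_real (\<Theta> -` K) z *\<^sub>R (det (jac \<Theta> z) *\<^sub>R w' k (\<Theta> z)))"
      by (simp add: cofC scaleR_add_right)
    then show "set_integrable lborel K (w' k)"
      unfolding set_integrable_def
      by (subst integral_diffeo(2)[OF diff]) (auto simp: inv i[THEN fun_cong] mult.commute)
  next
    fix \<eta> :: "real^2 \<Rightarrow> real" assume \<eta>: "smooth \<eta> \<and> bounded {y. \<eta> y \<noteq> 0}"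
    let ?z = "\<lambda>i z. \<eta> (\<Theta> z) * C k i z"
    have [measurable]: "\<eta> \<in> borel_measurable borel" "partial k \<eta> \<in> borel_measurable borel"
      using \<eta> by (auto intro!: borel_measurable_continuous_onI smooth_continuous smooth_partial)
    have sz: "smooth (?z i)" for i using smooth_mult[OF smooth_compose[of \<eta>, OF conjunct1[OF \<eta>] sm] smC[of k i]] .
    have "{z. ?z i z \<noteq> 0} \<subseteq> \<Theta> -` {y. \<eta> y \<noteq> 0}" for i by auto
    then have bz: "bounded {z. ?z i z \<noteq> 0}" for i
      using diffeo_bounded_preimage[OF diff] \<eta> bounded_subset by blast
    have wz: "(LINT z|lborel. partial i (?z i) z *\<^sub>R f z) = - (LINT z|lborel. ?z i z *\<^sub>R w i z)" for i
      using w[of i] sz[of i] bz[of i] unfolding weak_partial_def by blast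
    have i1: "integrable lborel (\<lambda>z. partial i (?z i) z *\<^sub>R f z)" for i
      by (intro integrable_mult_bounded_support li smooth_partial_continuous sz partial_bounded_support bz)
    have i2: "integrable lborel (\<lambda>z. ?z i z *\<^sub>R w i z)" for i
      by (intro integrable_mult_bounded_support li smooth_continuous sz bz)
    have "(LINT y|lborel. partial k \<eta> y *\<^sub>R f (\<Psi> y))
        = (LINT z|lborel. partial 1 (?z 1) z *\<^sub>R f z + partial 2 (?z 2) z *\<^sub>R f z)"
      using \<eta> by (subst integral_diffeo(1)[OF diff]) (auto simp: inv pC scaleR_add_left[symmetric])
    also have "\<dots> = - (LINT z|lborel. ?z 1 z *\<^sub>R w 1 z + ?z 2 z *\<^sub>R w 2 z)"
      using i1 i2 by (simp add: wz)
    also have "(LINT z|lborel. ?z 1 z *\<^sub>R w 1 z + ?z 2 z *\<^sub>R w 2 z) = (LINT z|lborel. \<eta> (\<Theta> z) *\<^sub>R det (jac \<Theta> z) *\<^sub>R w' k (\<Theta> z))"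
      by (simp add: cofC scaleR_add_right)
    also have "\<dots> = (LINT y|lborel. \<eta> y *\<^sub>R w' k y)"
      by (subst integral_diffeo(1)[OF diff, of "\<lambda>y. \<eta> y *\<^sub>R w' k y"]) (auto simp: mult.commute)
    finally show "(LINT y|lborel. partial k \<eta> y *\<^sub>R f (\<Psi> y)) = - (LINT y|lborel. \<eta> y *\<^sub>R w' k y)" .
  qed
qed

section \<open>Linear algebra of the energy density\<close>

lemma lor_sym: "lor X Y = lor Y X" by (simp add: lor_def mult.commute)
lemma lor_simps:
  "lor (X + Y) Z = lor X Z + lor Y Z" "lor Z (X + Y) = lor Z X + lor Z Y"
  "lor (X - Y) Z = lor X Z - lor Y Z" "lor Z (X - Y) = lor Z X - lor Z Y"
  "lor (c *\<^sub>R X) Z = c * lor X Z" "lor Z (c *\<^sub>R X) = c * lor Z X"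
  "lor (- X) Z = - lor X Z" "lor Z (- X) = - lor Z X" "lor 0 Z = 0" "lor Z 0 = 0"
  by (simp_all add: lor_def algebra_simps)

lemma lor_diag_mult: "lor_diag *v X = vector [X$1, X$2, - X$3]"
  by (simp add: vec_eq_iff forall_3 lor_diag_def matrix_vector_mult_def sum_3)

lemma lor_inner: "lor X Y = (lor_diag *v X) \<bullet> Y"
  by (simp add: lor_diag_mult inner_vec_def sum_3 lor_def)

lemma lor_bounded_bilinear: "bounded_bilinear lor"
proof -
  have "bounded_bilinear (\<lambda>X Y. (lor_diag *v X) \<bullet> Y)"
    by (rule bounded_bilinear.comp1[OF bounded_bilinear_inner matrix_vector_mul_bounded_linear])
  then show ?thesis by (simp add: lor_inner[abs_def])
qed

lemma lor_nondegenerate: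
  assumes "\<And>Y. lor X Y = 0"
  shows "X = 0"
  using assms[of "vector [X$1, X$2, - X$3]"] unfolding lor_def
  by (simp add: vec_eq_iff forall_3 add_nonneg_eq_0_iff sum_squares_eq_zero_iff add_nonneg_nonneg)

definition lor_frame :: "real^3 \<Rightarrow> real^3 \<Rightarrow> real^3 \<Rightarrow> bool" where
  "lor_frame z f1 f2 \<longleftrightarrow> lor z z = - 1 \<and> lor f1 f1 = 1 \<and> lor f2 f2 = 1 \<and>
     lor z f1 = 0 \<and> lor z f2 = 0 \<and> lor f1 f2 = 0"

text \<open>Orthonormality says that the \<open>lor\<close>-transpose \<open>N\<close> is a left
  inverse of the matrix \<open>M\<close> with columns \<open>f1\<close>, \<open>f2\<close>,
  \<open>z\<close>. For square matrices it is then a right inverse, and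
  \<open>M ** N = mat 1\<close> is the expansion.\<close>

lemma lor_frame_expand:
  assumes "lor_frame z f1 f2"
  shows "v = lor f1 v *\<^sub>R f1 + lor f2 v *\<^sub>R f2 - lor z v *\<^sub>R z"
proof -
  define M :: "real^3^3" where "M = (\<chi> i j. if j = 1 then f1$i else if j = 2 then f2$i else z$i)"
  define N where "N = lor_diag ** transpose M ** lor_diag"
  define c where "c j = (if j = 1 then f1 else if j = 2 then f2 else z)" for j :: 3
  have Mc: "M = (\<chi> i j. c j $ i)" by (simp add: M_def c_def vec_eq_iff)
  have NM: "(N ** M) $ i $ j = (if i = 3 then -1 else 1) * lor (c i) (c j)" for i j
    unfolding N_def Mc lor_def
    using exhaust_3[of i] by (auto simp: matrix_matrix_mult_def lor_diag_def transpose_def sum_3)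
  have "N ** M = mat 1"
    using assms lor_sym[of f1 z] lor_sym[of f2 z] lor_sym[of f2 f1] unfolding lor_frame_def
    by (simp add: vec_eq_iff forall_3 NM) (simp add: c_def mat_def)
  then have "M ** N = mat 1" by (simp add: matrix_left_right_inverse)
  then have "v = M *v (N *v v)" by (metis matrix_vector_mul_assoc matrix_vector_mul_lid)
  also have "\<dots> = lor f1 v *\<^sub>R f1 + lor f2 v *\<^sub>R f2 - lor z v *\<^sub>R z"
    by (simp add: vec_eq_iff forall_3 N_def M_def matrix_matrix_mult_def matrix_vector_mult_def lor_diag_def
        transpose_def sum_3 lor_def algebra_simps)
  finally show ?thesis .
qed

lemma hyp_lor: "z \<in> hyp \<Longrightarrow> lor z z = -1" by (simp add: hyp_def)

lemma hyp_norm: "z \<in> hyp \<Longrightarrow> (z$3)\<^sup>2 = 1 + (z$1)\<^sup>2 + (z$2)\<^sup>2"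
  by (simp add: hyp_def lor_def power2_eq_square)

text \<open>The tangent planes are spacelike. After eliminating \<open>v$3\<close> by tangency,
  Lagrange's identity turns the quadratic form, multiplied by the square of \<open>z$3\<close>, into
  a sum of squares.\<close>

lemma tangent_pos:
  assumes z: "z \<in> hyp" and v: "lor z v = 0"
  shows "lor v v \<ge> 0" "lor v v = 0 \<Longrightarrow> v = 0"
proof -
  have e: "z$1 * v$1 + z$2 * v$2 = z$3 * v$3" using v by (simp add: lor_def)
  have n: "(z$3)\<^sup>2 = 1 + (z$1)\<^sup>2 + (z$2)\<^sup>2" using z hyp_norm by blast
  have z3: "z$3 \<ge> 1" using z by (simp add: hyp_def)
  have id: "(z$3)\<^sup>2 * lor v v = (v$1)\<^sup>2 + (v$2)\<^sup>2 + (z$1 * v$2 - z$2 * v$1)\<^sup>2"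
  proof -
    have "(z$3)\<^sup>2 * lor v v = (z$3)\<^sup>2 * ((v$1)\<^sup>2 + (v$2)\<^sup>2) - (z$3 * v$3)\<^sup>2"
      by (simp add: lor_def power2_eq_square algebra_simps)
    also have "\<dots> = (1 + (z$1)\<^sup>2 + (z$2)\<^sup>2) * ((v$1)\<^sup>2 + (v$2)\<^sup>2) - (z$1 * v$1 + z$2 * v$2)\<^sup>2"
      using n e by simp
    also have "\<dots> = (v$1)\<^sup>2 + (v$2)\<^sup>2 + (z$1 * v$2 - z$2 * v$1)\<^sup>2"
      by (simp add: power2_eq_square algebra_simps)
    finally show ?thesis .
  qed
  then have "0 \<le> (z$3)\<^sup>2 * lor v v" by (simp add: add_nonneg_nonneg)
  moreover have "(z$3)\<^sup>2 > 0" using z3 by auto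
  ultimately show "lor v v \<ge> 0" by (simp add: zero_le_mult_iff)
  assume "lor v v = 0"
  then have "(v$1)\<^sup>2 + (v$2)\<^sup>2 + (z$1 * v$2 - z$2 * v$1)\<^sup>2 = 0" using id by simp
  then have "v$1 = 0" "v$2 = 0" by (simp_all add: add_nonneg_eq_0_iff)
  then show "v = 0" using e z3 by (simp add: vec_eq_iff forall_3)
qed

lemma cross3_lor: "lor (rot x v) w = x \<bullet> cross3 v w"
  by (simp add: rot_def lor_diag_mult lor_def cross3_simps inner_vec_def sum_3 algebra_simps cross3_def)

lemma lor_normalize: "lor v v > 0 \<Longrightarrow> inverse (sqrt (lor v v)) * (inverse (sqrt (lor v v)) * lor v v) = 1"
  by (simp add: field_simps)

lemma lor_frame_extend:
  assumes z: "z \<in> hyp" and "lor z f = 0" "lor f f = 1"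
  shows "lor_frame z f (rot z f)"
proof -
  have "lor (rot z f) (rot z f) = (lor z f)\<^sup>2 - lor z z * lor f f"
    by (simp add: rot_def lor_diag_mult lor_def cross3_def power2_eq_square algebra_simps)
  moreover have "lor z (rot z f) = 0" "lor f (rot z f) = 0"
    by (subst lor_sym, simp add: cross3_lor dot_cross_self)+
  ultimately show ?thesis using assms by (auto simp: lor_frame_def hyp_lor)
qed

lemma lor_frame_exists:
  assumes z: "z \<in> hyp"
  obtains f1 f2 where "lor_frame z f1 f2"
proof -
  have z3: "z$3 \<ge> 1" and n: "(z$3)\<^sup>2 = 1 + (z$1)\<^sup>2 + (z$2)\<^sup>2" using z hyp_norm by (auto simp: hyp_def)
  define v :: "real^3" where "v = vector [z$3, 0, z$1]"
  have v: "lor z v = 0" "v \<noteq> 0" using z3 by (auto simp: v_def lor_def vec_eq_iff forall_3)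
  then have p: "lor v v > 0" using tangent_pos[OF z v(1)] by force
  define f1 where "f1 = v /\<^sub>R sqrt (lor v v)"
  have "lor z f1 = 0" "lor f1 f1 = 1" using v(1) lor_normalize[OF p] by (simp_all add: f1_def lor_simps)
  then show thesis using that lor_frame_extend[OF z] by blast
qed

text \<open>A spectral decomposition: if \<open>z\<close>, \<open>f1\<close>, \<open>f2\<close> is
  an orthonormal frame, this is the \<open>lor\<close>-self-adjoint matrix with eigenvalues
  \<open>b1\<close>, \<open>b2\<close> on \<open>f1\<close>, \<open>f2\<close> and 0 on
  \<open>z\<close>.\<close>

definition spec :: "real^3 \<Rightarrow> real^3 \<Rightarrow> real \<Rightarrow> real \<Rightarrow> real^3^3" where
  "spec f1 f2 b1 b2 = (\<chi> i j. b1 * f1$i * (lor_diag *v f1)$j + b2 * f2$i * (lor_diag *v f2)$j)"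

lemma spec_mult: "spec f1 f2 b1 b2 *v v = (b1 * lor f1 v) *\<^sub>R f1 + (b2 * lor f2 v) *\<^sub>R f2"
  unfolding spec_def lor_diag_mult
  by (simp add: vec_eq_iff matrix_vector_mult_def sum_3 lor_def algebra_simps)

lemma trace_spec: "trace (spec f1 f2 b1 b2) = b1 * lor f1 f1 + b2 * lor f2 f2"
  unfolding spec_def lor_diag_mult by (simp add: trace_def sum_3 lor_def algebra_simps)

text \<open>Existence: an eigenvector for \<open>c\<close> has no component along a frame vector
  whose eigenvalue differs from \<open>c\<close>. Uniqueness: the frame consists of eigenvectors and
  spans. On \<open>z\<close> the value is 0 because \<open>0 powr s = 0\<close>.\<close>

lemma mat_powr_spec:
  assumes F: "lor_frame z f1 f2"
  shows "mat_powr (spec f1 f2 b1 b2) s = spec f1 f2 (b1 powr s) (b2 powr s)"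
  unfolding mat_powr_def
proof (rule the_equality)
  have l: "lor z z = -1" "lor f1 f1 = 1" "lor f2 f2 = 1" "lor z f1 = 0" "lor z f2 = 0" "lor f1 f2 = 0" "lor f2 f1 = 0"
    using F lor_sym[of f2 f1] by (simp_all add: lor_frame_def)
  show "\<forall>v c. spec f1 f2 b1 b2 *v v = c *\<^sub>R v \<longrightarrow> spec f1 f2 (b1 powr s) (b2 powr s) *v v = (c powr s) *\<^sub>R v"
  proof (intro allI impI)
    fix v c assume e: "spec f1 f2 b1 b2 *v v = c *\<^sub>R v"
    have "lor f1 (spec f1 f2 b1 b2 *v v) = c * lor f1 v" "lor f2 (spec f1 f2 b1 b2 *v v) = c * lor f2 v"
      "lor z (spec f1 f2 b1 b2 *v v) = c * lor z v"
      by (simp_all add: e lor_simps)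
    then have "b1 * lor f1 v = c * lor f1 v" "b2 * lor f2 v = c * lor f2 v" "0 = c * lor z v"
      by (simp_all add: spec_mult lor_simps l)
    then have "b1 powr s * lor f1 v = c powr s * lor f1 v" "b2 powr s * lor f2 v = c powr s * lor f2 v"
      "c powr s * lor z v = 0"
      by auto
    then show "spec f1 f2 (b1 powr s) (b2 powr s) *v v = (c powr s) *\<^sub>R v"
      using lor_frame_expand[OF F, of "(c powr s) *\<^sub>R v"] by (simp only: spec_mult lor_simps) simp
  qed
  fix B assume B: "\<forall>v c. spec f1 f2 b1 b2 *v v = c *\<^sub>R v \<longrightarrow> B *v v = (c powr s) *\<^sub>R v"
  have "B *v f1 = (b1 powr s) *\<^sub>R f1" "B *v f2 = (b2 powr s) *\<^sub>R f2" "B *v z = (0 powr s) *\<^sub>R z"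
    using B[rule_format, of f1 b1] B[rule_format, of f2 b2] B[rule_format, of z 0] l lor_sym[of f1 z] lor_sym[of f2 z]
    by (simp_all add: spec_mult)
  note Bf = this
  show "B = spec f1 f2 (b1 powr s) (b2 powr s)"
  proof (rule matrix_eq[THEN iffD2], rule allI)
    fix v
    have "B *v v = B *v (lor f1 v *\<^sub>R f1 + lor f2 v *\<^sub>R f2 - lor z v *\<^sub>R z)"
      using lor_frame_expand[OF F, of v] by simp
    also have "\<dots> = spec f1 f2 (b1 powr s) (b2 powr s) *v v"
      by (simp add: matrix_vector_mult_diff_distrib matrix_vector_right_distrib matrix_vector_mult_scaleR Bf spec_mult mult.commute)
    finally show "B *v v = spec f1 f2 (b1 powr s) (b2 powr s) *v v" .
  qed
qed

lemma lor_adj: "lor (adj L *v w) v = lor w (L *v v)"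
  by (simp add: adj_def lor_diag_def lor_def matrix_vector_mult_def matrix_matrix_mult_def transpose_def sum_3 algebra_simps)

lemma lor_diff_eq: "(\<And>Y. lor X Y = lor X' Y) \<Longrightarrow> X = X'"
  using lor_nondegenerate[of "X - X'"] by (simp add: lor_simps)

text \<open>The singular value decomposition of \<open>L\<close> when the frame already diagonalizes
  the pulled back metric. The normalized images of \<open>e1\<close>, \<open>e2\<close> form the
  frame in the target; where a singular value is 0, the missing vector is obtained by rotation or
  chosen freely.\<close>

lemma tangent_map_svd:
  assumes E: "lor_frame x e1 e2" and z: "z \<in> hyp"
    and Lx: "L *v x = 0" and Lt: "\<And>v. L *v v \<in> tangent z"
    and D: "lor (L *v e1) (L *v e1) = a" "lor (L *v e2) (L *v e2) = b" "lor (L *v e1) (L *v e2) = 0"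
  obtains f1 f2 where "lor_frame z f1 f2" "L *v e1 = sqrt a *\<^sub>R f1" "L *v e2 = sqrt b *\<^sub>R f2" "a \<ge> 0" "b \<ge> 0"
    "L ** adj L = spec f1 f2 a b"
proof -
  have t: "lor z (L *v v) = 0" for v using Lt[of v] by (simp add: tangent_def lor_sym)
  have ab: "a \<ge> 0" "b \<ge> 0" using tangent_pos(1)[OF z t] D by auto
  have zero: "a = 0 \<Longrightarrow> L *v e1 = 0" "b = 0 \<Longrightarrow> L *v e2 = 0" using tangent_pos(2)[OF z t] D by auto
  have "\<exists>f1 f2. lor_frame z f1 f2 \<and> L *v e1 = sqrt a *\<^sub>R f1 \<and> L *v e2 = sqrt b *\<^sub>R f2"
  proof (cases "a = 0")
    case True
    show ?thesis
    proof (cases "b = 0")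
      case b: True
      obtain f1 f2 where "lor_frame z f1 f2" using lor_frame_exists[OF z] .
      then show ?thesis using True b zero by auto
    next
      case False
      then have bp: "b > 0" using ab by simp
      define f where "f = (L *v e2) /\<^sub>R sqrt b"
      have "lor z f = 0" "lor f f = 1" using bp t D lor_normalize[of "L *v e2"] by (simp_all add: f_def lor_simps)
      then have "lor_frame z f (rot z f)" using lor_frame_extend z by blast
      then have "lor_frame z (rot z f) f" by (simp add: lor_frame_def lor_sym)
      moreover have "L *v e2 = sqrt b *\<^sub>R f" using bp by (simp add: f_def)
      ultimately show ?thesis using True zero by (metis real_sqrt_zero scaleR_zero_left)
    qed
  next
    case False
    then have ap: "a > 0" using ab by simp
    define f where "f = (L *v e1) /\<^sub>R sqrt a"
    have f: "lor z f = 0" "lor f f = 1" using ap t D lor_normalize[of "L *v e1"] by (simp_all add: f_def lor_simps)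
    have Lf: "L *v e1 = sqrt a *\<^sub>R f" using ap by (simp add: f_def)
    show ?thesis
    proof (cases "b = 0")
      case True
      then show ?thesis using lor_frame_extend[OF z f] Lf zero by (metis real_sqrt_zero scaleR_zero_left)
    next
      case False
      then have bp: "b > 0" using ab by simp
      define g where "g = (L *v e2) /\<^sub>R sqrt b"
      have "lor z g = 0" "lor g g = 1" "lor f g = 0" "L *v e2 = sqrt b *\<^sub>R g"
        using bp ap t D lor_normalize[of "L *v e2"] by (simp_all add: f_def g_def lor_simps)
      then show ?thesis using f Lf z hyp_lor by (auto simp: lor_frame_def)
    qed
  qed
  then obtain f1 f2 where F: "lor_frame z f1 f2" and Le: "L *v e1 = sqrt a *\<^sub>R f1" "L *v e2 = sqrt b *\<^sub>R f2" by blast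
  have l: "lor z z = -1" "lor f1 f1 = 1" "lor f2 f2 = 1" "lor z f1 = 0" "lor z f2 = 0" "lor f1 f2 = 0" "lor f2 f1 = 0"
    using F lor_sym[of f2 f1] by (auto simp: lor_frame_def)
  have le: "lor x x = -1" "lor e1 e1 = 1" "lor e2 e2 = 1" "lor x e1 = 0" "lor x e2 = 0" "lor e1 e2 = 0" "lor e2 e1 = 0"
    using E lor_sym[of e2 e1] by (auto simp: lor_frame_def)
  have Lv: "L *v v = (lor e1 v * sqrt a) *\<^sub>R f1 + (lor e2 v * sqrt b) *\<^sub>R f2" for v
  proof -
    have "L *v v = L *v (lor e1 v *\<^sub>R e1 + lor e2 v *\<^sub>R e2 - lor x v *\<^sub>R x)"
      using lor_frame_expand[OF E, of v] by simp
    then show ?thesis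
      by (simp add: matrix_vector_mult_diff_distrib matrix_vector_right_distrib matrix_vector_mult_scaleR Le Lx)
  qed
  have adj: "adj L *v w = (sqrt a * lor f1 w) *\<^sub>R e1 + (sqrt b * lor f2 w) *\<^sub>R e2" for w
    by (rule lor_diff_eq) (simp add: lor_adj Lv lor_simps lor_sym[of w] algebra_simps)
  have "L ** adj L = spec f1 f2 a b"
  proof (rule matrix_eq[THEN iffD2], rule allI)
    fix w
    have "(L ** adj L) *v w = L *v (adj L *v w)" by (simp add: matrix_vector_mul_assoc)
    also have "\<dots> = (sqrt a * lor f1 w * sqrt a) *\<^sub>R f1 + (sqrt b * lor f2 w * sqrt b) *\<^sub>R f2"
      unfolding adj by (simp only: Lv lor_simps le) simp
    also have "\<dots> = (sqrt a * sqrt a * lor f1 w) *\<^sub>R f1 + (sqrt b * sqrt b * lor f2 w) *\<^sub>R f2"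
      by (simp only: mult_ac)
    finally show "(L ** adj L) *v w = spec f1 f2 a b *v w" using ab by (simp add: spec_mult)
  qed
  then show thesis by (rule that[OF F Le ab])
qed

text \<open>All terms are read off from the singular values sqrt a and sqrt b. In
  \<open>T_tensor\<close> the power of \<open>Q\<close> contributes the exponent (p - 2)/2 and the
  two factors \<open>L\<close> another 1, so that p/2 results; for a singular value 0 both sides
  vanish by the convention \<open>0 powr s = 0\<close>.\<close>

lemma energy_terms:
  assumes E: "lor_frame x e1 e2" and z: "z \<in> hyp"
    and Lx: "L *v x = 0" and Lt: "\<And>v. L *v v \<in> tangent z"
    and D: "lor (L *v e1) (L *v e1) = a" "lor (L *v e2) (L *v e2) = b" "lor (L *v e1) (L *v e2) = 0"
    and p: "p > 2"
  shows "trace (mat_powr (Q L) p) = a powr (p/2) + b powr (p/2)"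
    and "trace (L ** adj L) = a + b"
    and "T_tensor p L (v1 *\<^sub>R e1 + v2 *\<^sub>R e2) (w1 *\<^sub>R e1 + w2 *\<^sub>R e2)
      = v1 * w1 * (a powr (p/2) - (a powr (p/2) + b powr (p/2)) / p)
      + v2 * w2 * (b powr (p/2) - (a powr (p/2) + b powr (p/2)) / p)"
proof -
  obtain f1 f2 where F: "lor_frame z f1 f2" and Le: "L *v e1 = sqrt a *\<^sub>R f1" "L *v e2 = sqrt b *\<^sub>R f2"
    and ab: "a \<ge> 0" "b \<ge> 0" and LL: "L ** adj L = spec f1 f2 a b"
    using tangent_map_svd[OF E z Lx Lt D] by blast
  have l: "lor f1 f1 = 1" "lor f2 f2 = 1" "lor f1 f2 = 0" "lor f2 f1 = 0"
    using F lor_sym[of f2 f1] by (auto simp: lor_frame_def)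
  have le: "lor e1 e1 = 1" "lor e2 e2 = 1" "lor e1 e2 = 0" "lor e2 e1 = 0"
    using E lor_sym[of e2 e1] by (auto simp: lor_frame_def)
  have Q: "Q L = spec f1 f2 (a powr (1/2)) (b powr (1/2))"
    by (simp add: Q_def LL mat_powr_spec[OF F])
  have Qp: "mat_powr (Q L) s = spec f1 f2 (a powr (s/2)) (b powr (s/2))" for s
    by (simp add: Q mat_powr_spec[OF F] powr_powr)
  show tr: "trace (mat_powr (Q L) p) = a powr (p/2) + b powr (p/2)"
    by (simp add: Qp trace_spec l)
  show "trace (L ** adj L) = a + b" by (simp add: LL trace_spec l)
  have pw: "c powr ((p - 2)/2) * sqrt c * sqrt c = c powr (p/2)" if "c \<ge> 0" for c :: real
  proof (cases "c = 0")
    case False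
    have "c powr ((p - 2)/2) * c = c powr ((p - 2)/2) * c powr 1" using that by simp
    also have "\<dots> = c powr ((p - 2)/2 + 1)" by (simp only: powr_add)
    also have "(p - 2)/2 + 1 = p/2" by (simp add: field_simps)
    finally show ?thesis using that by (simp add: mult.assoc)
  qed simp
  have Lv: "L *v (v1 *\<^sub>R e1 + v2 *\<^sub>R e2) = (v1 * sqrt a) *\<^sub>R f1 + (v2 * sqrt b) *\<^sub>R f2" for v1 v2
    by (simp add: matrix_vector_right_distrib matrix_vector_mult_scaleR Le)
  have "lor (mat_powr (Q L) (p - 2) *v (L *v (v1 *\<^sub>R e1 + v2 *\<^sub>R e2))) (L *v (w1 *\<^sub>R e1 + w2 *\<^sub>R e2))
    = v1 * w1 * (a powr ((p - 2)/2) * sqrt a * sqrt a) + v2 * w2 * (b powr ((p - 2)/2) * sqrt b * sqrt b)"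
    unfolding Qp Lv spec_mult by (simp add: lor_simps l algebra_simps)
  also have "\<dots> = v1 * w1 * a powr (p/2) + v2 * w2 * b powr (p/2)" by (simp only: pw ab)
  finally show "T_tensor p L (v1 *\<^sub>R e1 + v2 *\<^sub>R e2) (w1 *\<^sub>R e1 + w2 *\<^sub>R e2)
      = v1 * w1 * (a powr (p/2) - (a powr (p/2) + b powr (p/2)) / p)
      + v2 * w2 * (b powr (p/2) - (a powr (p/2) + b powr (p/2)) / p)"
  proof -
    assume *: "lor (mat_powr (Q L) (p - 2) *v (L *v (v1 *\<^sub>R e1 + v2 *\<^sub>R e2))) (L *v (w1 *\<^sub>R e1 + w2 *\<^sub>R e2))
      = v1 * w1 * a powr (p/2) + v2 * w2 * b powr (p/2)"
    have "lor (v1 *\<^sub>R e1 + v2 *\<^sub>R e2) (w1 *\<^sub>R e1 + w2 *\<^sub>R e2) = v1 * w1 + v2 * w2"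
      by (simp add: lor_simps le)
    then show ?thesis unfolding T_tensor_def tr * by (simp add: algebra_simps add_divide_distrib)
  qed
qed

lemma raise_index_eq:
  assumes E: "lor_frame x e1 e2" and x: "x \<in> hyp"
    and B: "\<And>w1 w2. B (w1 *\<^sub>R e1 + w2 *\<^sub>R e2) = w1 * c1 + w2 * (c2::real)" and Ba: "T a = B"
  shows "raise_index x T a = c1 *\<^sub>R e1 + c2 *\<^sub>R e2"
  unfolding raise_index_def
proof (rule the_equality)
  have le: "lor e1 e1 = 1" "lor e2 e2 = 1" "lor e1 e2 = 0" "lor e2 e1 = 0" "lor x e1 = 0" "lor x e2 = 0"
    "lor e1 x = 0" "lor e2 x = 0"
    using E lor_sym[of e2 e1] lor_sym[of e1 x] lor_sym[of e2 x] by (simp_all add: lor_frame_def)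
  have tan: "b = lor e1 b *\<^sub>R e1 + lor e2 b *\<^sub>R e2" if "b \<in> tangent x" for b
    using lor_frame_expand[OF E, of b] that lor_sym[of x b] by (simp add: tangent_def)
  have Bb: "B b = lor e1 b * c1 + lor e2 b * c2" if "b \<in> tangent x" for b
    using B[of "lor e1 b" "lor e2 b"] tan[OF that] by simp
  show "c1 *\<^sub>R e1 + c2 *\<^sub>R e2 \<in> tangent x \<and> (\<forall>b\<in>tangent x. lor (c1 *\<^sub>R e1 + c2 *\<^sub>R e2) b = T a b)"
    using Bb unfolding Ba by (simp add: tangent_def lor_simps le mult.commute)
  fix v assume v: "v \<in> tangent x \<and> (\<forall>b\<in>tangent x. lor v b = T a b)"
  have "e1 \<in> tangent x" "e2 \<in> tangent x" by (auto simp: tangent_def le)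
  then have "lor v e1 = c1" "lor v e2 = c2" using v by (auto simp: Ba Bb le)
  then show "v = c1 *\<^sub>R e1 + c2 *\<^sub>R e2" using tan[of v] v lor_sym[of e1 v] lor_sym[of e2 v] by simp
qed

text \<open>The two rank-one parts of the cross product contribute equally because \<open>B\<close>
  is skew. This turns the pairing of W with d\<phi> into the pairing of T with the tangent-valued
  form (d\<phi>) x.\<close>

lemma trace_lor_cross:
  assumes "B \<in> so21"
  shows "trace (lor_cross Y x ** B) = 2 * lor Y (B *v x)"
proof -
  have "trace (lor_cross Y x ** B) = lor Y (B *v x) - lor x (B *v Y)"
    unfolding lor_cross_def lor_diag_mult
    by (simp add: trace_def matrix_matrix_mult_def sum_3 lor_def matrix_vector_mult_def algebra_simps)
  moreover have "lor (B *v Y) x + lor Y (B *v x) = 0" using assms by (simp add: so21_def)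
  ultimately show ?thesis by (simp add: lor_sym[of x])
qed

section \<open>Dependence of the energy density on the metric\<close>

lemma powr_diff_bounds:
  fixes x y s :: real
  assumes "0 \<le> x" "x \<le> y" "s > 1"
  shows "s * x powr (s - 1) * (y - x) \<le> y powr s - x powr s"
    and "y powr s - x powr s \<le> s * y powr (s - 1) * (y - x)"
proof -
  have "s * x powr (s - 1) * (y - x) \<le> y powr s - x powr s \<and> y powr s - x powr s \<le> s * y powr (s - 1) * (y - x)"
  proof (cases "x = y")
    case False
    then have xy: "x < y" using assms by simp
    have "continuous_on {x..y} (\<lambda>z. z powr s)"
      using assms by (intro continuous_on_powr' continuous_intros) auto
    moreover have "\<And>z. x < z \<Longrightarrow> z < y \<Longrightarrow> (\<lambda>z. z powr s) differentiable (at z)"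
      using assms has_real_derivative_powr by (metis le_less_trans real_differentiable_def)
    ultimately obtain l z where z: "x < z" "z < y" "((\<lambda>z. z powr s) has_real_derivative l) (at z)"
        "y powr s - x powr s = (y - x) * l"
      using MVT[OF xy] by blast
    have "l = s * z powr (s - 1)"
      using DERIV_unique[OF z(3) has_real_derivative_powr[of z s]] z assms by simp
    moreover have "x powr (s - 1) \<le> z powr (s - 1)" "z powr (s - 1) \<le> y powr (s - 1)"
      using z assms by (auto intro: powr_mono2)
    ultimately show ?thesis using z assms xy by (simp add: mult.commute)
  qed simp
  then show "s * x powr (s - 1) * (y - x) \<le> y powr s - x powr s"
    and "y powr s - x powr s \<le> s * y powr (s - 1) * (y - x)" by auto
qed

lemma powr_lipschitz:
  fixes x y s :: real
  assumes "0 \<le> x" "0 \<le> y" "x \<le> M" "y \<le> M" "s > 1"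
  shows "\<bar>x powr s - y powr s\<bar> \<le> s * M powr (s - 1) * \<bar>x - y\<bar>"
proof -
  have *: "\<bar>v powr s - u powr s\<bar> \<le> s * M powr (s - 1) * \<bar>v - u\<bar>" if "0 \<le> u" "u \<le> v" "v \<le> M" for u v
  proof -
    have "v powr (s - 1) \<le> M powr (s - 1)" using that assms by (intro powr_mono2) auto
    then have "s * v powr (s - 1) * (v - u) \<le> s * M powr (s - 1) * (v - u)"
      using assms that by (intro mult_right_mono mult_left_mono) auto
    moreover have "u powr s \<le> v powr s" using that assms by (intro powr_mono2) auto
    ultimately show ?thesis using powr_diff_bounds(2)[OF that(1,2) assms(5)] that by simp
  qed
  show ?thesis using *[of x y] *[of y x] assms by (cases "x \<le> y") (auto simp: abs_minus_commute)
qed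

text \<open>The derivative is taken within the half-line because eigenvalues of the pulled back
  metric may vanish. At 0 the condition \<open>s > 1\<close>, which is p > 2 for s = p/2, makes it
  0.\<close>

lemma powr_has_derivative_nonneg:
  fixes x s :: real
  assumes "x \<ge> 0" "s > 1"
  shows "((\<lambda>x. x powr s) has_real_derivative s * x powr (s - 1)) (at x within {0..})"
proof (cases "x = 0")
  case True
  have "((\<lambda>y. y powr (s - 1)) \<longlongrightarrow> 0 powr (s - 1)) (at 0 within {0..})"
    using assms by (intro tendsto_powr2) (auto simp: eventually_at_filter)
  then have "((\<lambda>y. (y powr s - 0 powr s) / (y - 0)) \<longlongrightarrow> 0 powr (s - 1)) (at 0 within {0..})"
  proof (rule Lim_transform_eventually)
    show "\<forall>\<^sub>F y in at 0 within {0..}. y powr (s - 1) = (y powr s - 0 powr s) / (y - 0)"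
    proof (unfold eventually_at_filter, intro always_eventually allI impI)
      fix y :: real assume "y \<noteq> 0" "y \<in> {0..}"
      then have "y powr s = y powr (s - 1) * y" by (simp add: powr_diff field_simps)
      then show "y powr (s - 1) = (y powr s - 0 powr s) / (y - 0)" using \<open>y \<noteq> 0\<close> by simp
    qed
  qed
  then show ?thesis using True by (simp add: has_field_derivative_iff)
next
  case False
  then have "((\<lambda>x. x powr s) has_real_derivative s * x powr (s - 1)) (at x)"
    using assms by (intro has_real_derivative_powr) auto
  then show ?thesis by (rule has_field_derivative_at_within)
qed

text \<open>Eigenvalues of the symmetric matrix with rows \<open>(A, B)\<close> and \<open>(B, C)\<close>.\<close>
definition eig_max :: "real \<Rightarrow> real \<Rightarrow> real \<Rightarrow> real" where
  "eig_max A B C = (A + C)/2 + sqrt (((A - C)/2)\<^sup>2 + B\<^sup>2)"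
definition eig_min :: "real \<Rightarrow> real \<Rightarrow> real \<Rightarrow> real" where
  "eig_min A B C = (A + C)/2 - sqrt (((A - C)/2)\<^sup>2 + B\<^sup>2)"

definition eig_gap :: "real \<Rightarrow> real \<Rightarrow> real \<Rightarrow> real" where
  "eig_gap A B C = sqrt (((A - C)/2)\<^sup>2 + B\<^sup>2) - \<bar>(A - C)/2\<bar>"

text \<open>The gap is how far the off-diagonal entry pushes the eigenvalues away from the diagonal
  entries. Both upper bounds matter: the first holds up to coinciding diagonal entries, the second
  is quadratic in \<open>B\<close> when they differ. The second comes from gap * (r + d) = r^2 - d^2
  = B^2, with r the square root and d half the distance of the diagonal entries.\<close>

lemma eig_gap:
  "eig_max A B C = max A C + eig_gap A B C" "eig_min A B C = min A C - eig_gap A B C"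
  "0 \<le> eig_gap A B C" "eig_gap A B C \<le> \<bar>B\<bar>" "eig_gap A B C * \<bar>A - C\<bar> \<le> B\<^sup>2"
proof -
  let ?r = "sqrt (((A - C)/2)\<^sup>2 + B\<^sup>2)" and ?d = "\<bar>(A - C)/2\<bar>"
  show "eig_max A B C = max A C + eig_gap A B C" "eig_min A B C = min A C - eig_gap A B C"
    by (auto simp: eig_max_def eig_min_def eig_gap_def max_def min_def abs_if field_simps)
  have "?d = sqrt (((A - C)/2)\<^sup>2)" by simp
  also have "\<dots> \<le> ?r" by (intro real_sqrt_le_mono) simp
  finally have dr: "?d \<le> ?r" .
  then show "0 \<le> eig_gap A B C" by (simp add: eig_gap_def)
  have "?r \<le> ?d + \<bar>B\<bar>"
    by (rule sqrt_sum_squares_le_sum_abs[THEN order_trans]) simp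
  then show "eig_gap A B C \<le> \<bar>B\<bar>" by (simp add: eig_gap_def)
  have "eig_gap A B C * (?r + ?d) = ?r\<^sup>2 - ?d\<^sup>2"
    unfolding eig_gap_def power2_eq_square by (rule square_diff_square_factored[symmetric, unfolded mult.commute[of "_ + _"]])
  also have "\<dots> = B\<^sup>2" using power2_abs[of "(A - C)/2"] by (simp add: add_nonneg_nonneg del: power2_abs)
  finally have "eig_gap A B C * (?r + ?d) = B\<^sup>2" .
  moreover have "\<bar>A - C\<bar> \<le> ?r + ?d" using dr by simp
  ultimately show "eig_gap A B C * \<bar>A - C\<bar> \<le> B\<^sup>2"
    using mult_left_mono[OF \<open>\<bar>A - C\<bar> \<le> ?r + ?d\<close> \<open>0 \<le> eig_gap A B C\<close>] by linarith
qed

text \<open>The gap is added to the larger diagonal entry and subtracted from the smaller one, so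
  its first-order effects partly cancel. What is left carries the difference of the derivatives of
  the power at the two eigenvalues, which is small when these are close.\<close>

lemma sum_eig_powr_remainder:
  assumes s: "s > 1" and nn: "eig_min A B C \<ge> 0"
  shows "\<bar>(eig_max A B C powr s + eig_min A B C powr s) - (A powr s + C powr s)\<bar>
    \<le> s * (eig_max A B C powr (s - 1) - eig_min A B C powr (s - 1)) * eig_gap A B C"
proof -
  define e where "e = eig_gap A B C"
  define m where "m = min A C"
  define M where "M = max A C"
  have e: "eig_max A B C = M + e" "eig_min A B C = m - e" "e \<ge> 0"
    unfolding e_def m_def M_def by (rule eig_gap)+
  have mM: "m \<le> M" "A powr s + C powr s = M powr s + m powr s" by (auto simp: m_def M_def max_def min_def)
  have m0: "0 \<le> m - e" "0 \<le> m" "0 \<le> M" using nn e mM by auto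
  have 1: "s * M powr (s - 1) * e \<le> (M + e) powr s - M powr s" "(M + e) powr s - M powr s \<le> s * (M + e) powr (s - 1) * e"
    using powr_diff_bounds[of M "M + e" s] m0 e s by auto
  have 2: "s * (m - e) powr (s - 1) * e \<le> m powr s - (m - e) powr s" "m powr s - (m - e) powr s \<le> s * m powr (s - 1) * e"
    using powr_diff_bounds[of "m - e" m s] m0 e s by auto
  have "m powr (s - 1) \<le> M powr (s - 1)" using m0 mM s by (intro powr_mono2) auto
  then have "s * m powr (s - 1) * e \<le> s * M powr (s - 1) * e" using s e by (intro mult_right_mono mult_left_mono) auto
  then have "0 \<le> ((M + e) powr s + (m - e) powr s) - (M powr s + m powr s)" using 1 2 by linarith
  moreover have "((M + e) powr s + (m - e) powr s) - (M powr s + m powr s) \<le> s * ((M + e) powr (s - 1) - (m - e) powr (s - 1)) * e"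
    using 1 2 by (simp add: algebra_simps)
  ultimately show ?thesis using e mM by (simp add: e_def[symmetric])
qed

lemma powr_sum_le:
  fixes a b s :: real
  assumes "a \<ge> 0" "b \<ge> 0" "s > 0"
  shows "(a + b) powr s \<le> 2 powr s * (a powr s + b powr s)" "a powr s + b powr s \<le> 2 * (a + b) powr s"
proof -
  have "(a + b) powr s \<le> (2 * max a b) powr s" using assms by (intro powr_mono2) auto
  also have "\<dots> = 2 powr s * max a b powr s" using assms by (simp add: powr_mult)
  also have "\<dots> \<le> 2 powr s * (a powr s + b powr s)" by (intro mult_left_mono) (auto simp: max_def)
  finally show "(a + b) powr s \<le> 2 powr s * (a powr s + b powr s)" .
  have "a powr s \<le> (a + b) powr s" "b powr s \<le> (a + b) powr s" using assms by (auto intro: powr_mono2)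
  then show "a powr s + b powr s \<le> 2 * (a + b) powr s" by linarith
qed

text \<open>The mixed discriminant, that is, the polarization of the determinant: det (G + U) = det
  G + mdisc G U + det U. For invertible G, its quotient by det G is the trace of G^(-1) U.\<close>

definition mdisc :: "real^2^2 \<Rightarrow> real^2^2 \<Rightarrow> real" where
  "mdisc G U = G$1$1 * U$2$2 + G$2$2 * U$1$1 - G$1$2 * U$2$1 - G$2$1 * U$1$2"

text \<open>If \<open>G\<close> and \<open>U\<close> are the Gram matrices of a metric \<open>g\<close> and of \<open>u\<^sup>*h\<close> in a chart, this is the
  density of \<open>Tr Q(du)\<^sup>2\<^sup>s * 1\<close> in that chart: the numbers raised to the power \<open>s\<close> are the
  eigenvalues of \<open>U\<close> relative to \<open>G\<close>.\<close>
definition dens :: "real \<Rightarrow> real^2^2 \<Rightarrow> real^2^2 \<Rightarrow> real" where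
  "dens s G U =
    ((mdisc G U / (2 * det G) + sqrt ((mdisc G U / (2 * det G))\<^sup>2 - det U / det G)) powr s
     + (mdisc G U / (2 * det G) - sqrt ((mdisc G U / (2 * det G))\<^sup>2 - det U / det G)) powr s) * sqrt (det G)"

lemma det_congruence: "det (transpose C ** X ** C) = (det C)\<^sup>2 * det X" for X :: "real^2^2"
  by (simp add: det_mul power2_eq_square mult_ac)

lemma mdisc_congruence: "mdisc (transpose C ** G ** C) (transpose C ** U ** C) = (det C)\<^sup>2 * mdisc G U"
  by (simp add: mdisc_def det_2 matrix_matrix_mult_def transpose_def sum_2 power2_eq_square algebra_simps)

text \<open>Relative eigenvalues do not depend on the basis; only the factor sqrt (det G) sees
  \<open>C\<close>. Hence the density may be computed in any frame.\<close>

lemma dens_congruence: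
  assumes "det C \<noteq> 0"
  shows "dens s (transpose C ** G ** C) (transpose C ** U ** C) = \<bar>det C\<bar> * dens s G U"
proof -
  note d = det_congruence and m = mdisc_congruence
  have c: "(det C)\<^sup>2 \<noteq> 0" using assms by simp
  have q: "((det C)\<^sup>2 * mdisc G U) / (2 * ((det C)\<^sup>2 * det G)) = mdisc G U / (2 * det G)"
    "((det C)\<^sup>2 * det U) / ((det C)\<^sup>2 * det G) = det U / det G"
    using c by (auto simp: field_simps)
  show ?thesis unfolding dens_def d m q by (simp add: real_sqrt_mult)
qed

section \<open>The density for metrics close to the standard one\<close>

definition mat2 :: "real \<Rightarrow> real \<Rightarrow> real \<Rightarrow> real \<Rightarrow> real^2^2" where
  "mat2 p q r s = vector [vector [p, q], vector [r, s]]"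

lemma mat2_nth [simp]: "mat2 p q r s $ 1 $ 1 = p" "mat2 p q r s $ 1 $ 2 = q"
  "mat2 p q r s $ 2 $ 1 = r" "mat2 p q r s $ 2 $ 2 = s"
  by (simp_all add: mat2_def)

lemma mat2_eqI: "X$1$1 = p \<Longrightarrow> X$1$2 = q \<Longrightarrow> X$2$1 = r \<Longrightarrow> X$2$2 = s \<Longrightarrow> X = mat2 p q r s"
  by (simp add: vec_eq_iff forall_2)

text \<open>The matrix with rows \<open>(A, B)\<close> and \<open>(B, C)\<close> represents the form \<open>diag(a, b)\<close> in the basis
  obtained from the standard one by Gram-Schmidt with respect to \<open>G\<close>.\<close>
lemma dens_diag:
  fixes g11 g12 g22 a b :: real
  defines "d \<equiv> g11 * g22 - g12\<^sup>2"
  defines "A \<equiv> a / g11" and "B \<equiv> - a * g12 / (g11 * sqrt d)" and "C \<equiv> (b + a * g12\<^sup>2 / g11\<^sup>2) * g11 / d"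
  assumes "g11 > 0" "d > 0"
  shows "dens s (mat2 g11 g12 g12 g22) (mat2 a 0 0 b) = (eig_max A B C powr s + eig_min A B C powr s) * sqrt d"
    and "A * C - B\<^sup>2 = a * b / d" "A + C = (g22 * a + g11 * b) / d"
proof -
  have B2: "B\<^sup>2 = a\<^sup>2 * g12\<^sup>2 / (g11\<^sup>2 * d)"
    using assms(5,6) by (simp add: B_def power_mult_distrib power_divide)
  show AC: "A * C - B\<^sup>2 = a * b / d"
    unfolding B2 A_def C_def using assms(5,6) by (simp add: field_simps power2_eq_square)
  have "A + C = (a * (d + g12\<^sup>2) + b * g11\<^sup>2) / (g11 * d)"
    unfolding A_def C_def using assms(5,6) by (simp add: field_simps power2_eq_square)
  also have "a * (d + g12\<^sup>2) + b * g11\<^sup>2 = (g22 * a + g11 * b) * g11"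
    by (simp add: d_def power2_eq_square algebra_simps)
  also have "\<dots> / (g11 * d) = (g22 * a + g11 * b) / d" using assms(5,6) by (simp add: field_simps)
  finally show S: "A + C = (g22 * a + g11 * b) / d" .
  have dd: "det (mat2 g11 g12 g12 g22) = d" "det (mat2 a 0 0 b) = a * b"
    "mdisc (mat2 g11 g12 g12 g22) (mat2 a 0 0 b) = g22 * a + g11 * b"
    by (simp_all add: det_2 d_def power2_eq_square mdisc_def)
  have m: "(g22 * a + g11 * b) / (2 * d) = (A + C) / 2" unfolding S by simp
  have r: "((A + C) / 2)\<^sup>2 - a * b / d = ((A - C)/2)\<^sup>2 + B\<^sup>2"
    unfolding AC[symmetric] by (simp add: power2_eq_square field_simps)
  show "dens s (mat2 g11 g12 g12 g22) (mat2 a 0 0 b) = (eig_max A B C powr s + eig_min A B C powr s) * sqrt d"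
    unfolding dens_def dd m r eig_max_def eig_min_def ..
qed

lemma eig_min_nonneg:
  assumes "A + C \<ge> 0" "A * C - B\<^sup>2 \<ge> 0"
  shows "eig_min A B C \<ge> 0"
proof -
  have "sqrt (((A - C)/2)\<^sup>2 + B\<^sup>2) \<le> sqrt (((A + C)/2)\<^sup>2)"
    using assms by (intro real_sqrt_le_mono) (simp add: power2_eq_square field_simps)
  then show ?thesis using assms by (simp add: eig_min_def)
qed

lemma dens_one_diag: "a \<ge> 0 \<Longrightarrow> b \<ge> 0 \<Longrightarrow> dens s (mat2 1 0 0 1) (mat2 a 0 0 b) = a powr s + b powr s"
proof -
  assume "a \<ge> 0" "b \<ge> 0"
  have "sqrt (((a - b)/2)\<^sup>2) = \<bar>a - b\<bar> / 2" by simp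
  then show ?thesis
    using dens_diag(1)[of 1 1 0 s a b] by (auto simp: eig_max_def eig_min_def abs_if field_simps)
qed

text \<open>In the first summand one factor 2 counts the eigenvalues and the other bounds sqrt (det
  G); \<open>s * 3 powr (s - 1)\<close> is the Lipschitz constant of the power on [0, 3 (a + b)] up
  to (a + b)^(s - 1), the 8 comes from \<open>E\<close> in the next proof and
  \<open>2 powr s\<close> from \<open>powr_sum_le\<close>. The final 3 is the bound for the
  deviation of sqrt (det G) from 1.\<close>

definition dens_const :: "real \<Rightarrow> real" where
  "dens_const s = 2 * (2 * (s * 3 powr (s - 1) * 8 * 2 powr s)) + 3"

text \<open>The error is relative to the unperturbed density, uniformly in \<open>a\<close> and
  \<open>b\<close>; this later provides an integrable majorant. The bound 1/4 keeps
  \<open>g11\<close> above 3/4 and the determinant above 1/2, away from all denominators.\<close>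

lemma dens_lipschitz:
  fixes g11 g12 g22 a b :: real
  assumes s: "s > 1" and ab: "a \<ge> 0" "b \<ge> 0" and eps: "\<epsilon> \<le> 1/4"
    and g: "\<bar>g11 - 1\<bar> \<le> \<epsilon>" "\<bar>g12\<bar> \<le> \<epsilon>" "\<bar>g22 - 1\<bar> \<le> \<epsilon>"
  shows "\<bar>dens s (mat2 g11 g12 g12 g22) (mat2 a 0 0 b) - (a powr s + b powr s)\<bar> \<le> dens_const s * \<epsilon> * (a powr s + b powr s)"
proof -
  have e0: "\<epsilon> \<ge> 0" using g by linarith
  define d where "d = g11 * g22 - g12\<^sup>2"
  define A where "A = a / g11"
  define B where "B = - a * g12 / (g11 * sqrt d)"
  define C where "C = (b + a * g12\<^sup>2 / g11\<^sup>2) * g11 / d"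
  define S where "S = a powr s + b powr s"
  have g11: "3/4 \<le> g11" "g11 \<le> 5/4" and g22: "3/4 \<le> g22" "g22 \<le> 5/4" using g eps by linarith+
  have g12: "g12\<^sup>2 \<le> \<epsilon> / 4" "g12\<^sup>2 \<le> 1/16"
  proof -
    have "\<bar>g12\<bar> * \<bar>g12\<bar> \<le> \<epsilon> * (1/4)" using g e0 eps by (intro mult_mono) auto
    then show "g12\<^sup>2 \<le> \<epsilon> / 4" by (simp add: power2_eq_square abs_mult[symmetric])
    then show "g12\<^sup>2 \<le> 1/16" using eps by linarith
  qed
  have "(3/4) * (3/4) \<le> g11 * g22" using g11 g22 by (intro mult_mono) auto
  then have d: "d \<ge> 1/2" using g12 by (simp add: d_def)
  have "(g11 - 1) * (g22 - 1) \<le> \<epsilon> * (1/4) \<and> - ((g11 - 1) * (g22 - 1)) \<le> \<epsilon> * (1/4)"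
  proof -
    have "\<bar>g11 - 1\<bar> * \<bar>g22 - 1\<bar> \<le> \<epsilon> * (1/4)" using g e0 eps by (intro mult_mono) auto
    then show ?thesis unfolding abs_mult[symmetric] by (simp only: abs_le_iff)
  qed
  moreover have "g11 * g22 = 1 + (g11 - 1) + (g22 - 1) + (g11 - 1) * (g22 - 1)" by (simp add: algebra_simps)
  moreover have "0 \<le> g12\<^sup>2" by simp
  ultimately have d1: "\<bar>d - 1\<bar> \<le> 3 * \<epsilon>" using g g12 e0 unfolding d_def abs_le_iff by linarith
  have sd: "1/2 \<le> sqrt d" by (rule real_le_rsqrt) (use d in \<open>simp add: power2_eq_square\<close>)
  have sd2: "\<bar>sqrt d - 1\<bar> \<le> 3 * \<epsilon>"
  proof -
    have "(sqrt d - 1) * (sqrt d + 1) = d - 1" using d by (simp add: algebra_simps)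
    then have "\<bar>sqrt d - 1\<bar> * \<bar>sqrt d + 1\<bar> = \<bar>d - 1\<bar>" by (simp only: abs_mult[symmetric])
    then have "\<bar>sqrt d - 1\<bar> * (sqrt d + 1) = \<bar>d - 1\<bar>" using sd by simp
    moreover have "\<bar>sqrt d - 1\<bar> * 1 \<le> \<bar>sqrt d - 1\<bar> * (sqrt d + 1)" using sd d by (intro mult_left_mono) simp_all
    ultimately show ?thesis using d1 by (simp only: mult_1_right)
  qed
  have Aa: "\<bar>A - a\<bar> \<le> 2 * \<epsilon> * a"
  proof -
    have "A - a = a * (1 - g11) / g11" using g11 by (simp add: A_def field_simps)
    then have "\<bar>A - a\<bar> = a * \<bar>g11 - 1\<bar> / g11" using g11 ab by (simp add: abs_mult abs_minus_commute)
    also have "\<dots> \<le> (a * \<epsilon>) / (1/2)" using g11 g ab e0 by (intro frac_le mult_left_mono mult_nonneg_nonneg) auto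
    finally show ?thesis by (simp add: mult_ac)
  qed
  have Bb: "\<bar>B\<bar> \<le> 3 * \<epsilon> * a"
  proof -
    have "\<bar>B\<bar> = a * \<bar>g12\<bar> / (g11 * sqrt d)" using g11 sd ab d by (simp add: B_def abs_mult)
    also have "\<dots> \<le> (a * \<epsilon>) / (3/4 * (1/2))"
      using g11 sd g ab e0 by (intro frac_le mult_left_mono mult_mono mult_nonneg_nonneg) auto
    also have "\<dots> = (8/3) * (a * \<epsilon>)" by simp
    also have "\<dots> \<le> 3 * (a * \<epsilon>)" using ab e0 by (intro mult_right_mono) auto
    finally show ?thesis by (simp add: mult_ac)
  qed
  have Cb: "\<bar>C - b\<bar> \<le> 8 * \<epsilon> * b + \<epsilon> * a"
  proof -
    have "C - b = b * (g11 - d) / d + a * (g12\<^sup>2 / (g11 * d))"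
      using g11 d by (simp add: C_def field_simps power2_eq_square)
    then have "\<bar>C - b\<bar> \<le> \<bar>b * (g11 - d) / d\<bar> + \<bar>a * (g12\<^sup>2 / (g11 * d))\<bar>"
      by (simp only: abs_triangle_ineq)
    moreover have "\<bar>b * (g11 - d) / d\<bar> \<le> (b * (4 * \<epsilon>)) / (1/2)"
    proof -
      have "\<bar>g11 - d\<bar> \<le> 4 * \<epsilon>" using g d1 by linarith
      then have "b * \<bar>g11 - d\<bar> / d \<le> (b * (4 * \<epsilon>)) / (1/2)"
        using ab d e0 by (intro frac_le mult_left_mono mult_nonneg_nonneg) auto
      then show ?thesis using ab d by (simp add: abs_mult)
    qed
    moreover have "\<bar>a * (g12\<^sup>2 / (g11 * d))\<bar> \<le> a * \<epsilon>"
    proof -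
      have "g12\<^sup>2 / (g11 * d) \<le> (\<epsilon> / 4) / (3/4 * (1/2))"
        using g12 g11 d e0 by (intro frac_le mult_mono) auto
      also have "\<dots> \<le> \<epsilon>" using e0 by simp
      finally have "g12\<^sup>2 / (g11 * d) \<le> \<epsilon>" .
      moreover have "0 \<le> g12\<^sup>2 / (g11 * d)" using g11 d by simp
      ultimately have "a * \<bar>g12\<^sup>2 / (g11 * d)\<bar> \<le> a * \<epsilon>" using ab by (intro mult_left_mono) (simp_all only: abs_of_nonneg)
      then show ?thesis using ab by (simp only: abs_mult abs_of_nonneg)
    qed
    ultimately have "\<bar>C - b\<bar> \<le> (b * (4 * \<epsilon>)) / (1/2) + a * \<epsilon>" by (meson add_mono order_trans)
    then show ?thesis by (simp add: mult_ac)
  qed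
  \<comment> \<open>The three deviations add up to at most 6 \<epsilon> a + 8 \<epsilon> b.\<close>
  define E where "E = 8 * \<epsilon> * (a + b)"
  have E: "\<bar>A - a\<bar> + \<bar>C - b\<bar> + \<bar>B\<bar> \<le> E"
  proof -
    have "2 * \<epsilon> * a + (8 * \<epsilon> * b + \<epsilon> * a) + 3 * \<epsilon> * a \<le> E" using ab e0 by (simp add: E_def algebra_simps)
    then show ?thesis using Aa Bb Cb by linarith
  qed
  \<comment> \<open>With \<epsilon> at most 1/4 this places the old and the new eigenvalues in
    [0, 3 (a + b)], where the power is Lipschitz.\<close>
  have Eab: "E \<le> 2 * (a + b)"
    unfolding E_def using ab eps by (intro mult_right_mono) auto
  define L where "L = eig_max A B C"
  define l where "l = eig_min A B C"
  have gap: "L = max A C + eig_gap A B C" "l = min A C - eig_gap A B C" "0 \<le> eig_gap A B C" "eig_gap A B C \<le> \<bar>B\<bar>"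
    unfolding L_def l_def by (rule eig_gap)+
  have "\<bar>max A C - max a b\<bar> \<le> \<bar>A - a\<bar> + \<bar>C - b\<bar>" "\<bar>min A C - min a b\<bar> \<le> \<bar>A - a\<bar> + \<bar>C - b\<bar>"
    by linarith+
  note mm = this
  have aux: "\<bar>X + g - Y\<bar> \<le> E \<and> \<bar>X - g - Y\<bar> \<le> E" if "\<bar>X - Y\<bar> \<le> \<bar>A - a\<bar> + \<bar>C - b\<bar>" "0 \<le> g" "g \<le> \<bar>B\<bar>" for X Y g :: real
    using that E by linarith
  have LE: "\<bar>L - max a b\<bar> \<le> E" "\<bar>l - min a b\<bar> \<le> E"
    unfolding gap(1,2) using aux[OF mm(1) gap(3,4)] aux[OF mm(2) gap(3,4)] by blast+
  have g11p: "g11 > 0" "g11 * g22 - g12\<^sup>2 > 0" using g11 d d_def by auto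
  note dd = dens_diag[OF g11p, where a = a and b = b, folded d_def, folded A_def B_def C_def]
  have "A + C \<ge> 0" "A * C - B\<^sup>2 \<ge> 0" unfolding dd(2,3) using ab d g11 g22 by (auto intro!: divide_nonneg_nonneg add_nonneg_nonneg mult_nonneg_nonneg)
  then have l0: "l \<ge> 0" "L \<ge> l" unfolding l_def L_def
    by (auto intro!: eig_min_nonneg) (simp add: eig_min_def eig_max_def)
  have bd: "max a b \<le> 3 * (a + b)" "min a b \<le> 3 * (a + b)" "L \<le> 3 * (a + b)" "l \<le> 3 * (a + b)"
  proof -
    have "max a b \<le> a + b" "min a b \<le> a + b" using ab by auto
    moreover have "Y \<le> 3 * (a + b)" if "Y \<le> a + b" for Y :: real
      using that ab by (intro order_trans[OF that]) simp
    moreover have "L \<le> 3 * (a + b)" if "\<bar>L - Y\<bar> \<le> E" "Y \<le> a + b" for Y :: real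
    proof -
      have "L \<le> Y + E" using that(1) by (simp add: abs_le_iff)
      then show ?thesis using that(2) Eab by (simp add: distrib_left)
    qed
    ultimately show "max a b \<le> 3 * (a + b)" "min a b \<le> 3 * (a + b)" "L \<le> 3 * (a + b)" "l \<le> 3 * (a + b)"
      using LE l0(2) by (blast intro: order_trans)+
  qed
  let ?K = "s * (3 * (a + b)) powr (s - 1)"
  have K0: "0 \<le> ?K" using s by simp
  have "\<bar>L powr s - max a b powr s\<bar> \<le> ?K * \<bar>L - max a b\<bar>"
    by (rule powr_lipschitz) (use l0 bd ab s in auto)
  also have "\<dots> \<le> ?K * E" using LE(1) K0 by (rule mult_left_mono)
  finally have F1: "\<bar>L powr s - max a b powr s\<bar> \<le> ?K * E" .
  have "\<bar>l powr s - min a b powr s\<bar> \<le> ?K * \<bar>l - min a b\<bar>"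
    by (rule powr_lipschitz) (use l0 bd ab s in auto)
  also have "\<dots> \<le> ?K * E" using LE(2) K0 by (rule mult_left_mono)
  finally have F2: "\<bar>l powr s - min a b powr s\<bar> \<le> ?K * E" .
  have "max a b powr s + min a b powr s = S" by (auto simp: S_def max_def min_def)
  then have "(L powr s + l powr s) - S = (L powr s - max a b powr s) + (l powr s - min a b powr s)" by linarith
  then have "\<bar>(L powr s + l powr s) - S\<bar> \<le> \<bar>L powr s - max a b powr s\<bar> + \<bar>l powr s - min a b powr s\<bar>"
    by (simp only: abs_triangle_ineq)
  also have "\<dots> \<le> ?K * E + ?K * E" using F1 F2 by (rule add_mono)
  finally have F: "\<bar>(L powr s + l powr s) - S\<bar> \<le> 2 * (?K * E)" by (simp only: mult_2)
  have "?K * E = (s * 3 powr (s - 1) * 8 * \<epsilon>) * (a + b) powr s"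
  proof (cases "a + b = 0")
    case False
    then have "(a + b) powr s = (a + b) powr (s - 1) * (a + b)" using ab by (simp add: powr_diff)
    moreover have "(3 * (a + b)) powr (s - 1) = 3 powr (s - 1) * (a + b) powr (s - 1)"
      by (rule powr_mult)
    ultimately have "?K * E = s * (3 powr (s - 1) * (a + b) powr (s - 1)) * (8 * \<epsilon> * (a + b))"
      "(a + b) powr s = (a + b) powr (s - 1) * (a + b)" by (simp_all only: E_def)
    then show ?thesis by (simp only: mult_ac)
  qed (simp add: E_def)
  also have "\<dots> \<le> (s * 3 powr (s - 1) * 8 * \<epsilon>) * (2 powr s * S)"
    unfolding S_def using powr_sum_le(1)[OF ab, of s] s e0 by (intro mult_left_mono) auto
  finally have K: "?K * E \<le> (s * 3 powr (s - 1) * 8 * 2 powr s) * \<epsilon> * S" by (simp only: mult_ac)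
  have S0: "S \<ge> 0" by (simp add: S_def)
  have "dens s (mat2 g11 g12 g12 g22) (mat2 a 0 0 b) - S = ((L powr s + l powr s) - S) * sqrt d + S * (sqrt d - 1)"
    unfolding dd(1) L_def l_def by (simp add: algebra_simps)
  then have "\<bar>dens s (mat2 g11 g12 g12 g22) (mat2 a 0 0 b) - S\<bar>
      \<le> \<bar>(L powr s + l powr s) - S\<bar> * \<bar>sqrt d\<bar> + S * \<bar>sqrt d - 1\<bar>"
    using abs_triangle_ineq[of "((L powr s + l powr s) - S) * sqrt d" "S * (sqrt d - 1)"] S0
    by (simp only: abs_mult abs_of_nonneg)
  also have "\<dots> \<le> (2 * ((s * 3 powr (s - 1) * 8 * 2 powr s) * \<epsilon> * S)) * 2 + S * (3 * \<epsilon>)"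
  proof (intro add_mono mult_mono)
    show "\<bar>L powr s + l powr s - S\<bar> \<le> 2 * (s * 3 powr (s - 1) * 8 * 2 powr s * \<epsilon> * S)"
      using F K by linarith
    show "\<bar>sqrt d\<bar> \<le> 2" using sd2 eps sd by linarith
    show "0 \<le> 2 * (s * 3 powr (s - 1) * 8 * 2 powr s * \<epsilon> * S)" using s e0 S0 by simp
  qed (use sd2 S0 in auto)
  also have "\<dots> = dens_const s * \<epsilon> * S" by (simp add: dens_const_def algebra_simps)
  finally show ?thesis unfolding S_def .
qed

section \<open>Differentiability of the density in the metric\<close>

lemma powr_compose_has_derivative_nonneg:
  fixes A :: "real \<Rightarrow> real"
  assumes "s > 1" "(A has_real_derivative A') (at 0)" "\<forall>\<^sub>F t in nhds 0. A t \<ge> 0"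
  shows "((\<lambda>t. A t powr s) has_real_derivative s * A 0 powr (s - 1) * A') (at 0)"
proof -
  obtain S where S: "open S" "0 \<in> S" "\<And>t. t \<in> S \<Longrightarrow> A t \<ge> 0"
    using assms(3) unfolding eventually_nhds by blast
  have "((\<lambda>x. x powr s) has_real_derivative s * A 0 powr (s - 1)) (at (A 0) within A ` S)"
    by (rule has_field_derivative_subset[OF powr_has_derivative_nonneg]) (use S assms(1) in auto)
  moreover have "(A has_real_derivative A') (at 0 within S)"
    using assms(2) by (rule has_field_derivative_at_within)
  ultimately have "((\<lambda>x. x powr s) \<circ> A has_real_derivative s * A 0 powr (s - 1) * A') (at 0 within S)"
    by (rule DERIV_image_chain)
  then show ?thesis using at_within_open[OF S(2,1)] by (simp add: o_def)
qed

text \<open>The eigenvalues themselves may fail to be differentiable where a = b. Therefore the sum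
  of their powers is split into \<open>H\<close>, formed with the diagonal entries \<open>A\<close>
  and \<open>C\<close>, which are differentiable, and a remainder \<open>R\<close> that is o(t). The
  off-diagonal derivative \<open>k12\<close> enters only \<open>R\<close>, hence not the
  result.\<close>

lemma dens_has_derivative:
  fixes g11 g12 g22 :: "real \<Rightarrow> real"
  assumes s: "s > 1" and ab: "a \<ge> 0" "b \<ge> 0"
    and g0: "g11 0 = 1" "g12 0 = 0" "g22 0 = 1"
    and g': "(g11 has_real_derivative k11) (at 0)" "(g12 has_real_derivative k12) (at 0)" "(g22 has_real_derivative k22) (at 0)"
  shows "((\<lambda>t. dens s (mat2 (g11 t) (g12 t) (g12 t) (g22 t)) (mat2 a 0 0 b)) has_real_derivative
    (a powr s + b powr s) * ((k11 + k22) / 2) - s * (a powr s * k11 + b powr s * k22)) (at 0)"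
proof -
  define d where "d t = g11 t * g22 t - (g12 t)\<^sup>2" for t
  define A where "A t = a / g11 t" for t
  define B where "B t = - a * g12 t / (g11 t * sqrt (d t))" for t
  define C where "C t = (b + a * (g12 t)\<^sup>2 / (g11 t)\<^sup>2) * g11 t / d t" for t
  define L where "L t = eig_max (A t) (B t) (C t)" for t
  define l where "l t = eig_min (A t) (B t) (C t)" for t
  define e where "e t = eig_gap (A t) (B t) (C t)" for t
  have d': "(d has_real_derivative k11 + k22) (at 0)"
    unfolding d_def[abs_def] by (rule derivative_eq_intros g' refl)+ (simp add: g0)
  have d0: "d 0 = 1" by (simp add: d_def g0)
  have A': "(A has_real_derivative - (a * k11)) (at 0)"
    unfolding A_def[abs_def] by (rule derivative_eq_intros g' refl)+ (simp_all add: g0)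
  have sd': "((\<lambda>t. sqrt (d t)) has_real_derivative (k11 + k22)/2) (at 0)"
    using d0 by (auto intro!: derivative_eq_intros d' simp: field_simps)
  have B': "(B has_real_derivative - (a * k12)) (at 0)"
    unfolding B_def[abs_def] by (rule derivative_eq_intros g' sd' refl)+ (simp_all add: g0 d0)
  have C': "(C has_real_derivative - (b * k22)) (at 0)"
  proof -
    have "((\<lambda>t. b + a * (g12 t)\<^sup>2 / (g11 t)\<^sup>2) has_real_derivative 0) (at 0)"
      using g0 by (auto intro!: derivative_eq_intros g')
    moreover have "((\<lambda>t. g11 t / d t) has_real_derivative - k22) (at 0)"
      using g0 d0 by (auto intro!: derivative_eq_intros g' d')
    ultimately have "((\<lambda>t. (b + a * (g12 t)\<^sup>2 / (g11 t)\<^sup>2) * (g11 t / d t)) has_real_derivative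
        0 * (g11 0 / d 0) + - k22 * (b + a * (g12 0)\<^sup>2 / (g11 0)\<^sup>2)) (at 0)"
      by (rule DERIV_mult)
    then show ?thesis unfolding C_def[abs_def] by (simp add: g0 d0 mult.commute)
  qed
  have ABC0: "A 0 = a" "B 0 = 0" "C 0 = b" by (simp_all add: A_def B_def C_def g0 d0)
  have tends: "(f \<longlongrightarrow> f 0) (nhds 0)" if "(f has_real_derivative f') (at 0)" for f :: "real \<Rightarrow> real" and f'
    using DERIV_isCont[OF that] by (simp add: continuous_at tendsto_at_iff_tendsto_nhds)
  have ev: "\<forall>\<^sub>F t in nhds 0. g11 t > 0 \<and> g22 t > 0 \<and> d t > 0"
    using order_tendstoD(1)[OF tends[OF g'(1)], of 0] order_tendstoD(1)[OF tends[OF g'(3)], of 0]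
      order_tendstoD(1)[OF tends[OF d'], of 0] g0 d0 by (auto simp: eventually_conj_iff)
  have pos: "A t \<ge> 0" "C t \<ge> 0" "l t \<ge> 0" "L t \<ge> 0"
    "dens s (mat2 (g11 t) (g12 t) (g12 t) (g22 t)) (mat2 a 0 0 b) = (L t powr s + l t powr s) * sqrt (d t)"
    if "g11 t > 0 \<and> g22 t > 0 \<and> d t > 0" for t
  proof -
    have g: "g11 t > 0" "g11 t * g22 t - (g12 t)\<^sup>2 > 0" using that by (auto simp: d_def)
    note dd = dens_diag[OF g, where a = a and b = b, folded d_def, folded A_def B_def C_def]
    show "A t \<ge> 0" "C t \<ge> 0" using that ab by (auto simp: A_def C_def)
    have "A t + C t \<ge> 0" "A t * C t - (B t)\<^sup>2 \<ge> 0" unfolding dd(2,3) using ab that by auto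
    then show "l t \<ge> 0" unfolding l_def by (rule eig_min_nonneg)
    moreover have "l t \<le> L t" by (simp add: l_def L_def eig_min_def eig_max_def)
    ultimately show "L t \<ge> 0" by simp
    show "dens s (mat2 (g11 t) (g12 t) (g12 t) (g22 t)) (mat2 a 0 0 b) = (L t powr s + l t powr s) * sqrt (d t)"
      unfolding dd(1) L_def l_def ..
  qed
  have pw: "c powr (s - 1) * c = c powr s" if "c \<ge> 0" for c :: real
    using that by (cases "c = 0") (auto simp: powr_diff)
  define H where "H t = A t powr s + C t powr s" for t
  define R where "R t = (L t powr s + l t powr s) - H t" for t
  have "((\<lambda>t. A t powr s) has_real_derivative s * A 0 powr (s - 1) * - (a * k11)) (at 0)"
    by (rule powr_compose_has_derivative_nonneg[OF s A' eventually_mono[OF ev]]) (rule pos)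
  moreover have "((\<lambda>t. C t powr s) has_real_derivative s * C 0 powr (s - 1) * - (b * k22)) (at 0)"
    by (rule powr_compose_has_derivative_nonneg[OF s C' eventually_mono[OF ev]]) (rule pos)
  ultimately have "(H has_real_derivative s * A 0 powr (s - 1) * - (a * k11) + s * C 0 powr (s - 1) * - (b * k22)) (at 0)"
    unfolding H_def[abs_def] by (rule DERIV_add)
  moreover have "s * A 0 powr (s - 1) * - (a * k11) + s * C 0 powr (s - 1) * - (b * k22) = - s * (a powr s * k11 + b powr s * k22)"
    unfolding ABC0 pw[OF ab(1), symmetric] pw[OF ab(2), symmetric] by (simp add: algebra_simps)
  ultimately have H': "(H has_real_derivative - s * (a powr s * k11 + b powr s * k22)) (at 0)" by simp
  have lim: "(A \<longlongrightarrow> a) (at 0)" "(B \<longlongrightarrow> 0) (at 0)" "(C \<longlongrightarrow> b) (at 0)"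
    using DERIV_isCont[OF A'] DERIV_isCont[OF B'] DERIV_isCont[OF C'] by (simp_all add: isCont_def ABC0)
  have Bt: "((\<lambda>t. B t / t) \<longlongrightarrow> - (a * k12)) (at 0)"
    using B' by (simp add: DERIV_def ABC0)
  have L0: "eig_max a 0 b = max a b" "eig_min a 0 b = min a b" "eig_gap a 0 b = 0"
    using eig_gap[of a 0 b] by simp_all
  have Llim: "(L \<longlongrightarrow> max a b) (at 0)" "(l \<longlongrightarrow> min a b) (at 0)"
    unfolding L0(1,2)[symmetric] unfolding L_def[abs_def] l_def[abs_def] eig_max_def eig_min_def
    by (auto intro!: tendsto_eq_intros lim)
  have ev': "\<forall>\<^sub>F t in at 0. g11 t > 0 \<and> g22 t > 0 \<and> d t > 0"
    using ev by (auto simp: eventually_at_filter elim: eventually_mono)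
  have Lp: "((\<lambda>t. L t powr (s - 1)) \<longlongrightarrow> max a b powr (s - 1)) (at 0)" "((\<lambda>t. l t powr (s - 1)) \<longlongrightarrow> min a b powr (s - 1)) (at 0)"
    using s by (auto intro!: tendsto_powr2[OF Llim(1)] tendsto_powr2[OF Llim(2)] tendsto_const eventually_mono[OF ev'] pos)
  have Rb: "\<bar>R t\<bar> \<le> s * (L t powr (s - 1) - l t powr (s - 1)) * e t" if "g11 t > 0 \<and> g22 t > 0 \<and> d t > 0" for t
    using sum_eig_powr_remainder[OF s, of "A t" "B t" "C t"] pos(3)[OF that]
    by (simp add: R_def H_def L_def l_def e_def)
  have e0: "0 \<le> e t" "e t \<le> \<bar>B t\<bar>" "e t * \<bar>A t - C t\<bar> \<le> (B t)\<^sup>2" for t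
    unfolding e_def by (rule eig_gap)+
  have LL: "0 \<le> L t powr (s - 1) - l t powr (s - 1)" if "g11 t > 0 \<and> g22 t > 0 \<and> d t > 0" for t
  proof -
    have "l t \<le> L t" by (simp add: l_def L_def eig_min_def eig_max_def)
    then show ?thesis using powr_mono2[of "s - 1" "l t" "L t"] pos(3)[OF that] s by simp
  qed
  \<comment> \<open>The gap divided by t is bounded in any case. If a = b, the difference of powers
    in \<open>Rb\<close> tends to 0; if a and b differ, the gap is at most
    \<open>(B t)\<^sup>2 / \<bar>A t - C t\<bar>\<close>, hence of second order.\<close>
  have Rt: "((\<lambda>t. R t / t) \<longlongrightarrow> 0) (at 0)"
  proof (cases "a = b")
    case True
    have lim0: "((\<lambda>t. s * (L t powr (s - 1) - l t powr (s - 1)) * \<bar>B t / t\<bar>) \<longlongrightarrow> s * (max a b powr (s - 1) - min a b powr (s - 1)) * \<bar>- (a * k12)\<bar>) (at 0)"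
      by (intro tendsto_intros Lp Bt)
    have "\<forall>\<^sub>F t in at 0. norm (R t / t) \<le> s * (L t powr (s - 1) - l t powr (s - 1)) * \<bar>B t / t\<bar>"
      using ev'
    proof (rule eventually_mono)
      fix t assume t: "g11 t > 0 \<and> g22 t > 0 \<and> d t > 0"
      have "\<bar>R t\<bar> \<le> s * (L t powr (s - 1) - l t powr (s - 1)) * \<bar>B t\<bar>"
        by (rule order_trans[OF Rb[OF t] mult_left_mono[OF e0(2)]]) (use LL[OF t] s in simp)
      then show "norm (R t / t) \<le> s * (L t powr (s - 1) - l t powr (s - 1)) * \<bar>B t / t\<bar>"
        by (simp add: abs_divide divide_right_mono)
    qed
    moreover have "((\<lambda>t. s * (L t powr (s - 1) - l t powr (s - 1)) * \<bar>B t / t\<bar>) \<longlongrightarrow> 0) (at 0)"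
      using lim0 True by simp
    ultimately show ?thesis by (rule Lim_null_comparison)
  next
    case False
    have lim0: "((\<lambda>t. s * (L t powr (s - 1) - l t powr (s - 1)) * (\<bar>B t\<bar> * \<bar>B t / t\<bar> / \<bar>A t - C t\<bar>)) \<longlongrightarrow> s * (max a b powr (s - 1) - min a b powr (s - 1)) * (\<bar>0\<bar> * \<bar>- (a * k12)\<bar> / \<bar>a - b\<bar>)) (at 0)"
      by (rule tendsto_mult[OF tendsto_mult[OF tendsto_const tendsto_diff[OF Lp]]
            tendsto_divide[OF tendsto_mult[OF tendsto_rabs[OF lim(2)] tendsto_rabs[OF Bt]] tendsto_rabs[OF tendsto_diff[OF lim(1,3)]]]])
        (use False in simp)
    have "((\<lambda>t. \<bar>A t - C t\<bar>) \<longlongrightarrow> \<bar>a - b\<bar>) (at 0)" by (intro tendsto_intros lim)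
    then have "\<forall>\<^sub>F t in at 0. \<bar>A t - C t\<bar> > 0" using False by (intro order_tendstoD(1)) auto
    then have "\<forall>\<^sub>F t in at 0. norm (R t / t) \<le> s * (L t powr (s - 1) - l t powr (s - 1)) * (\<bar>B t\<bar> * \<bar>B t / t\<bar> / \<bar>A t - C t\<bar>)"
      using ev'
    proof eventually_elim
      case (elim t)
      have "e t \<le> (B t)\<^sup>2 / \<bar>A t - C t\<bar>" using e0(3)[of t] elim(1) by (simp add: field_simps)
      then have "\<bar>R t\<bar> \<le> s * (L t powr (s - 1) - l t powr (s - 1)) * ((B t)\<^sup>2 / \<bar>A t - C t\<bar>)"
        by (rule order_trans[OF Rb[OF elim(2)] mult_left_mono]) (use LL[OF elim(2)] s in simp)
      then have "\<bar>R t\<bar> / \<bar>t\<bar> \<le> s * (L t powr (s - 1) - l t powr (s - 1)) * ((B t)\<^sup>2 / \<bar>A t - C t\<bar>) / \<bar>t\<bar>"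
        by (rule divide_right_mono) simp
      moreover have "(B t)\<^sup>2 = \<bar>B t\<bar> * \<bar>B t\<bar>" by (simp add: power2_eq_square)
      ultimately show ?case by (simp add: abs_divide mult.commute[of "\<bar>A t - C t\<bar>"])
    qed
    moreover have "((\<lambda>t. s * (L t powr (s - 1) - l t powr (s - 1)) * (\<bar>B t\<bar> * \<bar>B t / t\<bar> / \<bar>A t - C t\<bar>)) \<longlongrightarrow> 0) (at 0)"
      using lim0 by simp
    ultimately show ?thesis by (rule Lim_null_comparison)
  qed
  have "R 0 = 0" unfolding R_def H_def L_def l_def ABC0 L0 by (auto simp: max_def min_def)
  then have R': "(R has_real_derivative 0) (at 0)" using Rt by (simp add: DERIV_def)
  have "((\<lambda>t. (H t + R t) * sqrt (d t)) has_real_derivative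
      (H 0 + R 0) * ((k11 + k22)/2) + (- s * (a powr s * k11 + b powr s * k22) + 0) * sqrt (d 0)) (at 0)"
    by (rule DERIV_mult'[OF DERIV_add[OF H' R'] sd'])
  moreover have "(H 0 + R 0) * ((k11 + k22)/2) + (- s * (a powr s * k11 + b powr s * k22) + 0) * sqrt (d 0)
      = (a powr s + b powr s) * ((k11 + k22) / 2) - s * (a powr s * k11 + b powr s * k22)"
    using \<open>R 0 = 0\<close> by (simp add: H_def ABC0 d0)
  moreover have E: "\<forall>\<^sub>F t in nhds 0. (H t + R t) * sqrt (d t) = dens s (mat2 (g11 t) (g12 t) (g12 t) (g22 t)) (mat2 a 0 0 b)"
    using ev by (rule eventually_mono) (simp add: R_def pos(5))
  ultimately show ?thesis by (simp only: DERIV_cong_ev[OF refl E refl])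
qed

section \<open>The hyperboloid and its chart\<close>

definition proj :: "real^3 \<Rightarrow> real^2" where
  "proj x = vector [x$1, x$2]"

lemma norm_2: "(norm (y :: real^2))\<^sup>2 = (y$1)\<^sup>2 + (y$2)\<^sup>2"
  by (simp add: norm_vec_def L2_set_def sum_2 real_norm_def)

lemma chart_nth [simp]: "chart y $ 1 = y$1" "chart y $ 2 = y$2" "chart y $ 3 = sqrt (1 + (norm y)\<^sup>2)"
  by (simp_all add: chart_def)

lemma proj_nth [simp]: "proj x $ 1 = x$1" "proj x $ 2 = x$2"
  by (simp_all add: proj_def)

lemma chart_hyp: "chart y \<in> hyp"
  by (simp add: hyp_def lor_def norm_2 power2_eq_square[symmetric])

lemma proj_chart [simp]: "proj (chart y) = y"
  by (simp add: vec_eq_iff forall_2)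

lemma chart_proj: "x \<in> hyp \<Longrightarrow> chart (proj x) = x"
  using hyp_norm[of x]
  by (auto simp: vec_eq_iff forall_3 norm_2 add.assoc[symmetric] hyp_def real_sqrt_unique)

lemma range_chart: "range chart = hyp"
  using chart_hyp chart_proj by (metis image_iff image_subsetI rangeI subsetI subset_antisym)

lemma smooth_chart: "smooth chart"
proof (rule smooth_vec)
  fix j :: 3
  have "smooth (\<lambda>y::real^2. sqrt (1 + (y$1 * y$1 + y$2 * y$2)))"
    by (intro smooth_sqrt smooth_add smooth_const smooth_mult smooth_coord)
      (simp add: add_pos_nonneg sum_squares_ge_zero)
  moreover have "1 + (y$1 * y$1 + y$2 * y$2) = 1 + (norm y)\<^sup>2" for y :: "real^2"
    unfolding norm_2 by (simp add: power2_eq_square)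
  ultimately have s: "smooth (\<lambda>y::real^2. sqrt (1 + (norm y)\<^sup>2))" by (simp only:)
  show "smooth (\<lambda>y. chart y $ j)" using exhaust_3[of j] s by auto
qed

lemma continuous_chart: "continuous_on S chart"
  by (rule smooth_continuous[OF smooth_chart])

lemma continuous_proj: "continuous_on S proj"
proof -
  have "proj = (\<lambda>x. \<chi> i. if i = 1 then x$1 else x$2)"
    by (auto simp: fun_eq_iff vec_eq_iff forall_2)
  moreover have "continuous_on S (\<lambda>x::real^3. \<chi> i::2. if i = 1 then x$1 else x$2)"
  proof (rule continuous_on_vec_lambda)
    show "continuous_on S (\<lambda>x::real^3. if i = 1 then x$1 else x$2)" for i :: 2
      by (cases "i = 1") (auto intro!: continuous_intros)
  qed
  ultimately show ?thesis by (simp only:)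
qed

lemma connected_hyp: "connected hyp"
  unfolding range_chart[symmetric] by (intro connected_continuous_image continuous_chart connected_UNIV)

lemma chart_3_pos: "chart y $ 3 > 0" by (simp add: add_pos_nonneg)

section \<open>Hyperbolic distance and isometries\<close>

lemma SO_plus_lor: "A \<in> SO_plus \<Longrightarrow> lor (A *v X) (A *v Y) = lor X Y"
  by (simp add: SO_plus_def)

text \<open>With e = (0,0,1), \<open>z$3\<close> is cosh of the distance from e to z, and
  \<open>- lor x z\<close> is cosh of the distance from x to z. The bound is the triangle inequality
  in the form cosh (r + s) \<le> 2 cosh r cosh s.\<close>

lemma hyp_lor_bound:
  assumes "x \<in> hyp" "z \<in> hyp"
  shows "z$3 \<le> 2 * x$3 * (- lor x z)"
proof -
  let ?a = "sqrt ((x$1)\<^sup>2 + (x$2)\<^sup>2)" and ?b = "sqrt ((z$1)\<^sup>2 + (z$2)\<^sup>2)"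
  have x: "(x$3)\<^sup>2 = 1 + ?a\<^sup>2" "x$3 \<ge> 1" and z: "(z$3)\<^sup>2 = 1 + ?b\<^sup>2" "z$3 \<ge> 1"
    using assms hyp_norm[of x] hyp_norm[of z] by (auto simp: hyp_def)
  have cs: "x$1 * z$1 + x$2 * z$2 \<le> ?a * ?b"
  proof -
    have "(x$1 * z$1 + x$2 * z$2)\<^sup>2 \<le> ((x$1)\<^sup>2 + (x$2)\<^sup>2) * ((z$1)\<^sup>2 + (z$2)\<^sup>2)"
    proof -
      have "((x$1)\<^sup>2 + (x$2)\<^sup>2) * ((z$1)\<^sup>2 + (z$2)\<^sup>2) - (x$1 * z$1 + x$2 * z$2)\<^sup>2 = (x$1 * z$2 - x$2 * z$1)\<^sup>2"
        by (simp add: power2_eq_square algebra_simps)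
      then show ?thesis by (metis diff_ge_0_iff_ge zero_le_power2)
    qed
    then have "x$1 * z$1 + x$2 * z$2 \<le> sqrt (((x$1)\<^sup>2 + (x$2)\<^sup>2) * ((z$1)\<^sup>2 + (z$2)\<^sup>2))"
      by (rule real_le_rsqrt)
    then show ?thesis by (simp add: real_sqrt_mult)
  qed
  have a: "0 \<le> ?a" "?a \<le> x$3" using x by (auto intro: power2_le_imp_le)
  have b: "?b \<le> z$3" using z by (auto intro: power2_le_imp_le)
  have "x$3 * z$3 - ?a * ?b \<ge> x$3 * z$3 - ?a * z$3" using a b by (simp add: mult_left_mono)
  also have "x$3 * z$3 - ?a * z$3 = z$3 * (x$3 - ?a)" by (simp add: algebra_simps)
  finally have 1: "z$3 * (x$3 - ?a) \<le> - lor x z" using cs by (simp add: lor_def)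
  have "(x$3 + ?a) * (x$3 - ?a) = (x$3)\<^sup>2 - ?a\<^sup>2" by (simp only: power2_eq_square square_diff_square_factored)
  then have "(x$3 + ?a) * (x$3 - ?a) = 1" using x by simp
  moreover have "(x$3 + ?a) * (x$3 - ?a) \<le> 2 * x$3 * (x$3 - ?a)" using a by (intro mult_right_mono) auto
  ultimately have "1 \<le> 2 * x$3 * (x$3 - ?a)" by simp
  then have "z$3 * 1 \<le> z$3 * (2 * x$3 * (x$3 - ?a))" using z by (intro mult_left_mono) auto
  also have "\<dots> = 2 * x$3 * (z$3 * (x$3 - ?a))" by simp
  also have "\<dots> \<le> 2 * x$3 * (- lor x z)" using 1 x by (intro mult_left_mono) auto
  finally show ?thesis by simp
qed

lemma hyp_lor_neg: "x \<in> hyp \<Longrightarrow> z \<in> hyp \<Longrightarrow> lor x z < 0"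
proof -
  assume a: "x \<in> hyp" "z \<in> hyp"
  then have "1 \<le> 2 * x$3 * (- lor x z)" "x$3 \<ge> 1" using hyp_lor_bound[OF a] by (auto simp: hyp_def)
  then show ?thesis using mult_nonneg_nonpos[of "2 * x$3" "- lor x z"] by fastforce
qed

text \<open>The sign of \<open>lor x z\<close> separates the two sheets: if \<open>z\<close> were on
  the lower sheet, \<open>- z\<close> would be in \<open>hyp\<close> and the sign would be
  opposite.\<close>

lemma hyp_if_lor_neg:
  assumes x: "x \<in> hyp" and z: "lor z z = -1" "lor x z < 0"
  shows "z \<in> hyp"
proof -
  have up: "z \<in> hyp" if "lor z z = -1" "z$3 > 0" for z :: "real^3"
  proof -
    have "1\<^sup>2 \<le> (z$3)\<^sup>2"
      using that(1) zero_le_square[of "z$1"] zero_le_square[of "z$2"] unfolding lor_def power2_eq_square by linarith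
    then have "1 \<le> z$3" using that(2) by (intro power2_le_imp_le[of 1]) auto
    then show ?thesis using that by (simp add: hyp_def)
  qed
  show ?thesis
  proof (rule up[OF z(1)], rule ccontr)
    assume "\<not> 0 < z$3"
    moreover have "z$3 \<noteq> 0"
      using z(1) zero_le_square[of "z$1"] zero_le_square[of "z$2"] unfolding lor_def by fastforce
    ultimately have "- z \<in> hyp" using z(1) by (intro up) (auto simp: lor_simps)
    then have "lor x (- z) < 0" by (rule hyp_lor_neg[OF x])
    then show False using z(2) by (simp add: lor_simps)
  qed
qed

text \<open>The condition \<open>A$3$3 > 0\<close> says that \<open>A\<close> keeps (0,0,1) on the
  upper sheet; all other points follow by comparing them with the image of this one.\<close>

lemma SO_plus_hyp:
  assumes A: "A \<in> SO_plus" and x: "x \<in> hyp"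
  shows "A *v x \<in> hyp"
proof -
  let ?e = "vector [0,0,1] :: real^3"
  have e: "?e \<in> hyp" by (simp add: hyp_def lor_def)
  have l: "lor (A *v y) (A *v y) = -1" if "y \<in> hyp" for y using SO_plus_lor[OF A] hyp_lor[OF that] by simp
  have "lor ?e (A *v ?e) = - A$3$3" by (simp add: lor_def matrix_vector_mult_def sum_3)
  then have "A *v ?e \<in> hyp" using A l[OF e] by (intro hyp_if_lor_neg[OF e]) (auto simp: SO_plus_def)
  then show ?thesis
    using hyp_lor_neg[OF e x] SO_plus_lor[OF A] by (intro hyp_if_lor_neg[OF _ l[OF x]]) auto
qed

lemma SO_plus_inverse:
  assumes "A \<in> SO_plus"
  shows "A ** matrix_inv A = mat 1" "matrix_inv A ** A = mat 1"
proof -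
  have "det A \<noteq> 0" using assms by (simp add: SO_plus_def)
  then have "\<exists>A'. A ** A' = mat 1 \<and> A' ** A = mat 1"
    using invertible_det_nz invertible_def by blast
  then have "A ** matrix_inv A = mat 1 \<and> matrix_inv A ** A = mat 1"
    unfolding matrix_inv_def by (rule someI_ex)
  then show "A ** matrix_inv A = mat 1" "matrix_inv A ** A = mat 1" by auto
qed

lemma SO_plus_inverse_mult:
  assumes "A \<in> SO_plus"
  shows "A *v (matrix_inv A *v x) = x" "matrix_inv A *v (A *v x) = x"
  using SO_plus_inverse[OF assms] by (simp_all add: matrix_vector_mul_assoc)

definition act :: "real^3^3 \<Rightarrow> real^2 \<Rightarrow> real^2" where
  "act A y = proj (A *v chart y)"

lemma chart_act: "A \<in> SO_plus \<Longrightarrow> chart (act A y) = A *v chart y"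
  by (simp add: act_def chart_proj SO_plus_hyp chart_hyp)

lemma matrix_vector_bounded_bilinear: "bounded_bilinear (\<lambda>A::real^3^3. \<lambda>x::real^3. A *v x)"
  unfolding bilinear_conv_bounded_bilinear[symmetric] bilinear_def
  by (intro conjI allI linearI)
    (simp_all add: matrix_vector_mult_add_rdistrib scaleR_matrix_vector_assoc matrix_vector_right_distrib matrix_vector_mult_scaleR)

lemma smooth_matrix_vector: "smooth f \<Longrightarrow> smooth (\<lambda>y. A *v f y)" for A :: "real^3^3"
  by (rule smooth_linear[OF matrix_vector_mul_bounded_linear])

lemma smooth_proj: "smooth f \<Longrightarrow> smooth (\<lambda>y. proj (f y))"
proof (rule smooth_vec)
  fix j :: 2 assume "smooth f"
  then show "smooth (\<lambda>y. proj (f y) $ j)" using exhaust_2[of j] by auto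
qed

lemma smooth_act: "smooth (act A)"
  unfolding act_def[abs_def] by (intro smooth_proj smooth_matrix_vector smooth_chart)

lemma det_chart: "chart y \<bullet> cross3 (partial 1 chart y) (partial 2 chart y) = 1 / sqrt (1 + (norm y)\<^sup>2)"
  and partial_chart_3: "partial i chart y $ 3 = y $ i / sqrt (1 + (norm y)\<^sup>2)"
  and partial_chart_12: "partial i chart y $ 1 = axis i 1 $ 1" "partial i chart y $ 2 = axis i 1 $ 2"
proof -
  have d: "chart differentiable (at y)" using smooth_chart smooth_differentiable by blast
  have p: "0 < 1 + (norm y)\<^sup>2" by (simp add: add_pos_nonneg)
  have c: "partial i chart y $ j = partial i (\<lambda>y. chart y $ j) y" for i j
    using partial_nth[OF d] by simp
  show 1: "partial i chart y $ 1 = axis i 1 $ 1" "partial i chart y $ 2 = axis i 1 $ 2" for i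
    unfolding c by (auto intro!: partial_eqI[where f' = "\<lambda>v. v $ 1"] partial_eqI[where f' = "\<lambda>v. v $ 2"] bounded_linear_imp_has_derivative)
  show 3: "partial i chart y $ 3 = y $ i / sqrt (1 + (norm y)\<^sup>2)" for i
  proof -
    have "((\<lambda>y. y \<bullet> y) has_derivative (\<lambda>v. 2 * (y \<bullet> v))) (at y)"
      by (auto intro!: derivative_eq_intros simp: inner_commute)
    then have "((\<lambda>y. sqrt (1 + y \<bullet> y)) has_derivative (\<lambda>v. (y \<bullet> v) / sqrt (1 + y \<bullet> y))) (at y)"
      using p by (auto intro!: derivative_eq_intros simp: power2_norm_eq_inner inner_commute field_simps)
    then have "partial i (\<lambda>y. sqrt (1 + y \<bullet> y)) y = (y \<bullet> axis i 1) / sqrt (1 + y \<bullet> y)"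
      by (rule partial_eqI)
    then show ?thesis unfolding c by (simp add: power2_norm_eq_inner inner_axis)
  qed
  have sq: "sqrt (1 + (norm y)\<^sup>2) * sqrt (1 + (norm y)\<^sup>2) = 1 + (y$1)\<^sup>2 + (y$2)\<^sup>2"
    using p by (simp add: norm_2)
  have "chart y \<bullet> cross3 (partial 1 chart y) (partial 2 chart y)
     = sqrt (1 + (norm y)\<^sup>2) - y$1 * (y$1 / sqrt (1 + (norm y)\<^sup>2)) - y$2 * (y$2 / sqrt (1 + (norm y)\<^sup>2))"
    by (simp add: inner_vec_def sum_3 cross3_def 1 3 axis_def)
  also have "\<dots> = 1 / sqrt (1 + (norm y)\<^sup>2)"
    using p sq by (simp add: field_simps power2_eq_square del: real_sqrt_mult_self)
  finally show "chart y \<bullet> cross3 (partial 1 chart y) (partial 2 chart y) = 1 / sqrt (1 + (norm y)\<^sup>2)" .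
qed

definition area :: "real^2 \<Rightarrow> real" where
  "area y = 1 / sqrt (1 + (norm y)\<^sup>2)"

lemma area_pos: "area y > 0" by (simp add: area_def add_pos_nonneg)

lemma partial_chart_compose:
  assumes "smooth \<Theta>"
  shows "partial i (\<lambda>y. chart (\<Theta> y)) y = (\<Sum>j\<in>UNIV. (partial i \<Theta> y $ j) *\<^sub>R partial j chart (\<Theta> y))"
  using assms smooth_chart by (intro partial_compose(1) smooth_differentiable)

text \<open>Comparing volumes gives the Jacobian determinant of a map which is known through its
  composition with the chart.\<close>
lemma det_jac_chart:
  assumes "smooth \<Theta>"
  shows "det (jac \<Theta> y) * area (\<Theta> y)
    = chart (\<Theta> y) \<bullet> cross3 (partial 1 (\<lambda>y. chart (\<Theta> y)) y) (partial 2 (\<lambda>y. chart (\<Theta> y)) y)"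
proof -
  let ?a = "partial 1 \<Theta> y" and ?b = "partial 2 \<Theta> y" and ?P = "\<lambda>i. partial i chart (\<Theta> y)"
  have "chart (\<Theta> y) \<bullet> cross3 (partial 1 (\<lambda>y. chart (\<Theta> y)) y) (partial 2 (\<lambda>y. chart (\<Theta> y)) y)
      = (?a$1 * ?b$2 - ?a$2 * ?b$1) * (chart (\<Theta> y) \<bullet> cross3 (?P 1) (?P 2))"
    unfolding partial_chart_compose[OF assms]
    by (simp add: sum_2 cross3_def inner_vec_def sum_3 algebra_simps)
  then show ?thesis unfolding det_chart by (simp add: det_2 jac_def area_def algebra_simps)
qed

lemma triple_product_matrix: "(A *v x) \<bullet> cross3 (A *v v) (A *v w) = det A * (x \<bullet> cross3 v w)"
  by (simp add: cross3_def inner_vec_def sum_3 det_3 matrix_vector_mult_def algebra_simps)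

lemma det_jac_act:
  assumes "A \<in> SO_plus"
  shows "det (jac (act A) y) * area (act A y) = area y"
proof -
  have p: "partial i (\<lambda>y. chart (act A y)) y = A *v partial i chart y" for i
    unfolding chart_act[OF assms]
    by (rule partial_linear[OF matrix_vector_mul_bounded_linear smooth_differentiable[OF smooth_chart]])
  show ?thesis
    unfolding det_jac_chart[OF smooth_act] p
    unfolding chart_act[OF assms] triple_product_matrix det_chart
    using assms by (simp add: SO_plus_def area_def)
qed

lemma diffeo_null_preimage:
  assumes "diffeo \<Theta> \<Psi>" and N: "N \<in> null_sets lborel"
  shows "\<Theta> -` N \<in> null_sets lborel"
proof -
  have sm: "smooth \<Theta>" and pos: "\<And>z. det (jac \<Theta> z) > 0" using assms by (auto simp: diffeo_def)
  have [measurable]: "\<Theta> \<in> borel_measurable borel" "(\<lambda>y. det (jac \<Theta> y)) \<in> borel_measurable borel" "N \<in> sets borel"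
    using smooth_continuous[OF sm] jac_continuous[OF sm] N by (auto intro: borel_measurable_continuous_onI)
  have "(\<integral>\<^sup>+ y. indicator N y \<partial>lborel) = 0" using N by (simp add: null_setsD1)
  then have "(\<integral>\<^sup>+ z. ennreal (det (jac \<Theta> z)) * indicator N (\<Theta> z) \<partial>lborel) = 0"
    using nn_integral_diffeo[OF assms(1), of "indicator N"] by simp
  then have "AE z in lborel. ennreal (det (jac \<Theta> z)) * indicator N (\<Theta> z) = 0"
    by (subst (asm) nn_integral_0_iff_AE) auto
  then have "AE z in lborel. z \<notin> \<Theta> -` N"
  proof (rule AE_mp, intro AE_I2 impI)
    fix z assume "ennreal (det (jac \<Theta> z)) * indicator N (\<Theta> z) = 0"
    then show "z \<notin> \<Theta> -` N" using pos[of z] by (auto simp: indicator_def ennreal_eq_0_iff split: if_splits)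
  qed
  moreover have "\<Theta> -` N \<in> sets lborel"
    using measurable_sets_borel[of \<Theta> borel N] by simp
  ultimately show ?thesis using AE_iff_null_sets by blast
qed

section \<open>Fundamental domains\<close>

locale surface =
  fixes M :: "'m::t2_space set" and \<pi> :: "real^3 \<Rightarrow> 'm" and \<Gamma> :: "(real^3^3) set"
  assumes surface: "closed_hyperbolic_surface M \<pi> \<Gamma>"
begin

lemma compact_M: "compact M" and \<Gamma>_SO: "\<Gamma> \<subseteq> SO_plus" and \<Gamma>_one: "mat 1 \<in> \<Gamma>"
  and \<Gamma>_mult: "A \<in> \<Gamma> \<Longrightarrow> B \<in> \<Gamma> \<Longrightarrow> A ** B \<in> \<Gamma>" and \<Gamma>_inv: "A \<in> \<Gamma> \<Longrightarrow> matrix_inv A \<in> \<Gamma>"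
  and cov: "covering_space hyp \<pi> M"
  and fibres: "x \<in> hyp \<Longrightarrow> y \<in> hyp \<Longrightarrow> \<pi> x = \<pi> y \<longleftrightarrow> (\<exists>A\<in>\<Gamma>. y = A *v x)"
  using surface unfolding closed_hyperbolic_surface_def by blast+

lemma \<Gamma>_hyp: "A \<in> \<Gamma> \<Longrightarrow> x \<in> hyp \<Longrightarrow> A *v x \<in> hyp"
  using \<Gamma>_SO SO_plus_hyp by blast

lemma \<pi>_act: "A \<in> \<Gamma> \<Longrightarrow> x \<in> hyp \<Longrightarrow> \<pi> (A *v x) = \<pi> x"
  using fibres[of x "A *v x"] \<Gamma>_hyp by metis

lemma continuous_\<pi>: "continuous_on hyp \<pi>" and \<pi>_image: "\<pi> ` hyp = M"
  using cov by (auto simp: covering_space_def)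

lemma \<Gamma>_inv_mult: "A \<in> \<Gamma> \<Longrightarrow> A *v (matrix_inv A *v x) = x" "A \<in> \<Gamma> \<Longrightarrow> matrix_inv A *v (A *v x) = x"
  using \<Gamma>_SO SO_plus_inverse_mult by blast+

lemma hyp_spans:
  fixes A B :: "real^3^3"
  assumes "\<And>x. x \<in> hyp \<Longrightarrow> A *v x = B *v x"
  shows "A = B"
proof -
  let ?x = "chart (vector [1, 0])" and ?y = "chart (vector [0, 1])" and ?e = "chart 0"
  have "norm (vector [1, 0] :: real^2) = 1" "norm (vector [0, 1] :: real^2) = 1"
    by (simp_all add: norm_vec_def L2_set_def sum_2)
  then have c: "?x = vector [1, 0, sqrt 2]" "?y = vector [0, 1, sqrt 2]" "?e = vector [0, 0, 1]"
    by (simp_all add: vec_eq_iff forall_3)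
  have v: "v = v$1 *\<^sub>R ?x + v$2 *\<^sub>R ?y + (v$3 - sqrt 2 * (v$1 + v$2)) *\<^sub>R ?e" for v :: "real^3"
    unfolding c by (simp add: vec_eq_iff forall_3 algebra_simps)
  show ?thesis
  proof (rule matrix_eq[THEN iffD2], rule allI)
    fix v :: "real^3"
    have "A *v ?x = B *v ?x" "A *v ?y = B *v ?y" "A *v ?e = B *v ?e" by (simp_all add: assms chart_hyp)
    then have "A *v (v$1 *\<^sub>R ?x + v$2 *\<^sub>R ?y + (v$3 - sqrt 2 * (v$1 + v$2)) *\<^sub>R ?e)
      = B *v (v$1 *\<^sub>R ?x + v$2 *\<^sub>R ?y + (v$3 - sqrt 2 * (v$1 + v$2)) *\<^sub>R ?e)"
      by (simp only: matrix_vector_right_distrib matrix_vector_mult_scaleR)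
    then show "A *v v = B *v v" using v[of v] by simp
  qed
qed

text \<open>\<open>A\<close> and the identity both lift \<pi> and agree at \<open>x\<close>.
  Uniqueness of lifts makes them agree on \<open>hyp\<close>, which spans the whole space.\<close>

lemma free:
  assumes "A \<in> \<Gamma>" "x \<in> hyp" "A *v x = x"
  shows "A = mat 1"
proof (rule hyp_spans)
  fix y assume y: "y \<in> hyp"
  have "A *v y = y"
  proof (rule covering_space_lift_unique[OF cov, where T = hyp and f = \<pi> and a = x and ?g1.0 = "\<lambda>y. A *v y" and ?g2.0 = "\<lambda>y. y"])
    show "continuous_on hyp (\<lambda>y. A *v y)"
      by (intro linear_continuous_on matrix_vector_mul_bounded_linear)
    show "(\<lambda>y. A *v y) \<in> hyp \<rightarrow> hyp" using \<Gamma>_hyp assms by auto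
    show "\<pi> \<in> hyp \<rightarrow> M" using \<pi>_image by auto
  qed (use assms y continuous_\<pi> connected_hyp \<pi>_act in auto)
  then show "A *v y = mat 1 *v y" by simp
qed

lemma \<pi>_locally_injective:
  assumes "x \<in> hyp"
  obtains e where "e > 0" "\<And>y z. y \<in> hyp \<Longrightarrow> z \<in> hyp \<Longrightarrow> dist y x < e \<Longrightarrow> dist z x < e \<Longrightarrow> \<pi> y = \<pi> z \<Longrightarrow> y = z"
proof -
  obtain T U q where T: "x \<in> T" "openin (top_of_set hyp) T" "homeomorphism T U \<pi> q"
    using covering_space_local_homeomorphism[OF cov assms] by metis
  obtain e where e: "e > 0" "ball x e \<inter> hyp \<subseteq> T"
    using T(1,2) by (auto simp: openin_contains_ball)
  show thesis
  proof (rule that[OF e(1)])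
    fix y z assume "y \<in> hyp" "z \<in> hyp" "dist y x < e" "dist z x < e" "\<pi> y = \<pi> z"
    then have "y \<in> T" "z \<in> T" using e(2) by (auto simp: dist_commute)
    then show "y = z" using T(3) \<open>\<pi> y = \<pi> z\<close> unfolding homeomorphism_def by metis
  qed
qed

lemma \<pi>_open_map:
  assumes T: "openin (top_of_set hyp) T"
  shows "openin (top_of_set M) (\<pi> ` T)"
proof (subst openin_subopen, intro ballI)
  fix y assume "y \<in> \<pi> ` T"
  then obtain x where x: "x \<in> T" "y = \<pi> x" by blast
  then have "x \<in> hyp" using T openin_imp_subset by blast
  then obtain T0 U q where T0: "x \<in> T0" "openin (top_of_set hyp) T0" "openin (top_of_set M) U" "homeomorphism T0 U \<pi> q"
    using covering_space_local_homeomorphism[OF cov] by metis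
  have "openin (top_of_set T0) (T \<inter> T0)"
  proof -
    obtain S where S: "open S" "T = hyp \<inter> S" using T by (auto simp: openin_open)
    have "T \<inter> T0 = T0 \<inter> S" using S openin_imp_subset[OF T0(2)] by blast
    then show ?thesis using S(1) by (simp add: openin_open_Int)
  qed
  then have "openin (top_of_set U) (\<pi> ` (T \<inter> T0))"
    by (rule homeomorphism_imp_open_map[OF T0(4)])
  then have "openin (top_of_set M) (\<pi> ` (T \<inter> T0))" using T0(3) openin_trans by blast
  then show "\<exists>V. openin (top_of_set M) V \<and> y \<in> V \<and> V \<subseteq> \<pi> ` T"
    using x T0(1) by (intro exI[of _ "\<pi> ` (T \<inter> T0)"]) auto
qed

lemma some_preimage:
  assumes "x \<in> hyp" obtains A where "A \<in> \<Gamma>" "(SOME z. z \<in> hyp \<and> \<pi> z = \<pi> x) = A *v x"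
proof -
  have "(SOME z. z \<in> hyp \<and> \<pi> z = \<pi> x) \<in> hyp \<and> \<pi> (SOME z. z \<in> hyp \<and> \<pi> z = \<pi> x) = \<pi> x"
    by (rule someI[of _ x]) (use assms in simp)
  then show thesis using that fibres[of x "SOME z. z \<in> hyp \<and> \<pi> z = \<pi> x"] assms by metis
qed

text \<open>Orbit points of bounded height lie in a compact set. Infinitely many of them would
  accumulate at a point near which \<pi> is injective, although they all have the same image;
  freeness makes distinct group elements give distinct points.\<close>

lemma finite_orbit:
  assumes x: "x \<in> hyp"
  shows "finite {A \<in> \<Gamma>. (A *v x)$3 \<le> R}"
proof (rule ccontr)
  let ?S = "{A \<in> \<Gamma>. (A *v x)$3 \<le> R}"
  assume inf: "infinite ?S"
  have inj: "inj_on (\<lambda>A. A *v x) ?S"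
  proof (rule inj_onI)
    fix A B assume AB: "A \<in> ?S" "B \<in> ?S" "A *v x = B *v x"
    have "(matrix_inv B ** A) *v x = x"
      using AB \<Gamma>_inv_mult(2)[of B x] by (simp add: matrix_vector_mul_assoc[symmetric])
    then have "matrix_inv B ** A = mat 1"
      using AB \<Gamma>_mult \<Gamma>_inv free[of "matrix_inv B ** A" x] x by blast
    then have "B ** (matrix_inv B ** A) = B" by simp
    then show "A = B"
      using AB \<Gamma>_SO SO_plus_inverse(1)[of B] by (simp add: matrix_mul_assoc subset_iff)
  qed
  have "infinite ((\<lambda>A. A *v x) ` ?S)" using inf inj finite_imageD by blast
  moreover have "(\<lambda>A. A *v x) ` ?S \<subseteq> chart ` cball 0 R"
  proof
    fix z assume "z \<in> (\<lambda>A. A *v x) ` ?S"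
    then have z: "z \<in> hyp" "z$3 \<le> R" using \<Gamma>_hyp x by auto
    have "(norm (proj z))\<^sup>2 \<le> (z$3)\<^sup>2" using hyp_norm[OF z(1)] by (simp add: norm_2)
    then have "norm (proj z) \<le> z$3" using z(1) by (rule_tac power2_le_imp_le) (auto simp: hyp_def)
    then show "z \<in> chart ` cball 0 R" using z chart_proj[OF z(1)] by (intro image_eqI[of _ _ "proj z"]) auto
  qed
  moreover have "compact (chart ` cball 0 R)" by (intro compact_continuous_image continuous_chart compact_cball)
  ultimately obtain l where l: "l \<in> chart ` cball 0 R" "l islimpt ((\<lambda>A. A *v x) ` ?S)"
    unfolding compact_eq_Bolzano_Weierstrass by blast
  then have "l \<in> hyp" using chart_hyp by auto
  then obtain e where e: "e > 0" "\<And>y z. y \<in> hyp \<Longrightarrow> z \<in> hyp \<Longrightarrow> dist y l < e \<Longrightarrow> dist z l < e \<Longrightarrow> \<pi> y = \<pi> z \<Longrightarrow> y = z"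
    using \<pi>_locally_injective[of l] by metis
  have inf_near: "infinite ((\<lambda>A. A *v x) ` ?S \<inter> ball l e)"
    using l(2) e(1) by (simp add: islimpt_eq_infinite_ball)
  have eq: "y = z" if "y \<in> (\<lambda>A. A *v x) ` ?S \<inter> ball l e" "z \<in> (\<lambda>A. A *v x) ` ?S \<inter> ball l e" for y z
    using that \<Gamma>_hyp x \<pi>_act by (intro e(2)) (auto simp: dist_commute)
  obtain y where "y \<in> (\<lambda>A. A *v x) ` ?S \<inter> ball l e" using infinite_imp_nonempty[OF inf_near] by blast
  then have "(\<lambda>A. A *v x) ` ?S \<inter> ball l e \<subseteq> {y}" using eq by blast
  then show False using inf_near finite_subset by blast
qed

lemma countable_\<Gamma>: "countable \<Gamma>"
proof -
  have "\<Gamma> = (\<Union>n::nat. {A \<in> \<Gamma>. (A *v chart 0)$3 \<le> n})"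
  proof (intro subset_antisym subsetI)
    fix A assume "A \<in> \<Gamma>"
    then show "A \<in> (\<Union>n::nat. {A \<in> \<Gamma>. (A *v chart 0)$3 \<le> n})"
      using real_arch_simple[of "(A *v chart 0)$3"] by blast
  qed auto
  moreover have "countable (\<Union>n::nat. {A \<in> \<Gamma>. (A *v chart 0)$3 \<le> n})"
    by (rule countable_UN[OF countableI_type]) (rule countable_finite[OF finite_orbit[OF chart_hyp]])
  ultimately show ?thesis by simp
qed

text \<open>By \<open>finite_orbit\<close> the height attains its minimum on every orbit, and a
  lowest point of the orbit lies in the domain.\<close>

lemma dirichlet_covers:
  assumes x: "x \<in> hyp"
  shows "\<exists>A\<in>\<Gamma>. A *v x \<in> dirichlet \<Gamma>"
proof -
  let ?S = "{A \<in> \<Gamma>. (A *v x)$3 \<le> x$3}"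
  have "mat 1 \<in> ?S" using \<Gamma>_one by simp
  then have ne: "(\<lambda>A. (A *v x)$3) ` ?S \<noteq> {}" by blast
  have fin: "finite ?S" by (rule finite_orbit[OF x])
  have "Min ((\<lambda>A. (A *v x)$3) ` ?S) \<in> (\<lambda>A. (A *v x)$3) ` ?S"
    using fin ne by (intro Min_in) auto
  then obtain A where A: "A \<in> ?S" "(A *v x)$3 = Min ((\<lambda>A. (A *v x)$3) ` ?S)" by auto
  have "(A *v x)$3 \<le> (B *v (A *v x))$3" if B: "B \<in> \<Gamma>" for B
  proof (cases "B ** A \<in> ?S")
    case True
    then have "Min ((\<lambda>A. (A *v x)$3) ` ?S) \<le> ((B ** A) *v x)$3" using fin by (intro Min_le) auto
    then show ?thesis using A by (simp add: matrix_vector_mul_assoc)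
  next
    case False
    then show ?thesis using A B \<Gamma>_mult by (auto simp: matrix_vector_mul_assoc)
  qed
  then show ?thesis using A \<Gamma>_hyp x by (intro bexI[of _ A]) (auto simp: dirichlet_def)
qed

text \<open>The covering map is open, so compactness of \<open>M\<close> gives a height below which
  every orbit has a point. A point of the Dirichlet domain is lowest in its orbit.\<close>

lemma dirichlet_bounded: "\<exists>R. \<forall>x\<in>dirichlet \<Gamma>. x$3 \<le> R"
proof -
  define V where "V n = \<pi> ` {x \<in> hyp. x$3 < real n}" for n
  have op: "openin (top_of_set M) (V n)" for n
  proof -
    have "openin (top_of_set hyp) (hyp \<inter> {x. x$3 < real n})"
      by (intro openin_open_Int open_halfspace_component_lt_cart)
    then show ?thesis using \<pi>_open_map by (simp add: V_def Int_def)
  qed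
  have "M \<subseteq> (\<Union>n. V n)"
  proof
    fix m assume "m \<in> M"
    then obtain x where x: "x \<in> hyp" "m = \<pi> x" using \<pi>_image by blast
    obtain n :: nat where "x$3 < n" using reals_Archimedean2 by blast
    then show "m \<in> (\<Union>n. V n)" using x by (auto simp: V_def)
  qed
  moreover have "\<And>T. T \<in> range V \<Longrightarrow> openin (top_of_set M) T" using op by blast
  ultimately obtain F where F: "finite F" "F \<subseteq> range V" "M \<subseteq> \<Union>F"
    using compact_M unfolding compact_eq_openin_cover by meson
  then obtain I where I: "finite I" "F = V ` I" by (meson finite_subset_image)
  have "x$3 \<le> real (Max (insert 0 I))" if x: "x \<in> dirichlet \<Gamma>" for x
  proof -
    have xh: "x \<in> hyp" using x by (simp add: dirichlet_def)
    then have "\<pi> x \<in> M" using \<pi>_image by blast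
    then obtain n where n: "n \<in> I" "\<pi> x \<in> V n" using F I by blast
    then obtain z where z: "z \<in> hyp" "z$3 < real n" "\<pi> x = \<pi> z" by (auto simp: V_def)
    then obtain A where "A \<in> \<Gamma>" "z = A *v x" using fibres xh by blast
    then have "x$3 \<le> z$3" using x by (simp add: dirichlet_def)
    moreover have "n \<le> Max (insert 0 I)" using I n by (intro Max_ge) auto
    ultimately show ?thesis using z by linarith
  qed
  then show ?thesis by blast
qed

section \<open>The fundamental domain in the chart\<close>

definition D :: "(real^2) set" where "D = {y. chart y \<in> dirichlet \<Gamma>}"

lemma D_bounded: obtains R where "R > 0" "D \<subseteq> cball 0 R"
proof -
  obtain R where R: "\<forall>x\<in>dirichlet \<Gamma>. x$3 \<le> R" using dirichlet_bounded by blast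
  have "norm y \<le> max R 1" if "y \<in> D" for y
  proof -
    have "sqrt (1 + (norm y)\<^sup>2) \<le> R" using R that by (auto simp: D_def dest!: bspec)
    moreover have "norm y \<le> sqrt (1 + (norm y)\<^sup>2)" by (rule real_le_rsqrt) simp
    ultimately show ?thesis by simp
  qed
  then have "D \<subseteq> cball 0 (max R 1)" by auto
  then show thesis using that[of "max R 1"] by simp
qed

lemma D_covers: "\<exists>A\<in>\<Gamma>. act A y \<in> D"
proof -
  obtain A where A: "A \<in> \<Gamma>" "A *v chart y \<in> dirichlet \<Gamma>" using dirichlet_covers chart_hyp by blast
  moreover have "chart (act A y) = A *v chart y" using A \<Gamma>_SO chart_act by blast
  ultimately show ?thesis by (intro bexI[of _ A]) (auto simp: D_def)
qed

lemma D_borel [measurable]: "D \<in> sets borel"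
proof -
  have "D = (\<Inter>A\<in>\<Gamma>. {y. chart y $ 3 \<le> (A *v chart y)$3})"
    using chart_hyp \<Gamma>_one by (auto simp: D_def dirichlet_def)
  moreover have "closed (\<Inter>A\<in>\<Gamma>. {y. chart y $ 3 \<le> (A *v chart y)$3})"
    by (intro closed_INT ballI closed_Collect_le continuous_intros continuous_chart
        linear_continuous_on_compose[OF continuous_chart matrix_vector_mul_linear])
  ultimately show ?thesis by (metis borel_closed)
qed

lemma act_inverse: "A \<in> \<Gamma> \<Longrightarrow> act A (act (matrix_inv A) y) = y" "A \<in> \<Gamma> \<Longrightarrow> act (matrix_inv A) (act A y) = y"
  using \<Gamma>_SO chart_act[of A y] chart_act[of "matrix_inv A" y] \<Gamma>_inv[of A] \<Gamma>_inv_mult[of A "chart y"]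
  by (auto simp: act_def)

lemma diffeo_act: "A \<in> \<Gamma> \<Longrightarrow> diffeo (act A) (act (matrix_inv A))"
proof -
  assume A: "A \<in> \<Gamma>"
  have "det (jac (act A) y) > 0" for y
    using det_jac_act[of A y] \<Gamma>_SO A area_pos[of y] area_pos[of "act A y"]
    by (metis less_asym mult.commute subsetD zero_less_mult_pos)
  then show ?thesis using A act_inverse by (auto simp: diffeo_def smooth_act)
qed

text \<open>The set is the bisector of \<open>c\<close> and (0,0,1). On a ray from the origin of the
  chart its equation becomes quadratic and homogeneous up to a nonzero constant, so the ray meets it
  at most once and the set is negligible.\<close>

lemma orbit_equidistant_null:
  assumes "c \<in> hyp" "c \<noteq> chart 0"
  shows "{y. lor (c - chart 0) (chart y) = 0} \<in> null_sets lborel"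
proof -
  define v where "v = c - chart 0"
  have c3: "v$3 > 0"
  proof -
    have "c$3 \<noteq> 1"
    proof
      assume "c$3 = 1"
      then have "(c$1)\<^sup>2 + (c$2)\<^sup>2 = 0" using hyp_norm[OF assms(1)] by simp
      then have "c = chart 0" using \<open>c$3 = 1\<close> by (simp add: vec_eq_iff forall_3 sum_power2_eq_zero_iff)
      then show False using assms by simp
    qed
    then show ?thesis using assms(1) by (auto simp: v_def hyp_def)
  qed
  let ?S = "{y. lor v (chart y) = 0}"
  have cl: "closed ?S"
    unfolding lor_def by (intro closed_Collect_eq continuous_intros continuous_chart)
  have sq: "(c * (v$1 * y$1 + v$2 * y$2))\<^sup>2 = (v$3)\<^sup>2 * (1 + c\<^sup>2 * (norm y)\<^sup>2)" if "c *\<^sub>R y \<in> ?S" for c y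
  proof -
    have "c * (v$1 * y$1 + v$2 * y$2) = v$3 * sqrt (1 + (c * norm y)\<^sup>2)"
      using that by (simp add: lor_def algebra_simps power_mult_distrib)
    then have "(c * (v$1 * y$1 + v$2 * y$2))\<^sup>2 = (v$3)\<^sup>2 * (sqrt (1 + (c * norm y)\<^sup>2))\<^sup>2"
      by (simp add: power_mult_distrib)
    then show ?thesis by (simp add: power_mult_distrib add_nonneg_nonneg)
  qed
  have "negligible ?S"
  proof (rule starlike_negligible[OF cl, of 0])
    fix c :: real and x :: "real^2" assume cx: "0 + c *\<^sub>R x \<in> ?S" "0 \<le> c" "0 + x \<in> ?S"
    define p where "p = (v$1 * x$1 + v$2 * x$2)\<^sup>2 - (v$3)\<^sup>2 * (norm x)\<^sup>2"
    have "c\<^sup>2 * (v$1 * x$1 + v$2 * x$2)\<^sup>2 = (v$3)\<^sup>2 * (1 + c\<^sup>2 * (norm x)\<^sup>2)"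
      using sq[of c x] cx(1) by (simp only: power_mult_distrib add_0)
    then have "c\<^sup>2 * p = (v$3)\<^sup>2" unfolding p_def right_diff_distrib by (simp add: distrib_left)
    moreover have "p = (v$3)\<^sup>2" using sq[of 1 x] cx by (simp add: p_def distrib_left)
    ultimately have "c\<^sup>2 = 1" using c3 by simp
    then show "c = 1" using cx(2) by (simp add: power2_eq_1_iff)
  qed
  then have "?S \<in> null_sets lebesgue" by (simp add: negligible_iff_null_sets)
  then show ?thesis using cl by (simp add: v_def[symmetric] null_sets_completion_iff borel_closed)
qed

definition overlap :: "(real^2) set" where
  "overlap = (\<Union>A\<in>\<Gamma>. \<Union>B\<in>\<Gamma> - {A}. {y. act A y \<in> D \<and> act B y \<in> D})"

text \<open>If two translates A y and B y of a point lie in the Dirichlet domain, they have equal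
  height, so A y is equidistant from (0,0,1) and its image under A B^(-1). By freeness these are
  different points, and countably many bisectors are null.\<close>

lemma overlap_null: "AE y in lborel. y \<notin> overlap"
proof -
  have *: "AE y in lborel. \<not> (act A y \<in> D \<and> act B y \<in> D)" if AB: "A \<in> \<Gamma>" "B \<in> \<Gamma> - {A}" for A B
  proof -
    define c where "c = (A ** matrix_inv B) *v chart 0"
    have C: "A ** matrix_inv B \<in> \<Gamma>" using AB \<Gamma>_mult \<Gamma>_inv by blast
    have "c \<noteq> chart 0"
    proof
      assume "c = chart 0"
      then have "A ** matrix_inv B = mat 1" using free[OF C chart_hyp] by (simp add: c_def)
      then have "A ** (matrix_inv B ** B) = B" by (simp add: matrix_mul_assoc)
      then show False using AB \<Gamma>_SO SO_plus_inverse(2)[of B] by auto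
    qed
    moreover have "c \<in> hyp" using C \<Gamma>_hyp chart_hyp by (simp add: c_def)
    ultimately have N: "{y. lor (c - chart 0) (chart y) = 0} \<in> null_sets lborel"
      by (rule orbit_equidistant_null[rotated])
    have "act A -` {y. lor (c - chart 0) (chart y) = 0} \<in> null_sets lborel"
      by (rule diffeo_null_preimage[OF diffeo_act[OF AB(1)] N])
    then have "AE y in lborel. y \<notin> act A -` {y. lor (c - chart 0) (chart y) = 0}"
      by (rule AE_not_in)
    then show ?thesis
    proof (rule AE_mp, intro AE_I2 impI notI)
      fix y assume y: "y \<notin> act A -` {y. lor (c - chart 0) (chart y) = 0}" "act A y \<in> D \<and> act B y \<in> D"
      have ch: "chart (act A y) = A *v chart y" "chart (act B y) = B *v chart y"
        using AB \<Gamma>_SO chart_act by auto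
      have third: "lor (chart 0) v = - v$3" for v by (simp add: lor_def)
      have "B *v chart y = (B ** matrix_inv A) *v (A *v chart y)" "A *v chart y = (A ** matrix_inv B) *v (B *v chart y)"
        using AB \<Gamma>_inv_mult by (auto simp: matrix_vector_mul_assoc[symmetric])
      moreover have "B ** matrix_inv A \<in> \<Gamma>" using AB \<Gamma>_mult \<Gamma>_inv by blast
      ultimately have "(A *v chart y)$3 \<le> (B *v chart y)$3" "(B *v chart y)$3 \<le> (A *v chart y)$3"
        using y(2) C unfolding D_def dirichlet_def ch mem_Collect_eq by metis+
      then have "(A *v chart y)$3 = (B *v chart y)$3" by simp
      moreover have "lor c (A *v chart y) = lor (chart 0) (B *v chart y)"
      proof -
        have "lor c (A *v chart y) = lor (matrix_inv B *v chart 0) (chart y)"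
          using AB \<Gamma>_SO SO_plus_lor[of A] by (auto simp: c_def matrix_vector_mul_assoc[symmetric])
        also have "\<dots> = lor (B *v (matrix_inv B *v chart 0)) (B *v chart y)"
          using AB \<Gamma>_SO SO_plus_lor[of B] by auto
        finally show ?thesis using AB \<Gamma>_inv_mult(1)[of B] by auto
      qed
      ultimately have "lor (c - chart 0) (chart (act A y)) = 0"
        by (simp add: lor_simps third ch)
      then show False using y(1) by simp
    qed
  qed
  have "AE y in lborel. \<forall>B\<in>\<Gamma> - {A}. \<not> (act A y \<in> D \<and> act B y \<in> D)" if "A \<in> \<Gamma>" for A
    by (subst AE_ball_countable) (use *[OF that] countable_\<Gamma> in auto)
  then have "AE y in lborel. \<forall>A\<in>\<Gamma>. \<forall>B\<in>\<Gamma> - {A}. \<not> (act A y \<in> D \<and> act B y \<in> D)"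
    by (subst AE_ball_countable[OF countable_\<Gamma>]) blast
  then show ?thesis by (rule AE_mp) (auto intro!: AE_I2 simp: overlap_def)
qed

lemma act_measurable [measurable]: "act A \<in> borel_measurable borel"
  by (intro borel_measurable_continuous_onI smooth_continuous smooth_act)

text \<open>The integral of an invariant density over a measurable set whose translates overlap in null
  sets only is at most the integral over the fundamental domain: cut the set into the pieces which
  are moved into \<open>D\<close> by the elements of \<open>\<Gamma>\<close>.\<close>
lemma fold_into_D:
  fixes F :: "real^2 \<Rightarrow> ennreal"
  assumes [measurable]: "F \<in> borel_measurable borel" "E \<in> sets borel"
    and inv: "\<And>A. A \<in> \<Gamma> \<Longrightarrow> AE y in lborel. ennreal (det (jac (act A) y)) * F (act A y) = F y"
    and E: "AE y in lborel. \<forall>A\<in>\<Gamma>. \<forall>B\<in>\<Gamma>. act A y \<in> E \<longrightarrow> act B y \<in> E \<longrightarrow> A = B"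
  shows "(\<integral>\<^sup>+ y. F y * indicator E y \<partial>lborel) \<le> (\<integral>\<^sup>+ y. F y * indicator D y \<partial>lborel)"
proof -
  have "(\<integral>\<^sup>+ y. F y * indicator E y \<partial>lborel)
      \<le> (\<integral>\<^sup>+ y. (\<integral>\<^sup>+ A. F y * indicator E y * indicator D (act A y) \<partial>count_space \<Gamma>) \<partial>lborel)"
  proof (rule nn_integral_mono)
    fix y
    obtain A where A: "A \<in> \<Gamma>" "act A y \<in> D" using D_covers by blast
    then show "F y * indicator E y \<le> (\<integral>\<^sup>+ A. F y * indicator E y * indicator D (act A y) \<partial>count_space \<Gamma>)"
      using nn_integral_ge_point[OF A(1), of "\<lambda>A. F y * indicator E y * indicator D (act A y)"] by simp
  qed
  also have "\<dots> = (\<integral>\<^sup>+ A. (\<integral>\<^sup>+ y. F y * indicator E y * indicator D (act A y) \<partial>lborel) \<partial>count_space \<Gamma>)"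
    by (rule nn_integral_count_space_nn_integral[OF countable_\<Gamma>]) measurable
  also have "\<dots> = (\<integral>\<^sup>+ A. (\<integral>\<^sup>+ z. F z * indicator D z * indicator E (act (matrix_inv A) z) \<partial>lborel) \<partial>count_space \<Gamma>)"
  proof (rule nn_integral_cong)
    fix A assume "A \<in> space (count_space \<Gamma>)"
    then have A: "A \<in> \<Gamma>" by simp
    let ?B = "matrix_inv A"
    have B: "?B \<in> \<Gamma>" using A \<Gamma>_inv by blast
    have "(\<integral>\<^sup>+ y. F y * indicator E y * indicator D (act A y) \<partial>lborel)
        = (\<integral>\<^sup>+ z. ennreal (det (jac (act ?B) z)) * (F (act ?B z) * indicator E (act ?B z) * indicator D (act A (act ?B z))) \<partial>lborel)"
      by (rule nn_integral_diffeo[OF diffeo_act[OF B]]) measurable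
    also have "\<dots> = (\<integral>\<^sup>+ z. F z * indicator D z * indicator E (act ?B z) \<partial>lborel)"
    proof (rule nn_integral_cong_AE, rule AE_mp[OF inv[OF B]], intro AE_I2 impI)
      fix z assume "ennreal (det (jac (act ?B) z)) * F (act ?B z) = F z"
      moreover have "act A (act ?B z) = z" by (rule act_inverse(1)[OF A])
      ultimately show "ennreal (det (jac (act ?B) z)) * (F (act ?B z) * indicator E (act ?B z) * indicator D (act A (act ?B z)))
        = F z * indicator D z * indicator E (act ?B z)"
        by (simp add: mult.assoc[symmetric]) (simp only: mult_ac)
    qed
    finally show "(\<integral>\<^sup>+ y. F y * indicator E y * indicator D (act A y) \<partial>lborel)
      = (\<integral>\<^sup>+ z. F z * indicator D z * indicator E (act ?B z) \<partial>lborel)" .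
  qed
  also have "\<dots> = (\<integral>\<^sup>+ z. (\<integral>\<^sup>+ A. F z * indicator D z * indicator E (act (matrix_inv A) z) \<partial>count_space \<Gamma>) \<partial>lborel)"
    by (rule nn_integral_count_space_nn_integral[OF countable_\<Gamma>, symmetric]) measurable
  also have "\<dots> \<le> (\<integral>\<^sup>+ z. F z * indicator D z \<partial>lborel)"
  proof (rule nn_integral_mono_AE, use E in \<open>rule AE_mp\<close>, intro AE_I2 impI)
    fix z assume z: "\<forall>A\<in>\<Gamma>. \<forall>B\<in>\<Gamma>. act A z \<in> E \<longrightarrow> act B z \<in> E \<longrightarrow> A = B"
    let ?S = "{A \<in> \<Gamma>. act (matrix_inv A) z \<in> E}"
    have "A = B" if "A \<in> ?S" "B \<in> ?S" for A B
    proof -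
      have "matrix_inv A = matrix_inv B" using z that \<Gamma>_inv by blast
      then have "A ** matrix_inv A = A ** matrix_inv B" by simp
      then have "mat 1 ** B = A ** (matrix_inv B ** B)"
        using that \<Gamma>_SO SO_plus_inverse(1)[of A] by (auto simp: matrix_mul_assoc)
      then show "A = B" using that \<Gamma>_SO SO_plus_inverse(2)[of B] by auto
    qed
    then have "\<exists>A0. ?S \<subseteq> {A0}" by blast
    then obtain A0 where S: "?S \<subseteq> {A0}" by blast
    then have "emeasure (count_space \<Gamma>) ?S \<le> 1"
      using card_mono[OF _ S] finite_subset[OF S] by (subst emeasure_count_space) auto
    moreover have "(\<integral>\<^sup>+ A. F z * indicator D z * indicator E (act (matrix_inv A) z) \<partial>count_space \<Gamma>)
       = (\<integral>\<^sup>+ A. F z * indicator D z * indicator ?S A \<partial>count_space \<Gamma>)"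
      by (rule nn_integral_cong) (auto simp: indicator_def)
    moreover have "\<dots> = F z * indicator D z * emeasure (count_space \<Gamma>) ?S"
      by (rule nn_integral_cmult_indicator) auto
    ultimately show "(\<integral>\<^sup>+ A. F z * indicator D z * indicator E (act (matrix_inv A) z) \<partial>count_space \<Gamma>) \<le> F z * indicator D z"
      using mult_left_mono[of "emeasure (count_space \<Gamma>) ?S" 1 "F z * indicator D z"] by simp
  qed
  finally show ?thesis .
qed

end

section \<open>The energy density and the form W in adapted frames\<close>

definition gram :: "(2 \<Rightarrow> real^3) \<Rightarrow> real^2^2" where
  "gram P = (\<chi> i j. lor (P i) (P j))"

definition comb :: "real^2^2 \<Rightarrow> (2 \<Rightarrow> real^3) \<Rightarrow> 2 \<Rightarrow> real^3" where
  "comb C P k = (\<Sum>j\<in>UNIV. C$j$k *\<^sub>R P j)"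

lemma gram_comb: "gram (comb C P) = transpose C ** gram P ** C"
  by (simp add: gram_def comb_def vec_eq_iff forall_2 matrix_matrix_mult_def transpose_def sum_2 lor_simps algebra_simps)

lemma dens_comb:
  "det C \<noteq> 0 \<Longrightarrow> dens s (gram (comb C P)) (gram (comb C R)) = \<bar>det C\<bar> * dens s (gram P) (gram R)"
  by (simp add: gram_comb dens_congruence)

lemma gram_mat2: "gram P = mat2 (lor (P 1) (P 1)) (lor (P 1) (P 2)) (lor (P 1) (P 2)) (lor (P 2) (P 2))"
  by (rule mat2_eqI) (simp_all add: gram_def lor_sym)

text \<open>The rotation that diagonalizes a symmetric 2 by 2 matrix turns by half the polar angle
  of (\<alpha> - \<gamma>, 2 \<beta>). If this vector is 0, the matrix is a multiple of the identity
  and any rotation works.\<close>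

lemma rotation_diagonalizes:
  fixes \<alpha> \<beta> \<gamma> :: real
  obtains c s where "c\<^sup>2 + s\<^sup>2 = 1" "(\<gamma> - \<alpha>) * (c * s) + \<beta> * (c\<^sup>2 - s\<^sup>2) = 0"
proof (cases "(\<alpha> - \<gamma>)\<^sup>2 + (2 * \<beta>)\<^sup>2 = 0")
  case True
  then have "\<alpha> - \<gamma> = 0 \<and> 2 * \<beta> = 0" by (simp only: sum_power2_eq_zero_iff)
  then have "\<beta> = 0" "\<gamma> = \<alpha>" by simp_all
  then show thesis using that[of 1 0] by simp
next
  case False
  define r where "r = sqrt ((\<alpha> - \<gamma>)\<^sup>2 + (2 * \<beta>)\<^sup>2)"
  have r: "r\<^sup>2 = (\<alpha> - \<gamma>)\<^sup>2 + (2 * \<beta>)\<^sup>2"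
    unfolding r_def by (rule real_sqrt_pow2) (intro add_nonneg_nonneg zero_le_power2)
  then have r0: "r\<^sup>2 \<noteq> 0" using False by (simp only:) simp
  have "((\<alpha> - \<gamma>) / r)\<^sup>2 + (2 * \<beta> / r)\<^sup>2 = r\<^sup>2 / r\<^sup>2"
    unfolding power_divide add_divide_distrib[symmetric] r ..
  then have "((\<alpha> - \<gamma>) / r)\<^sup>2 + (2 * \<beta> / r)\<^sup>2 = 1" using divide_self[OF r0] by (simp only:)
  then obtain \<psi> where \<psi>: "(\<alpha> - \<gamma>) / r = cos \<psi>" "2 * \<beta> / r = sin \<psi>"
    using sincos_total_2pi by metis
  have "sin \<psi> = 2 * (cos (\<psi>/2) * sin (\<psi>/2))" "cos \<psi> = (cos (\<psi>/2))\<^sup>2 - (sin (\<psi>/2))\<^sup>2"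
    using sin_double[of "\<psi>/2"] cos_double[of "\<psi>/2"] by simp_all
  then have *: "cos (\<psi>/2) * sin (\<psi>/2) = \<beta> / r" "(cos (\<psi>/2))\<^sup>2 - (sin (\<psi>/2))\<^sup>2 = (\<alpha> - \<gamma>) / r"
    using \<psi> by simp_all
  have "(\<gamma> - \<alpha>) * (\<beta> / r) + \<beta> * ((\<alpha> - \<gamma>) / r) = 0"
    by (simp add: algebra_simps diff_divide_distrib)
  then show thesis by (intro that[of "cos (\<psi>/2)" "sin (\<psi>/2)"]) (simp_all only: * sin_cos_squared_add2)
qed

lemma tangent_partial_chart: "lor (chart y) (partial i chart y) = 0"
proof -
  have p: "0 < 1 + (norm y)\<^sup>2" by (simp add: add_pos_nonneg)
  have "sqrt (1 + (norm y)\<^sup>2) * (y $ i / sqrt (1 + (norm y)\<^sup>2)) = y $ i" using p by simp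
  moreover have "y$1 * axis i 1 $ 1 + y$2 * axis i 1 $ 2 = y $ i" using exhaust_2[of i] by (auto simp: axis_def)
  ultimately show ?thesis by (simp add: lor_def partial_chart_3 partial_chart_12)
qed

lemma tangent_chart_expand:
  assumes "lor (chart y) v = 0"
  shows "v = v$1 *\<^sub>R partial 1 chart y + v$2 *\<^sub>R partial 2 chart y"
proof -
  have p: "sqrt (1 + (norm y)\<^sup>2) > 0" by (simp add: add_pos_nonneg)
  have "v$3 = (y$1 * v$1 + y$2 * v$2) / sqrt (1 + (norm y)\<^sup>2)"
    using assms p by (simp add: lor_def field_simps)
  then show ?thesis
    by (simp add: vec_eq_iff forall_3 partial_chart_3 partial_chart_12 axis_def add_divide_distrib mult.commute)
qed

lemma tangent_norm_bound:
  assumes z: "z \<in> hyp" and v: "lor z v = 0"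
  shows "(v$1)\<^sup>2 + (v$2)\<^sup>2 \<le> (z$3)\<^sup>2 * lor v v"
proof -
  have e: "z$1 * v$1 + z$2 * v$2 = z$3 * v$3" using v by (simp add: lor_def)
  have n: "(z$3)\<^sup>2 = 1 + (z$1)\<^sup>2 + (z$2)\<^sup>2" using z hyp_norm by blast
  have "(z$3)\<^sup>2 * lor v v = (z$3)\<^sup>2 * ((v$1)\<^sup>2 + (v$2)\<^sup>2) - (z$3 * v$3)\<^sup>2"
    by (simp add: lor_def power2_eq_square algebra_simps)
  also have "\<dots> = (1 + (z$1)\<^sup>2 + (z$2)\<^sup>2) * ((v$1)\<^sup>2 + (v$2)\<^sup>2) - (z$1 * v$1 + z$2 * v$2)\<^sup>2"
    using n e by simp
  also have "\<dots> = (v$1)\<^sup>2 + (v$2)\<^sup>2 + (z$1 * v$2 - z$2 * v$1)\<^sup>2"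
    by (simp add: power2_eq_square algebra_simps)
  finally show ?thesis by simp
qed

lemma rot_frame:
  assumes "lor_frame x e1 e2" "x \<bullet> cross3 e1 e2 = 1"
  shows "rot x e1 = e2" "rot x e2 = - e1"
proof -
  have l: "lor x x = -1" "lor x e1 = 0" "lor x e2 = 0" "lor e1 e1 = 1" "lor e2 e2 = 1" "lor e1 e2 = 0" "lor e2 e1 = 0"
    using assms(1) lor_sym[of e2 e1] by (auto simp: lor_frame_def)
  have z: "lor x (rot x v) = 0" "lor v (rot x v) = 0" for v
    by (subst lor_sym, simp add: cross3_lor dot_cross_self)+
  have "lor e2 (rot x e1) = 1" using assms(2) by (subst lor_sym) (simp add: cross3_lor)
  then show "rot x e1 = e2" using lor_frame_expand[OF assms(1), of "rot x e1"] z by simp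
  have "cross3 e2 e1 = - cross3 e1 e2" by (simp add: cross3_def vec_eq_iff forall_3)
  then have "lor e1 (rot x e2) = -1" using assms(2) by (subst lor_sym) (simp add: cross3_lor)
  then show "rot x e2 = - e1" using lor_frame_expand[OF assms(1), of "rot x e2"] z by simp
qed

text \<open>An oriented orthonormal frame of the tangent plane in which the pull-back of the metric by
  \<open>L\<close> is diagonal, together with its matrix in the coordinate basis.\<close>
lemma adapted_frame:
  obtains e1 e2 C where "lor_frame (chart y) e1 e2" "lor (L *v e1) (L *v e2) = 0"
    "rot (chart y) e1 = e2" "rot (chart y) e2 = - e1"
    "C = mat2 (e1$1) (e2$1) (e1$2) (e2$2)" "det C * area y = 1"
    "e1 = e1$1 *\<^sub>R partial 1 chart y + e1$2 *\<^sub>R partial 2 chart y"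
    "e2 = e2$1 *\<^sub>R partial 1 chart y + e2$2 *\<^sub>R partial 2 chart y"
proof -
  let ?x = "chart y"
  obtain f1 f2 where F0: "lor_frame ?x f1 f2" using lor_frame_exists[OF chart_hyp] .
  define f2 where "f2 = rot ?x f1"
  have F: "lor_frame ?x f1 f2" unfolding f2_def
    by (rule lor_frame_extend[OF chart_hyp]) (use F0 in \<open>auto simp: lor_frame_def\<close>)
  have l: "lor ?x ?x = -1" "lor ?x f1 = 0" "lor ?x f2 = 0" "lor f1 f1 = 1" "lor f2 f2 = 1" "lor f1 f2 = 0" "lor f2 f1 = 0"
    using F lor_sym[of f2 f1] by (auto simp: lor_frame_def)
  have or: "?x \<bullet> cross3 f1 f2 = 1" using l(5) cross3_lor[of ?x f1 f2] by (simp add: f2_def)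
  obtain c s where cs: "c\<^sup>2 + s\<^sup>2 = 1"
    "(lor (L *v f2) (L *v f2) - lor (L *v f1) (L *v f1)) * (c * s) + lor (L *v f1) (L *v f2) * (c\<^sup>2 - s\<^sup>2) = 0"
    using rotation_diagonalizes .
  define e1 where "e1 = c *\<^sub>R f1 + s *\<^sub>R f2"
  define e2 where "e2 = - s *\<^sub>R f1 + c *\<^sub>R f2"
  have E: "lor_frame ?x e1 e2"
    using cs(1) by (auto simp: lor_frame_def e1_def e2_def lor_simps l power2_eq_square algebra_simps)
  have D: "lor (L *v e1) (L *v e2) = 0"
    using cs(2) lor_sym[of "L *v f2" "L *v f1"]
    by (simp add: e1_def e2_def lor_simps matrix_vector_right_distrib matrix_vector_mult_diff_distrib
        matrix_vector_mult_scaleR power2_eq_square algebra_simps)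
  have "cross3 e1 e2 = (c\<^sup>2 + s\<^sup>2) *\<^sub>R cross3 f1 f2"
    by (simp add: e1_def e2_def cross3_def vec_eq_iff forall_3 power2_eq_square algebra_simps)
  then have or': "?x \<bullet> cross3 e1 e2 = 1" using or cs by simp
  have ex: "e1 = e1$1 *\<^sub>R partial 1 chart y + e1$2 *\<^sub>R partial 2 chart y"
    "e2 = e2$1 *\<^sub>R partial 1 chart y + e2$2 *\<^sub>R partial 2 chart y"
    using E by (auto intro!: tangent_chart_expand simp: lor_frame_def)
  define C where "C = mat2 (e1$1) (e2$1) (e1$2) (e2$2)"
  have "?x \<bullet> cross3 (a1 *\<^sub>R v + a2 *\<^sub>R w) (b1 *\<^sub>R v + b2 *\<^sub>R w) = (a1 * b2 - a2 * b1) * (?x \<bullet> cross3 v w)" for a1 a2 b1 b2 v w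
    by (simp add: cross3_def inner_vec_def sum_3 algebra_simps)
  then have "1 = (e1$1 * e2$2 - e1$2 * e2$1) * area y"
    using or' ex by (metis det_chart area_def)
  then have "det C * area y = 1" by (simp add: C_def det_2 algebra_simps)
  then show thesis using that[OF E D rot_frame[OF E or'] C_def _ ex] by blast
qed

definition omega :: "(real^3 \<Rightarrow> real^3^3) \<Rightarrow> real^2 \<Rightarrow> 2 \<Rightarrow> real^3" where
  "omega du y i = du (chart y) *v partial i chart y"

definition tangent_map :: "real^3^3 \<Rightarrow> real^3 \<Rightarrow> real^3 \<Rightarrow> bool" where
  "tangent_map L x z \<longleftrightarrow> z \<in> hyp \<and> L *v x = 0 \<and> (\<forall>v. L *v v \<in> tangent z)"

text \<open>In the adapted frame both Gram matrices are diagonal; \<open>dens_comb\<close> brings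
  the result back to the coordinate basis. The two inequalities compare the energy with the Sobolev
  norm, and the last formula makes that norm a measurable expression in
  \<open>omega du\<close>.\<close>

lemma energy_density:
  assumes L: "tangent_map (du (chart y)) (chart y) z" and p: "p > 2"
  shows "trace (mat_powr (Q (du (chart y))) p) * area y
      = dens (p/2) (gram (\<lambda>i. partial i chart y)) (gram (omega du y))" (is ?t1)
    and "trace (du (chart y) ** adj (du (chart y))) powr (p/2) \<le> 2 powr (p/2) * trace (mat_powr (Q (du (chart y))) p)" (is ?t2)
    and "trace (mat_powr (Q (du (chart y))) p) \<le> 2 * trace (du (chart y) ** adj (du (chart y))) powr (p/2)" (is ?t3)
    and "trace (mat_powr (Q (du (chart y))) p) \<ge> 0" (is ?t4)
    and "trace (du (chart y) ** adj (du (chart y))) =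
      mdisc (gram (\<lambda>i. partial i chart y)) (gram (omega du y)) / det (gram (\<lambda>i. partial i chart y))" (is ?t5)
proof -
  let ?L = "du (chart y)"
  obtain e1 e2 C where E: "lor_frame (chart y) e1 e2" "lor (?L *v e1) (?L *v e2) = 0"
    and C: "C = mat2 (e1$1) (e2$1) (e1$2) (e2$2)" "det C * area y = 1"
    and ex: "e1 = e1$1 *\<^sub>R partial 1 chart y + e1$2 *\<^sub>R partial 2 chart y"
      "e2 = e2$1 *\<^sub>R partial 1 chart y + e2$2 *\<^sub>R partial 2 chart y"
    using adapted_frame[of y ?L] by metis
  define a where "a = lor (?L *v e1) (?L *v e1)"
  define b where "b = lor (?L *v e2) (?L *v e2)"
  have z: "z \<in> hyp" and Lx: "?L *v chart y = 0" and Lt: "\<And>v. ?L *v v \<in> tangent z" using L by (auto simp: tangent_map_def)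
  have ab: "a \<ge> 0" "b \<ge> 0" unfolding a_def b_def
    using Lt by (auto intro!: tangent_pos(1)[OF z] simp: tangent_def lor_sym[of z])
  note en = energy_terms[OF E(1) z Lx Lt a_def[symmetric] b_def[symmetric] E(2) p]
  have s: "p/2 > 0" using p by simp
  show ?t2 ?t3 ?t4 unfolding en(1,2) using powr_sum_le[OF ab s] by auto
  have cb: "comb C (\<lambda>i. partial i chart y) 1 = e1" "comb C (\<lambda>i. partial i chart y) 2 = e2"
    using ex by (simp_all add: comb_def C sum_2)
  have co: "comb C (omega du y) k = ?L *v comb C (\<lambda>i. partial i chart y) k" for k
    by (simp add: comb_def omega_def sum_2 matrix_vector_right_distrib matrix_vector_mult_scaleR)
  have G: "gram (comb C (\<lambda>i. partial i chart y)) = mat2 1 0 0 1"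
    unfolding gram_mat2 cb using E(1) by (simp add: lor_frame_def)
  have U: "gram (comb C (omega du y)) = mat2 a 0 0 b"
    unfolding gram_mat2 co cb a_def b_def E(2) ..
  have dC: "det C = 1 / area y" using C(2) area_pos[of y] by (simp add: field_simps)
  then have dC0: "det C > 0" using area_pos[of y] by simp
  have "a powr (p/2) + b powr (p/2) = \<bar>det C\<bar> * dens (p/2) (gram (\<lambda>i. partial i chart y)) (gram (omega du y))"
    using dens_comb[of C "p/2" "\<lambda>i. partial i chart y" "omega du y"] dC0 dens_one_diag[OF ab] unfolding G U by simp
  then show ?t1 unfolding en(1) using dC area_pos[of y] by (simp add: field_simps)
  have "mdisc (gram (comb C (\<lambda>i. partial i chart y))) (gram (comb C (omega du y)))
      = (det C)\<^sup>2 * mdisc (gram (\<lambda>i. partial i chart y)) (gram (omega du y))"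
    unfolding gram_comb by (rule mdisc_congruence)
  moreover have "det (gram (comb C (\<lambda>i. partial i chart y))) = (det C)\<^sup>2 * det (gram (\<lambda>i. partial i chart y))"
    unfolding gram_comb by (rule det_congruence)
  ultimately have "a + b = (det C)\<^sup>2 * mdisc (gram (\<lambda>i. partial i chart y)) (gram (omega du y))"
    "1 = (det C)\<^sup>2 * det (gram (\<lambda>i. partial i chart y))"
    unfolding G U by (simp_all add: mdisc_def det_2)
  then have ne: "det (gram (\<lambda>i. partial i chart y)) \<noteq> 0"
    and S: "(a + b) * det (gram (\<lambda>i. partial i chart y)) = mdisc (gram (\<lambda>i. partial i chart y)) (gram (omega du y))"
    by (auto simp: mult.commute mult.left_commute)
  show ?t5 unfolding en(2) S[symmetric] using ne by simp
qed

text \<open>\<open>so21\<close> is cut out by linear equations, which partial derivatives preserve.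
  It makes \<open>trace_lor_cross\<close> applicable to d\<phi>.\<close>

lemma so21_partial:
  assumes "\<And>y. f y \<in> so21" "f differentiable (at y)"
  shows "partial i f y \<in> so21"
proof -
  have bl: "bounded_linear (\<lambda>A::real^3^3. lor (A *v X) Y + lor X (A *v Y))" for X Y
  proof -
    have "bounded_linear (\<lambda>A::real^3^3. A *v X)" for X :: "real^3"
      unfolding linear_conv_bounded_linear[symmetric]
      by (rule linearI) (simp_all add: matrix_vector_mult_add_rdistrib scaleR_matrix_vector_assoc)
    then show ?thesis
      by (intro bounded_linear_add bounded_bilinear.bounded_linear_left[OF lor_bounded_bilinear, THEN bounded_linear_compose]
          bounded_bilinear.bounded_linear_right[OF lor_bounded_bilinear, THEN bounded_linear_compose])
  qed
  have "lor (partial i f y *v X) Y + lor X (partial i f y *v Y) = 0" for X Y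
  proof -
    have "partial i (\<lambda>y. lor (f y *v X) Y + lor X (f y *v Y)) y = lor (partial i f y *v X) Y + lor X (partial i f y *v Y)"
      by (rule partial_linear[OF bl assms(2)])
    moreover have "(\<lambda>y. lor (f y *v X) Y + lor X (f y *v Y)) = (\<lambda>y. 0)"
      using assms(1) by (auto simp: so21_def)
    moreover have "partial i (\<lambda>y. 0 :: real) y = 0" by (rule partial_eqI) (rule has_derivative_const)
    ultimately show ?thesis by simp
  qed
  then show ?thesis by (simp add: so21_def)
qed

text \<open>In an adapted frame \<open>*T\<close> is explicit, and pairing with \<open>d\<phi>\<close> only sees the diagonal of \<open>T\<close>.\<close>
lemma wedge_d_frame:
  assumes L: "tangent_map (du (chart y)) (chart y) z" and p: "p > 2"
    and E: "lor_frame (chart y) e1 e2" "lor (du (chart y) *v e1) (du (chart y) *v e2) = 0"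
      "rot (chart y) e1 = e2" "rot (chart y) e2 = - e1"
    and area: "(e1$1 * e2$2 - e2$1 * e1$2) * area y = 1"
    and ex: "e1 = e1$1 *\<^sub>R partial 1 chart y + e1$2 *\<^sub>R partial 2 chart y"
      "e2 = e2$1 *\<^sub>R partial 1 chart y + e2$2 *\<^sub>R partial 2 chart y"
    and \<phi>: "\<And>i. partial i (\<lambda>y. \<phi> (chart y)) y \<in> so21"
    and ab: "a = lor (du (chart y) *v e1) (du (chart y) *v e1)" "b = lor (du (chart y) *v e2) (du (chart y) *v e2)"
    and \<tau>: "\<tau>1 = a powr (p/2) - (a powr (p/2) + b powr (p/2)) / p" "\<tau>2 = b powr (p/2) - (a powr (p/2) + b powr (p/2)) / p"
  shows "wedge_d (W_form p du) \<phi> y = - 2 * area y *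
    (\<tau>1 * lor e1 ((e1$1 *\<^sub>R partial 1 (\<lambda>y. \<phi> (chart y)) y + e1$2 *\<^sub>R partial 2 (\<lambda>y. \<phi> (chart y)) y) *v chart y)
     + \<tau>2 * lor e2 ((e2$1 *\<^sub>R partial 1 (\<lambda>y. \<phi> (chart y)) y + e2$2 *\<^sub>R partial 2 (\<lambda>y. \<phi> (chart y)) y) *v chart y))"
proof -
  let ?x = "chart y" and ?L = "du (chart y)" and ?A = "area y"
  let ?\<phi> = "\<lambda>i. partial i (\<lambda>y. \<phi> (chart y)) y"
  have z: "z \<in> hyp" and Lx: "?L *v chart y = 0" and Lt: "\<And>v. ?L *v v \<in> tangent z" using L by (auto simp: tangent_map_def)
  note en = energy_terms[OF E(1) z Lx Lt ab[symmetric] E(2) p]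
  have S: "raise_index ?x (T_tensor p ?L) (v1 *\<^sub>R e1 + v2 *\<^sub>R e2) = (v1 * \<tau>1) *\<^sub>R e1 + (v2 * \<tau>2) *\<^sub>R e2" for v1 v2
    by (rule raise_index_eq[OF E(1) chart_hyp _ refl]) (simp add: en(3) \<tau> mult_ac)
  have rot: "rot ?x (v1 *\<^sub>R e1 + v2 *\<^sub>R e2) = (- v2) *\<^sub>R e1 + v1 *\<^sub>R e2" for v1 v2
  proof -
    have "rot ?x (v1 *\<^sub>R e1 + v2 *\<^sub>R e2) = v1 *\<^sub>R rot ?x e1 + v2 *\<^sub>R rot ?x e2"
      by (simp add: rot_def lor_diag_mult cross3_def vec_eq_iff forall_3 algebra_simps)
    then show ?thesis by (simp add: E(3,4))
  qed
  have W: "W_form p du ?x (v1 *\<^sub>R e1 + v2 *\<^sub>R e2) = lor_cross (- ((- v2 * \<tau>1) *\<^sub>R e1 + (v1 * \<tau>2) *\<^sub>R e2)) ?x" for v1 v2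
    unfolding W_form_def hodge_def rot S ..
  have P: "partial 1 chart y = (?A * e2$2) *\<^sub>R e1 + (- (?A * e1$2)) *\<^sub>R e2"
    "partial 2 chart y = (- (?A * e2$1)) *\<^sub>R e1 + (?A * e1$1) *\<^sub>R e2"
  proof -
    have "(?A * e2$2) *\<^sub>R (e1$1 *\<^sub>R v + e1$2 *\<^sub>R w) + (- (?A * e1$2)) *\<^sub>R (e2$1 *\<^sub>R v + e2$2 *\<^sub>R w) = ((e1$1 * e2$2 - e2$1 * e1$2) * ?A) *\<^sub>R v"
      "(- (?A * e2$1)) *\<^sub>R (e1$1 *\<^sub>R v + e1$2 *\<^sub>R w) + (?A * e1$1) *\<^sub>R (e2$1 *\<^sub>R v + e2$2 *\<^sub>R w) = ((e1$1 * e2$2 - e2$1 * e1$2) * ?A) *\<^sub>R w"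
      for v w :: "real^3"
      by (simp_all add: vec_eq_iff algebra_simps)
    then show "partial 1 chart y = (?A * e2$2) *\<^sub>R e1 + (- (?A * e1$2)) *\<^sub>R e2"
      "partial 2 chart y = (- (?A * e2$1)) *\<^sub>R e1 + (?A * e1$1) *\<^sub>R e2"
      unfolding area using ex by (metis scaleR_one)+
  qed
  have "wedge_d (W_form p du) \<phi> y =
     2 * lor (- ((- (- (?A * e1$2)) * \<tau>1) *\<^sub>R e1 + (?A * e2$2 * \<tau>2) *\<^sub>R e2)) (?\<phi> 2 *v ?x)
   - 2 * lor (- ((- (?A * e1$1) * \<tau>1) *\<^sub>R e1 + (- (?A * e2$1) * \<tau>2) *\<^sub>R e2)) (?\<phi> 1 *v ?x)"
    unfolding wedge_d_def by (simp only: P W trace_lor_cross[OF \<phi>])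
  then show ?thesis
    by (simp add: lor_simps matrix_vector_mult_add_rdistrib scaleR_matrix_vector_assoc[symmetric] algebra_simps)
qed

lemma norm_3: "(norm (v :: real^3))\<^sup>2 = (v$1)\<^sup>2 + (v$2)\<^sup>2 + (v$3)\<^sup>2"
  by (simp add: norm_vec_def L2_set_def sum_3)

lemma norm_proj: "norm (proj v) \<le> norm v"
  by (rule power2_le_imp_le) (simp_all add: norm_2 norm_3)

section \<open>Variations of the domain\<close>

locale variation = surface M \<pi> \<Gamma> for M :: "'m::t2_space set" and \<pi> and \<Gamma> +
  fixes \<phi> :: "real^3 \<Rightarrow> real^3^3"
  assumes sec: "smooth_section \<Gamma> \<phi>"
begin

definition X :: "real^3 \<Rightarrow> real^3" where "X x = \<phi> x *v x"

text \<open>The curves \<open>t \<mapsto> \<theta> t x\<close> stay on \<open>hyp\<close> and have velocity \<open>X x\<close> at \<open>t = 0\<close>.\<close>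
definition \<theta> :: "real \<Rightarrow> real^3 \<Rightarrow> real^3" where
  "\<theta> t x = sqrt (1 + t\<^sup>2 * lor (X x) (X x)) *\<^sub>R x + t *\<^sub>R X x"

definition \<Theta> :: "real \<Rightarrow> real^2 \<Rightarrow> real^2" where "\<Theta> t y = proj (\<theta> t (chart y))"

lemma section_so21: "x \<in> hyp \<Longrightarrow> \<phi> x \<in> so21"
  and section_equivariant: "A \<in> \<Gamma> \<Longrightarrow> x \<in> hyp \<Longrightarrow> \<phi> (A *v x) = A ** \<phi> x ** matrix_inv A"
  and smooth_\<phi>: "smooth (\<lambda>y. \<phi> (chart y))"
  using sec by (auto simp: smooth_section_def)

lemma so21_skew: "B \<in> so21 \<Longrightarrow> lor v (B *v v) = 0"
proof -
  assume "B \<in> so21"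
  then have "lor (B *v v) v + lor v (B *v v) = 0" by (simp add: so21_def)
  then show ?thesis using lor_sym[of "B *v v" v] by simp
qed

lemma X_tangent: "x \<in> hyp \<Longrightarrow> lor x (X x) = 0"
  using section_so21 so21_skew by (simp add: X_def)

lemma X_equivariant: "A \<in> \<Gamma> \<Longrightarrow> x \<in> hyp \<Longrightarrow> X (A *v x) = A *v X x"
  by (simp add: X_def section_equivariant matrix_vector_mul_assoc[symmetric] \<Gamma>_inv_mult)

lemma X_nonneg: "x \<in> hyp \<Longrightarrow> lor (X x) (X x) \<ge> 0"
  using tangent_pos(1)[OF _ X_tangent] by blast

lemma q_invariant: "A \<in> \<Gamma> \<Longrightarrow> x \<in> hyp \<Longrightarrow> lor (X (A *v x)) (X (A *v x)) = lor (X x) (X x)"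
  using \<Gamma>_SO SO_plus_lor by (auto simp: X_equivariant)

lemma lor_\<theta>: "x \<in> hyp \<Longrightarrow> lor x (\<theta> t x) = - sqrt (1 + t\<^sup>2 * lor (X x) (X x))"
  by (simp add: \<theta>_def lor_simps hyp_lor X_tangent)

lemma \<theta>_hyp:
  assumes x: "x \<in> hyp"
  shows "\<theta> t x \<in> hyp"
proof (rule hyp_if_lor_neg[OF x])
  have q: "1 + t\<^sup>2 * lor (X x) (X x) > 0" using X_nonneg[OF x] by (simp add: add_pos_nonneg)
  then show "lor x (\<theta> t x) < 0" by (simp add: lor_\<theta>[OF x])
  have "lor (X x) x = 0" using X_tangent[OF x] lor_sym[of x "X x"] by simp
  then have "lor (\<theta> t x) (\<theta> t x) = t\<^sup>2 * lor (X x) (X x) - (sqrt (1 + t\<^sup>2 * lor (X x) (X x)))\<^sup>2"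
    by (simp add: \<theta>_def lor_simps hyp_lor[OF x] X_tangent[OF x] power2_eq_square)
  then show "lor (\<theta> t x) (\<theta> t x) = -1" using q by simp
qed

lemma \<theta>_equivariant: "A \<in> \<Gamma> \<Longrightarrow> x \<in> hyp \<Longrightarrow> \<theta> t (A *v x) = A *v \<theta> t x"
  using q_invariant[of A x] X_equivariant[of A x]
  by (simp only: \<theta>_def matrix_vector_right_distrib matrix_vector_mult_scaleR)

lemma chart_\<Theta>: "chart (\<Theta> t y) = \<theta> t (chart y)"
  by (simp add: \<Theta>_def chart_proj \<theta>_hyp chart_hyp)

lemma \<Theta>_act: "A \<in> \<Gamma> \<Longrightarrow> \<Theta> t (act A y) = act A (\<Theta> t y)"
  using \<Gamma>_SO by (auto simp: \<Theta>_def chart_act \<theta>_equivariant chart_hyp act_def[of A "proj _"] chart_proj \<theta>_hyp)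

section \<open>The variation in the chart\<close>

definition Y :: "real^2 \<Rightarrow> real^3" where "Y y = X (chart y)"
definition q :: "real^2 \<Rightarrow> real" where "q y = lor (Y y) (Y y)"
definition \<sigma> :: "real \<Rightarrow> real^2 \<Rightarrow> real" where "\<sigma> t y = sqrt (1 + t\<^sup>2 * q y)"

lemma smooth_Y: "smooth Y"
  unfolding Y_def[abs_def] X_def by (rule smooth_bilinear[OF matrix_vector_bounded_bilinear smooth_\<phi> smooth_chart])

lemma smooth_q: "smooth q"
  unfolding q_def[abs_def] by (rule smooth_bilinear[OF lor_bounded_bilinear smooth_Y smooth_Y])

lemma q_nonneg: "q y \<ge> 0" by (simp add: q_def Y_def X_nonneg chart_hyp)

lemma \<sigma>_ge_1: "\<sigma> t y \<ge> 1" by (simp add: \<sigma>_def q_nonneg)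

lemma smooth_\<sigma>: "smooth (\<sigma> t)"
  unfolding \<sigma>_def[abs_def]
  by (intro smooth_sqrt smooth_add smooth_const smooth_mult smooth_q) (simp add: add_pos_nonneg q_nonneg)

lemma \<theta>_chart: "\<theta> t (chart y) = \<sigma> t y *\<^sub>R chart y + t *\<^sub>R Y y"
  by (simp add: \<theta>_def \<sigma>_def q_def Y_def)

lemma smooth_\<theta>_chart: "smooth (\<lambda>y. \<theta> t (chart y))"
  unfolding \<theta>_chart by (intro smooth_add smooth_scaleR smooth_\<sigma> smooth_chart smooth_const smooth_Y)

lemma smooth_\<Theta>: "smooth (\<Theta> t)"
  unfolding \<Theta>_def[abs_def] by (rule smooth_proj[OF smooth_\<theta>_chart])

lemma partial_\<sigma>: "partial i (\<sigma> t) y = t\<^sup>2 * partial i q y / (2 * \<sigma> t y)"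
proof -
  have p: "1 + t\<^sup>2 * q y > 0" using q_nonneg[of y] by (simp add: add_pos_nonneg)
  have "((\<lambda>x. sqrt (1 + t\<^sup>2 * x)) has_real_derivative t\<^sup>2 / (2 * sqrt (1 + t\<^sup>2 * q y))) (at (q y))"
    using p by (auto intro!: derivative_eq_intros simp: field_simps)
  from partial_compose_real(1)[OF this smooth_differentiable[OF smooth_q]]
  show ?thesis by (simp add: \<sigma>_def[abs_def] \<sigma>_def)
qed

text \<open>The difference quotient in \<open>t\<close> of the partial derivatives of \<theta>, see
  \<open>partial_\<theta>\<close>. At t = 0 the quotient \<open>(\<sigma> t y - 1) / t\<close> is 0
  by the convention on division, which is also its limit, so that \<open>V 0 i\<close> equals
  \<open>partial i Y\<close>.\<close>

definition V :: "real \<Rightarrow> 2 \<Rightarrow> real^2 \<Rightarrow> real^3" where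
  "V t i y = ((\<sigma> t y - 1) / t) *\<^sub>R partial i chart y + (t * partial i q y / (2 * \<sigma> t y)) *\<^sub>R chart y + partial i Y y"

lemma \<sigma>_bound: "\<bar>\<sigma> t y - 1\<bar> \<le> t\<^sup>2 * q y"
proof -
  have "sqrt (1 + a) \<le> 1 + a" if "a \<ge> 0" for a :: real
    using that by (intro real_le_lsqrt) (auto simp: power2_eq_square algebra_simps)
  then have "sqrt (1 + t\<^sup>2 * q y) \<le> 1 + t\<^sup>2 * q y" using q_nonneg[of y] by simp
  then show ?thesis using \<sigma>_ge_1[of t y] by (simp add: \<sigma>_def)
qed

lemma partial_\<theta>: "partial i (\<lambda>y. \<theta> t (chart y)) y = partial i chart y + t *\<^sub>R V t i y"
proof -
  have d: "\<sigma> t differentiable (at y)" "chart differentiable (at y)" "Y differentiable (at y)"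
    by (intro smooth_differentiable smooth_\<sigma> smooth_chart smooth_Y)+
  have d1: "(\<lambda>y. \<sigma> t y *\<^sub>R chart y) differentiable (at y)" "(\<lambda>y. t *\<^sub>R Y y) differentiable (at y)"
    by (intro smooth_differentiable smooth_scaleR smooth_\<sigma> smooth_chart smooth_const smooth_Y)+
  have "partial i (\<lambda>y. \<theta> t (chart y)) y
      = (\<sigma> t y *\<^sub>R partial i chart y + partial i (\<sigma> t) y *\<^sub>R chart y) + t *\<^sub>R partial i Y y"
    unfolding \<theta>_chart partial_add[OF d1] partial_bilinear[OF bounded_bilinear_scaleR d(1,2)]
      partial_linear[OF bounded_linear_scaleR_right d(3)] ..
  also have "\<dots> = partial i chart y + t *\<^sub>R V t i y"
  proof (cases "t = 0")
    case True
    then show ?thesis by (simp add: partial_\<sigma> V_def \<sigma>_def)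
  next
    case False
    then have *: "t * ((\<sigma> t y - 1) / t) = \<sigma> t y - 1" "t * (t * partial i q y / (2 * \<sigma> t y)) = t\<^sup>2 * partial i q y / (2 * \<sigma> t y)"
      by (simp_all add: power2_eq_square)
    show ?thesis
      unfolding V_def scaleR_add_right scaleR_scaleR partial_\<sigma> * by (simp add: scaleR_diff_left)
  qed
  finally show ?thesis .
qed

lemma V_bounded:
  obtains B where "B > 0" "\<And>t i y. \<bar>t\<bar> \<le> 1 \<Longrightarrow> norm y \<le> R \<Longrightarrow> norm (V t i y) \<le> B"
    "\<And>t i y. \<bar>t\<bar> \<le> 1 \<Longrightarrow> norm y \<le> R \<Longrightarrow> norm (V t i y - partial i Y y) \<le> B * \<bar>t\<bar>"
    "\<And>t y. \<bar>t\<bar> \<le> 1 \<Longrightarrow> norm y \<le> R \<Longrightarrow> norm (\<Theta> t y - y) \<le> B * \<bar>t\<bar>"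
proof -
  have bd: "\<exists>b>0. \<forall>y. norm y \<le> R \<longrightarrow> norm (f y) \<le> b" if "continuous_on UNIV f" for f :: "real^2 \<Rightarrow> 'b::real_normed_vector"
  proof -
    have "compact (f ` cball 0 R)"
      by (intro compact_continuous_image continuous_on_subset[OF that] compact_cball) simp
    then obtain b where "b > 0" "\<forall>z\<in>f ` cball 0 R. norm z \<le> b" using compact_imp_bounded bounded_pos by blast
    then show ?thesis by (intro exI[of _ b]) auto
  qed
  obtain c where c: "c > 0" "\<And>y. norm y \<le> R \<Longrightarrow> norm (chart y) \<le> c" using bd[OF continuous_chart] by blast
  obtain y0 where y0: "y0 > 0" "\<And>y. norm y \<le> R \<Longrightarrow> norm (Y y) \<le> y0" using bd[OF smooth_continuous[OF smooth_Y]] by blast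
  obtain k where k: "k > 0" "\<And>y. norm y \<le> R \<Longrightarrow> norm (q y) \<le> k" using bd[OF smooth_continuous[OF smooth_q]] by blast
  have ex: "\<exists>b>0. \<forall>i y. norm y \<le> R \<longrightarrow> norm (f i y) \<le> b" if cf: "\<And>i. continuous_on UNIV (f i)" for f :: "2 \<Rightarrow> real^2 \<Rightarrow> 'b::real_normed_vector"
  proof -
    obtain b1 b2 where "b1 > 0" "\<forall>y. norm y \<le> R \<longrightarrow> norm (f 1 y) \<le> b1" "b2 > 0" "\<forall>y. norm y \<le> R \<longrightarrow> norm (f 2 y) \<le> b2"
      using bd[OF cf] by metis
    then show ?thesis by (intro exI[of _ "b1 + b2"]) (auto simp: forall_2 add_increasing add_increasing2)
  qed
  obtain c' where c': "c' > 0" "\<And>i y. norm y \<le> R \<Longrightarrow> norm (partial i chart y) \<le> c'"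
    using ex[of "\<lambda>i. partial i chart"] smooth_partial_continuous[OF smooth_chart] by blast
  obtain y' where y': "y' > 0" "\<And>i y. norm y \<le> R \<Longrightarrow> norm (partial i Y y) \<le> y'"
    using ex[of "\<lambda>i. partial i Y"] smooth_partial_continuous[OF smooth_Y] by blast
  obtain k' where k': "k' > 0" "\<And>i y. norm y \<le> R \<Longrightarrow> norm (partial i q y) \<le> k'"
    using ex[of "\<lambda>i. partial i q"] smooth_partial_continuous[OF smooth_q] by blast
  define B where "B = k * c' + k' * c + y' + 2 * (k * c + y0)"
  have Bpos: "B > 0" using c y0 k c' y' k' by (simp add: B_def add_pos_pos)
  have diff: "norm (V t i y - partial i Y y) \<le> (k * c' + k' * c) * \<bar>t\<bar>" if t: "\<bar>t\<bar> \<le> 1" and y: "norm y \<le> R" for t i y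
  proof -
    have 1: "\<bar>(\<sigma> t y - 1) / t\<bar> \<le> \<bar>t\<bar> * k"
    proof (cases "t = 0")
      case False
      have "\<bar>\<sigma> t y - 1\<bar> \<le> t\<^sup>2 * k"
        using \<sigma>_bound[of t y] k(2)[OF y] mult_left_mono[of "q y" k "t\<^sup>2"] q_nonneg[of y] by simp
      then have "\<bar>\<sigma> t y - 1\<bar> / \<bar>t\<bar> \<le> (t\<^sup>2 * k) / \<bar>t\<bar>" by (rule divide_right_mono) simp
      also have "\<dots> = \<bar>t\<bar> * k"
      proof -
        have "t\<^sup>2 = \<bar>t\<bar> * \<bar>t\<bar>" by (simp add: power2_eq_square)
        then have "t\<^sup>2 * k = (\<bar>t\<bar> * k) * \<bar>t\<bar>" by (simp only: mult_ac)
        then show ?thesis using False by (simp only: nonzero_mult_div_cancel_right abs_eq_0 not_False_eq_True)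
      qed
      finally show ?thesis by (simp add: abs_divide)
    qed simp
    have 2: "\<bar>t * partial i q y / (2 * \<sigma> t y)\<bar> \<le> \<bar>t\<bar> * k'"
    proof -
      have "\<bar>t * partial i q y / (2 * \<sigma> t y)\<bar> = \<bar>t\<bar> * \<bar>partial i q y\<bar> / (2 * \<sigma> t y)"
        using \<sigma>_ge_1[of t y] by (simp add: abs_mult)
      also have "\<dots> \<le> (\<bar>t\<bar> * k') / 1"
        using \<sigma>_ge_1[of t y] k'(1) k'(2)[OF y, of i] by (intro frac_le mult_left_mono mult_nonneg_nonneg) auto
      finally show ?thesis by simp
    qed
    have "norm (V t i y - partial i Y y) \<le> norm (((\<sigma> t y - 1) / t) *\<^sub>R partial i chart y) + norm ((t * partial i q y / (2 * \<sigma> t y)) *\<^sub>R chart y)"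
      unfolding V_def by (simp add: norm_triangle_ineq del: norm_scaleR)
    also have "\<dots> = \<bar>(\<sigma> t y - 1) / t\<bar> * norm (partial i chart y) + \<bar>t * partial i q y / (2 * \<sigma> t y)\<bar> * norm (chart y)"
      by simp
    also have "\<dots> \<le> (\<bar>t\<bar> * k) * c' + (\<bar>t\<bar> * k') * c"
      using 1 2 c(2)[OF y] c'(2)[OF y] k(1) k'(1) by (intro add_mono mult_mono) auto
    finally show ?thesis by (simp add: algebra_simps)
  qed
  show thesis
  proof (rule that[OF Bpos])
    fix t :: real and i y assume t: "\<bar>t\<bar> \<le> 1" and y: "norm (y :: real^2) \<le> R"
    have nn: "0 \<le> k * c' + k' * c" "0 \<le> y'" "0 \<le> k * c + y0" using c y0 k c' y' k' by (auto simp: less_imp_le)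
    have "(k * c' + k' * c) * \<bar>t\<bar> \<le> B * \<bar>t\<bar>" using nn by (intro mult_right_mono) (auto simp: B_def)
    then show "norm (V t i y - partial i Y y) \<le> B * \<bar>t\<bar>" using diff[OF t y, of i] by linarith
    have "norm (V t i y) \<le> norm (V t i y - partial i Y y) + norm (partial i Y y)"
      using norm_triangle_ineq[of "V t i y - partial i Y y" "partial i Y y"] by simp
    also have "\<dots> \<le> (k * c' + k' * c) * 1 + y'"
      using diff[OF t y, of i] y'(2)[OF y, of i] mult_left_mono[OF t nn(1)] by linarith
    also have "\<dots> \<le> B" using nn by (simp add: B_def)
    finally show "norm (V t i y) \<le> B" .
  next
    fix t :: real and y assume t: "\<bar>t\<bar> \<le> 1" and y: "norm (y :: real^2) \<le> R"
    have "\<Theta> t y - y = proj ((\<sigma> t y - 1) *\<^sub>R chart y + t *\<^sub>R Y y)"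
      by (simp add: \<Theta>_def \<theta>_chart vec_eq_iff forall_2 algebra_simps)
    then have "norm (\<Theta> t y - y) \<le> norm ((\<sigma> t y - 1) *\<^sub>R chart y + t *\<^sub>R Y y)" using norm_proj by simp
    also have "\<dots> \<le> \<bar>\<sigma> t y - 1\<bar> * norm (chart y) + \<bar>t\<bar> * norm (Y y)"
      using norm_triangle_ineq[of "(\<sigma> t y - 1) *\<^sub>R chart y" "t *\<^sub>R Y y"] by simp
    also have "\<dots> \<le> (\<bar>t\<bar> * k) * c + \<bar>t\<bar> * y0"
    proof (intro add_mono mult_mono)
      have "t\<^sup>2 = \<bar>t\<bar> * \<bar>t\<bar>" by (simp add: power2_eq_square)
      also have "\<dots> \<le> \<bar>t\<bar> * 1" using t by (intro mult_left_mono) auto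
      finally have "t\<^sup>2 * q y \<le> \<bar>t\<bar> * k" using k(2)[OF y] q_nonneg[of y] by (intro mult_mono) auto
      then show "\<bar>\<sigma> t y - 1\<bar> \<le> \<bar>t\<bar> * k" using \<sigma>_bound[of t y] by linarith
    qed (use c y0 k y in auto)
    also have "\<dots> = (k * c + y0) * \<bar>t\<bar>" by (simp add: algebra_simps)
    also have "\<dots> \<le> B * \<bar>t\<bar>" using c y0 k c' y' k' by (intro mult_right_mono) (auto simp: B_def less_imp_le)
    finally show "norm (\<Theta> t y - y) \<le> B * \<bar>t\<bar>" .
  qed
qed

lemma bounded_linear_proj: "bounded_linear proj"
  unfolding linear_conv_bounded_linear[symmetric]
  by (rule linearI) (simp_all add: vec_eq_iff forall_2)

lemma partial_\<Theta>: "partial i (\<Theta> t) y = axis i 1 + t *\<^sub>R proj (V t i y)"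
proof -
  have "partial i (\<Theta> t) y = proj (partial i (\<lambda>y. \<theta> t (chart y)) y)"
    unfolding \<Theta>_def[abs_def]
    by (rule partial_linear[OF bounded_linear_proj smooth_differentiable[OF smooth_\<theta>_chart]])
  then show ?thesis
    by (simp add: partial_\<theta> vec_eq_iff forall_2 partial_chart_12)
qed


lemma \<Theta>_lipschitz:
  assumes B: "\<And>t i y. \<bar>t\<bar> \<le> 1 \<Longrightarrow> norm y \<le> R \<Longrightarrow> norm (V t i y) \<le> B" and "B > 0"
    and t: "\<bar>t\<bar> \<le> 1" and y: "norm y \<le> R" "norm y' \<le> R"
  shows "norm ((\<Theta> t y - y) - (\<Theta> t y' - y')) \<le> (2 * B * \<bar>t\<bar>) * norm (y - y')"
proof (rule differentiable_bound[of "cball 0 R" "\<lambda>y. \<Theta> t y - y" "\<lambda>y v. \<Sum>i\<in>UNIV. v$i *\<^sub>R (t *\<^sub>R proj (V t i y))"])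
  fix y :: "real^2" assume "y \<in> cball 0 R"
  then have y: "norm y \<le> R" by simp
  have "((\<lambda>y. \<Theta> t y - y) has_derivative (\<lambda>v. (\<Sum>i\<in>UNIV. v$i *\<^sub>R partial i (\<Theta> t) y) - v)) (at y)"
    by (intro has_derivative_diff smooth_has_derivative smooth_\<Theta> has_derivative_ident)
  moreover have "(\<Sum>i\<in>UNIV. v$i *\<^sub>R partial i (\<Theta> t) y) - v = (\<Sum>i\<in>UNIV. v$i *\<^sub>R (t *\<^sub>R proj (V t i y)))" for v
    using vec_expansion[of v] by (simp add: partial_\<Theta> scaleR_add_right sum.distrib)
  ultimately show "((\<lambda>y. \<Theta> t y - y) has_derivative (\<lambda>v. \<Sum>i\<in>UNIV. v$i *\<^sub>R (t *\<^sub>R proj (V t i y)))) (at y within cball 0 R)"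
    by (simp add: has_derivative_at_withinI)
  show "onorm (\<lambda>v. \<Sum>i\<in>UNIV. v$i *\<^sub>R (t *\<^sub>R proj (V t i y))) \<le> 2 * B * \<bar>t\<bar>"
  proof (rule onorm_le)
    fix v :: "real^2"
    have "norm (v$i *\<^sub>R (t *\<^sub>R proj (V t i y))) \<le> norm v * (\<bar>t\<bar> * B)" for i
    proof -
      have "norm (v$i *\<^sub>R (t *\<^sub>R proj (V t i y))) = \<bar>v$i\<bar> * (\<bar>t\<bar> * norm (proj (V t i y)))" by (simp add: abs_mult)
      also have "\<dots> \<le> norm v * (\<bar>t\<bar> * B)"
        using component_le_norm_cart[of v i] norm_proj[of "V t i y"] B[OF t y, of i]
        by (intro mult_mono mult_left_mono) auto
      finally show ?thesis .
    qed
    then have "norm (\<Sum>i\<in>UNIV. v$i *\<^sub>R (t *\<^sub>R proj (V t i y))) \<le> (\<Sum>i\<in>(UNIV::2 set). norm v * (\<bar>t\<bar> * B))"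
      by (rule sum_norm_le)
    then show "norm (\<Sum>i\<in>UNIV. v$i *\<^sub>R (t *\<^sub>R proj (V t i y))) \<le> 2 * B * \<bar>t\<bar> * norm v"
      by (simp add: mult_ac)
  qed
qed (use y in auto)

section \<open>Invertibility of the variation\<close>

lemma q_bounded: obtains k where "k \<ge> 0" "\<And>y. q y \<le> k"
proof -
  obtain R where R: "D \<subseteq> cball 0 R" using D_bounded by blast
  have "compact (q ` cball 0 R)"
    by (intro compact_continuous_image smooth_continuous[OF smooth_q] compact_cball)
  then obtain k where k: "\<And>y. y \<in> cball 0 R \<Longrightarrow> \<bar>q y\<bar> \<le> k" using compact_imp_bounded bounded_iff
    by (metis imageI real_norm_def)
  \<comment> \<open>\<open>q\<close> is invariant under \<Gamma>, so its bound on a ball containing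
    \<open>D\<close> is global.\<close>
  have qk: "q y \<le> k" for y
  proof -
    obtain A where A: "A \<in> \<Gamma>" "act A y \<in> D" using D_covers by blast
    have "chart (act A y) = A *v chart y" using A \<Gamma>_SO chart_act by blast
    then have "q (act A y) = q y" using q_invariant[OF A(1) chart_hyp[of y]] by (simp add: q_def Y_def)
    then show ?thesis using k[of "act A y"] A R by (auto simp: abs_le_iff)
  qed
  then have "k \<ge> 0" using q_nonneg[of 0] order_trans by blast
  then show thesis using that qk by blast
qed

lemma norm_le_chart_3: "norm y \<le> chart y $ 3"
  by (simp add: real_le_rsqrt)

lemma chart_3_le: "norm y \<le> R \<Longrightarrow> chart y $ 3 \<le> sqrt (1 + R\<^sup>2)"
  by (simp add: power_mono)

lemma jac_compose:
  assumes "smooth f" "smooth g"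
  shows "jac (\<lambda>y. f (g y)) y = jac f (g y) ** jac g y"
proof -
  have p: "partial i (\<lambda>y. f (g y)) y = (\<Sum>j\<in>UNIV. (partial i g y $ j) *\<^sub>R partial j f (g y))" for i
    by (rule partial_compose(1)[OF smooth_differentiable[OF assms(1)] smooth_differentiable[OF assms(2)]])
  show ?thesis
    by (simp add: jac_def p vec_eq_iff forall_2 matrix_matrix_mult_def sum_2 mult.commute)
qed

text \<open>\<open>\<Theta> t\<close> commutes with \<open>act A\<close>, whose Jacobian
  determinants are positive; the sign at \<open>y\<close> is therefore the sign at a translate in
  \<open>D\<close>.\<close>

lemma det_jac_\<Theta>_pos:
  assumes D: "\<And>y. y \<in> D \<Longrightarrow> det (jac (\<Theta> t) y) > 0"
  shows "det (jac (\<Theta> t) y) > 0"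
proof -
  obtain A where A: "A \<in> \<Gamma>" "act A y \<in> D" using D_covers by blast
  have pos: "det (jac (act A) z) > 0" for z using diffeo_act[OF A(1)] by (simp add: diffeo_def)
  have "(\<lambda>y. \<Theta> t (act A y)) = (\<lambda>y. act A (\<Theta> t y))" using \<Theta>_act[OF A(1)] by blast
  then have "det (jac (\<Theta> t) (act A y)) * det (jac (act A) y) = det (jac (act A) (\<Theta> t y)) * det (jac (\<Theta> t) y)"
    using jac_compose[OF smooth_\<Theta> smooth_act, of t A y] jac_compose[OF smooth_act smooth_\<Theta>, of A t y]
    by (metis det_mul)
  moreover have "det (jac (\<Theta> t) (act A y)) * det (jac (act A) y) > 0"
    using D[OF A(2)] pos by simp
  ultimately show ?thesis using pos zero_less_mult_pos by metis
qed

text \<open>In a large ball \<open>\<Theta> t\<close> is a small Lipschitz perturbation of the identity; by equivariance this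
  suffices because \<open>\<theta> t\<close> moves every point by a bounded hyperbolic distance.\<close>
lemma diffeo_\<Theta>: obtains t0 where "t0 > 0" "t0 \<le> 1" "\<And>t. \<bar>t\<bar> < t0 \<Longrightarrow> diffeo (\<Theta> t) (inv (\<Theta> t))"
proof -
  obtain R0 where R0: "R0 > 0" "D \<subseteq> cball 0 R0" using D_bounded by blast
  obtain k where k: "k \<ge> 0" "\<And>y. q y \<le> k" using q_bounded by blast
  define c where "c = sqrt (1 + k)"
  define S where "S = sqrt (1 + R0\<^sup>2)"
  have c0: "c \<ge> 1" "S \<ge> 0" using k by (auto simp: c_def S_def)
  have lor_c: "- lor (chart y) (chart (\<Theta> t y)) \<le> c" if "\<bar>t\<bar> \<le> 1" for t y
  proof -
    have "t\<^sup>2 \<le> 1" using that by (simp add: abs_square_le_1)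
    then have "t\<^sup>2 * q y \<le> 1 * k" using k q_nonneg by (intro mult_mono) auto
    then show ?thesis by (simp add: chart_\<Theta> lor_\<theta>[OF chart_hyp] c_def q_def[symmetric] Y_def[symmetric])
  qed
  \<comment> \<open>The summand 1 leaves room for the contraction below to map the ball into itself.
    The summand \<open>4 * S * c\<^sup>2\<close> bounds every point with the same image as a point
    of height at most \<open>S\<close>: passing to the image and back uses
    \<open>hyp_lor_bound\<close> twice, each time at the cost of a factor 2 c.\<close>
  define R where "R = R0 + 1 + 4 * S * c\<^sup>2"
  have R: "R0 + 1 \<le> R" "4 * S * c\<^sup>2 \<le> R" using c0 R0 by (auto simp: R_def)
  have far: "norm y' \<le> R" if t: "\<bar>t\<bar> \<le> 1" and e: "\<Theta> t y = \<Theta> t y'" and y: "norm y \<le> R0" for t y y'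
  proof -
    have l: "0 \<le> - lor (chart y) (chart (\<Theta> t y))" "0 \<le> - lor (chart y') (chart (\<Theta> t y'))"
      using hyp_lor_neg[OF chart_hyp chart_hyp] by (simp_all add: less_imp_le)
    have y3: "0 \<le> chart y $ 3" "chart y $ 3 \<le> S" using chart_3_pos[of y] chart_3_le[OF y] by (auto simp: S_def less_imp_le)
    have "chart (\<Theta> t y) $ 3 \<le> 2 * chart y $ 3 * (- lor (chart y) (chart (\<Theta> t y)))"
      by (rule hyp_lor_bound[OF chart_hyp chart_hyp])
    also have "\<dots> \<le> (2 * S) * c" using y3 lor_c[OF t, of y] l c0 by (intro mult_mono) auto
    finally have 1: "chart (\<Theta> t y) $ 3 \<le> 2 * S * c" .
    have "chart y' $ 3 \<le> 2 * chart (\<Theta> t y) $ 3 * (- lor (chart (\<Theta> t y)) (chart y'))"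
      by (rule hyp_lor_bound[OF chart_hyp chart_hyp])
    also have "- lor (chart (\<Theta> t y)) (chart y') = - lor (chart y') (chart (\<Theta> t y'))"
      using e lor_sym by metis
    also have "2 * chart (\<Theta> t y) $ 3 * (- lor (chart y') (chart (\<Theta> t y'))) \<le> (2 * (2 * S * c)) * c"
      using 1 lor_c[OF t, of y'] l c0 chart_3_pos[of "\<Theta> t y"] by (intro mult_mono) auto
    also have "\<dots> \<le> R" using R by (simp add: power2_eq_square mult_ac)
    finally show ?thesis using norm_le_chart_3[of y'] by linarith
  qed
  obtain B where B: "B > 0" "\<And>t i y. \<bar>t\<bar> \<le> 1 \<Longrightarrow> norm y \<le> R \<Longrightarrow> norm (V t i y) \<le> B"
    "\<And>t y. \<bar>t\<bar> \<le> 1 \<Longrightarrow> norm y \<le> R \<Longrightarrow> norm (\<Theta> t y - y) \<le> B * \<bar>t\<bar>"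
    using V_bounded[of R] by metis
  \<comment> \<open>It gives B |t| \<le> 1/8, hence Lipschitz constant 2 B |t| \<le> 1/4,
    displacement at most 1/8, and a Jacobian determinant of at least (7/8)^2 - (1/8)^2.\<close>
  define t0 where "t0 = min 1 (1 / (8 * B))"
  have t0: "t0 > 0" "t0 \<le> 1" using B by (auto simp: t0_def)
  have "diffeo (\<Theta> t) (inv (\<Theta> t))" if t: "\<bar>t\<bar> < t0" for t
  proof -
    have t1: "\<bar>t\<bar> \<le> 1" and tB: "B * \<bar>t\<bar> \<le> 1/8" using t B by (auto simp: t0_def field_simps)
    have lip: "norm ((\<Theta> t y - y) - (\<Theta> t y' - y')) \<le> (1/4) * norm (y - y')" if "norm y \<le> R" "norm y' \<le> R" for y y'
    proof -
      have "(2 * B * \<bar>t\<bar>) * norm (y - y') \<le> (1/4) * norm (y - y')" using tB by (intro mult_right_mono) auto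
      then show ?thesis using \<Theta>_lipschitz[OF B(2) B(1) t1 that] by linarith
    qed
    have inj: "inj (\<Theta> t)"
    proof (rule injI)
      fix y y' assume e: "\<Theta> t y = \<Theta> t y'"
      obtain A where A: "A \<in> \<Gamma>" "act A y \<in> D" using D_covers by blast
      have e': "\<Theta> t (act A y) = \<Theta> t (act A y')" using e \<Theta>_act[OF A(1)] by simp
      have n: "norm (act A y) \<le> R0" using A R0 by auto
      have "norm (act A y - act A y') \<le> (1/4) * norm (act A y - act A y')"
        using lip[of "act A y" "act A y'"] far[OF t1 e' n] n R(1) e' by (simp add: norm_minus_commute)
      then have "act A y = act A y'" by simp
      then show "y = y'" using act_inverse(2)[OF A(1)] by metis
    qed
    have surj: "surj (\<Theta> t)"
      unfolding surj_def
    proof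
      fix w0
      obtain A where A: "A \<in> \<Gamma>" "act A w0 \<in> D" using D_covers by blast
      let ?w = "act A w0"
      have w: "norm ?w \<le> R0" using A R0 by auto
      \<comment> \<open>Its fixed points are the solutions of
        \<open>\<Theta> t y = ?w\<close>.\<close>
      let ?f = "\<lambda>y. ?w - (\<Theta> t y - y)"
      have "\<exists>!y\<in>cball 0 R. ?f y = y"
      proof (rule Banach_fix[where c = "1/4"])
        show "?f ` cball 0 R \<subseteq> cball 0 R"
        proof
          fix z assume "z \<in> ?f ` cball 0 R"
          then obtain y where y: "norm y \<le> R" "z = ?f y" by auto
          have "norm z \<le> norm ?w + norm (\<Theta> t y - y)" unfolding y(2) by (rule norm_triangle_ineq4)
          then show "z \<in> cball 0 R" using w B(3)[OF t1 y(1)] tB R(1) by simp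
        qed
        fix x y :: "real^2" assume "x \<in> cball 0 R" "y \<in> cball 0 R"
        then show "dist (?f x) (?f y) \<le> (1/4) * dist x y"
          using lip[of y x] by (simp add: dist_norm norm_minus_commute algebra_simps)
      next
        show "cball (0::real^2) R \<noteq> {}" using R R0 by simp
      qed (auto intro: complete_eq_closed[THEN iffD2])
      then obtain y where "?f y = y" by blast
      then have "\<Theta> t y = ?w" by (simp add: algebra_simps)
      then have "\<Theta> t (act (matrix_inv A) y) = w0"
        using \<Theta>_act[OF \<Gamma>_inv[OF A(1)], of t y] act_inverse(2)[OF A(1)] by simp
      then show "\<exists>x. w0 = \<Theta> t x" by metis
    qed
    have "det (jac (\<Theta> t) y) > 0" if "y \<in> D" for y
    proof -
      have y: "norm y \<le> R" using that R0 R by force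
      have b: "\<bar>t * V t i y $ j\<bar> \<le> 1/8" for i j
      proof -
        have "\<bar>t * V t i y $ j\<bar> \<le> \<bar>t\<bar> * B"
          using component_le_norm_cart[of "V t i y" j] B(2)[OF t1 y, of i] by (simp add: abs_mult mult_left_mono)
        then show ?thesis using tB by (simp add: mult.commute)
      qed
      have d: "det (jac (\<Theta> t) y) = (1 + t * V t 1 y $ 1) * (1 + t * V t 2 y $ 2) - (t * V t 2 y $ 1) * (t * V t 1 y $ 2)"
        by (simp add: det_2 jac_def partial_\<Theta> axis_def)
      have "(7/8) * (7/8) \<le> (1 + t * V t 1 y $ 1) * (1 + t * V t 2 y $ 2)"
        using b[of 1 1] b[of 2 2] by (intro mult_mono) (auto simp: abs_le_iff)
      moreover have "\<bar>(t * V t 2 y $ 1) * (t * V t 1 y $ 2)\<bar> \<le> (1/8) * (1/8)"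
        unfolding abs_mult[of "t * V t 2 y $ 1"] using b by (intro mult_mono) auto
      ultimately show ?thesis unfolding d abs_le_iff by linarith
    qed
    then have "det (jac (\<Theta> t) y) > 0" for y by (rule det_jac_\<Theta>_pos)
    then show ?thesis using inj surj smooth_\<Theta> by (auto simp: diffeo_def surj_f_inv_f)
  qed
  then show thesis using that t0 by blast
qed

section \<open>The energy density along the variation\<close>

lemma lor_norm_bound: "\<bar>lor v w\<bar> \<le> norm v * norm w"
proof -
  have "norm (lor_diag *v v) = norm v"
    by (simp add: lor_diag_mult norm_eq_sqrt_inner inner_vec_def sum_3)
  then show ?thesis using Cauchy_Schwarz_ineq2[of "lor_diag *v v" w] by (simp add: lor_inner)
qed

definition edens :: "real \<Rightarrow> (real^3 \<Rightarrow> real^3^3) \<Rightarrow> real \<Rightarrow> real^2 \<Rightarrow> real" where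
  "edens s du t y = dens s (gram (\<lambda>i. partial i (\<lambda>y. \<theta> t (chart y)) y)) (gram (omega du y))"

lemma \<theta>_0: "\<theta> 0 x = x" by (simp add: \<theta>_def)

lemma frame_bounds:
  assumes "lor (chart y) e = 0" "lor e e = 1" "norm y \<le> R"
  shows "\<bar>e$1\<bar> \<le> sqrt (1 + R\<^sup>2)" "\<bar>e$2\<bar> \<le> sqrt (1 + R\<^sup>2)" "norm e \<le> 2 * sqrt (1 + R\<^sup>2)"
proof -
  let ?S = "sqrt (1 + R\<^sup>2)"
  have S2: "?S\<^sup>2 = 1 + R\<^sup>2" by (simp add: add_nonneg_nonneg)
  have R0: "0 \<le> R" using assms(3) norm_ge_zero[of y] by linarith
  have "(chart y $ 3)\<^sup>2 \<le> ?S\<^sup>2" using chart_3_le[OF assms(3)] chart_3_pos[of y] by (intro power_mono) auto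
  then have *: "(e$1)\<^sup>2 + (e$2)\<^sup>2 \<le> ?S\<^sup>2" using tangent_norm_bound[OF chart_hyp assms(1)] assms(2) by simp
  have e12: "(e$1)\<^sup>2 \<le> ?S\<^sup>2" "(e$2)\<^sup>2 \<le> ?S\<^sup>2"
    using * zero_le_power2[of "e$1"] zero_le_power2[of "e$2"] by linarith+
  show "\<bar>e$1\<bar> \<le> ?S" "\<bar>e$2\<bar> \<le> ?S"
    by (rule power2_le_imp_le, simp only: power2_abs e12, simp)+
  have "(norm e)\<^sup>2 = (e$1)\<^sup>2 + (e$2)\<^sup>2 + (e$3)\<^sup>2"
    by (rule norm_3)
  moreover have "(e$3)\<^sup>2 = (e$1)\<^sup>2 + (e$2)\<^sup>2 - 1" using assms(2) by (simp add: lor_def power2_eq_square)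
  ultimately have "(norm e)\<^sup>2 \<le> 4 * (1 + R\<^sup>2)" using * zero_le_power2[of R] unfolding S2 distrib_left by linarith
  then have "(norm e)\<^sup>2 \<le> (2 * ?S)\<^sup>2" unfolding power_mult_distrib S2 by simp
  then show "norm e \<le> 2 * ?S" by (rule power2_le_imp_le) simp
qed

text \<open>For \<open>e\<close> tangent at \<open>chart y\<close>, the numbers \<open>e$1\<close>,
  \<open>e$2\<close> are its coordinates in the basis given by the chart, and the differential of
  \<open>\<theta> t\<close> maps \<open>e\<close> to
  \<open>e + t *\<^sub>R displacement y e t\<close>.\<close>

definition displacement :: "real^2 \<Rightarrow> real^3 \<Rightarrow> real \<Rightarrow> real^3" where
  "displacement y e t = e$1 *\<^sub>R V t 1 y + e$2 *\<^sub>R V t 2 y"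

text \<open>The pull-back of \<open>lor\<close> by \<open>\<theta> t\<close>, on tangent vectors at \<open>chart y\<close>.\<close>
definition metric :: "real^2 \<Rightarrow> real^3 \<Rightarrow> real^3 \<Rightarrow> real \<Rightarrow> real" where
  "metric y e e' t = lor (e + t *\<^sub>R displacement y e t) (e' + t *\<^sub>R displacement y e' t)"

lemma gram_frame:
  assumes C: "C = mat2 (e1$1) (e2$1) (e1$2) (e2$2)"
    and ex: "e1 = e1$1 *\<^sub>R partial 1 chart y + e1$2 *\<^sub>R partial 2 chart y"
      "e2 = e2$1 *\<^sub>R partial 1 chart y + e2$2 *\<^sub>R partial 2 chart y"
  shows "gram (comb C (\<lambda>i. partial i (\<lambda>y. \<theta> t (chart y)) y)) = mat2 (metric y e1 e1 t) (metric y e1 e2 t) (metric y e1 e2 t) (metric y e2 e2 t)"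
proof -
  have cb: "comb C (\<lambda>i. partial i (\<lambda>y. \<theta> t (chart y)) y) 1 = e1 + t *\<^sub>R displacement y e1 t"
    "comb C (\<lambda>i. partial i (\<lambda>y. \<theta> t (chart y)) y) 2 = e2 + t *\<^sub>R displacement y e2 t"
    using ex by (simp_all add: comb_def C sum_2 partial_\<theta> displacement_def scaleR_add_right algebra_simps)
  show ?thesis unfolding gram_mat2 cb metric_def ..
qed

text \<open>After expanding, the difference quotient is an expression in \<open>V t\<close>, so
  convergence of \<open>V t\<close> to \<open>V 0\<close> is all that enters.\<close>

lemma metric_has_derivative:
  "((\<lambda>t. metric y e e' t) has_real_derivative lor e (displacement y e' 0) + lor (displacement y e 0) e') (at 0)"
proof -
  obtain B where B: "B > 0" "\<And>t i. \<bar>t\<bar> \<le> 1 \<Longrightarrow> norm (V t i y - partial i Y y) \<le> B * \<bar>t\<bar>"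
    using V_bounded[of "norm y"] by (metis order_refl)
  have V0: "V 0 i y = partial i Y y" for i using B(2)[of 0 i] by simp
  have Vlim: "((\<lambda>t. V t i y) \<longlongrightarrow> V 0 i y) (at 0)" for i
  proof (rule Lim_null[THEN iffD2], rule Lim_null_comparison)
    show "\<forall>\<^sub>F t in at 0. norm (V t i y - V 0 i y) \<le> B * \<bar>t\<bar>"
      using eventually_at_ball[of 1 0 UNIV] by (rule eventually_mono) (use B(2) V0 in \<open>auto simp: dist_real_def\<close>)
    show "((\<lambda>t. B * \<bar>t\<bar>) \<longlongrightarrow> 0) (at 0)" by (auto intro!: tendsto_eq_intros)
  qed
  have Wlim: "((\<lambda>t. displacement y e t) \<longlongrightarrow> displacement y e 0) (at 0)" for e
    unfolding displacement_def by (intro tendsto_intros Vlim)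
  have ge: "metric y e e' t = lor e e' + t * (lor e (displacement y e' t) + lor (displacement y e t) e' + t * lor (displacement y e t) (displacement y e' t))" for t
    by (simp add: metric_def lor_simps algebra_simps)
  have "((\<lambda>t. lor e (displacement y e' t) + lor (displacement y e t) e' + t * lor (displacement y e t) (displacement y e' t)) \<longlongrightarrow>
      lor e (displacement y e' 0) + lor (displacement y e 0) e' + 0 * lor (displacement y e 0) (displacement y e' 0)) (at 0)"
    by (intro tendsto_intros bounded_bilinear.tendsto[OF lor_bounded_bilinear] Wlim)
  then have "((\<lambda>h. (metric y e e' (0 + h) - metric y e e' 0) / h) \<longlongrightarrow> lor e (displacement y e' 0) + lor (displacement y e 0) e') (at 0)"
    by (rule Lim_transform_eventually[OF tendsto_eq_rhs]) (auto simp: eventually_at_filter ge)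
  then show "((\<lambda>t. metric y e e' t) has_real_derivative lor e (displacement y e' 0) + lor (displacement y e 0) e') (at 0)"
    unfolding DERIV_def .
qed

text \<open>Provides the normal form for \<open>dens_lipschitz\<close> and
  \<open>dens_has_derivative\<close>: in the adapted frame the pull-back by \<open>u\<close> is
  diagonal and fixed, and the moving metric starts at the identity matrix.\<close>

lemma edens_frame:
  assumes L: "tangent_map (du (chart y)) (chart y) z"
  obtains e1 e2 and C :: "real^2^2" and a b where "lor_frame (chart y) e1 e2" "lor (du (chart y) *v e1) (du (chart y) *v e2) = 0"
    "rot (chart y) e1 = e2" "rot (chart y) e2 = - e1"
    "det C = e1$1 * e2$2 - e2$1 * e1$2" "det C * area y = 1" "det C > 0"
    "e1 = e1$1 *\<^sub>R partial 1 chart y + e1$2 *\<^sub>R partial 2 chart y"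
    "e2 = e2$1 *\<^sub>R partial 1 chart y + e2$2 *\<^sub>R partial 2 chart y"
    "a = lor (du (chart y) *v e1) (du (chart y) *v e1)" "b = lor (du (chart y) *v e2) (du (chart y) *v e2)"
    "a \<ge> 0" "b \<ge> 0"
    "metric y e1 e1 0 = 1" "metric y e1 e2 0 = 0" "metric y e2 e2 0 = 1"
    "\<And>s t. det C * edens s du t y
      = dens s (mat2 (metric y e1 e1 t) (metric y e1 e2 t) (metric y e1 e2 t) (metric y e2 e2 t)) (mat2 a 0 0 b)"
proof -
  let ?L = "du (chart y)"
  obtain e1 e2 C where E: "lor_frame (chart y) e1 e2" "lor (?L *v e1) (?L *v e2) = 0"
    "rot (chart y) e1 = e2" "rot (chart y) e2 = - e1"
    and C: "C = mat2 (e1$1) (e2$1) (e1$2) (e2$2)" "det C * area y = 1"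
    and ex: "e1 = e1$1 *\<^sub>R partial 1 chart y + e1$2 *\<^sub>R partial 2 chart y"
      "e2 = e2$1 *\<^sub>R partial 1 chart y + e2$2 *\<^sub>R partial 2 chart y"
    using adapted_frame[of y ?L] by metis
  define a where "a = lor (?L *v e1) (?L *v e1)"
  define b where "b = lor (?L *v e2) (?L *v e2)"
  have ab: "a \<ge> 0" "b \<ge> 0" unfolding a_def b_def
    using L by (auto intro!: tangent_pos(1)[of z] simp: tangent_map_def tangent_def lor_sym[of z])
  have co: "comb C (omega du y) k = ?L *v comb C (\<lambda>i. partial i chart y) k" for k
    by (simp add: comb_def omega_def sum_2 matrix_vector_right_distrib matrix_vector_mult_scaleR)
  have cb: "comb C (\<lambda>i. partial i chart y) 1 = e1" "comb C (\<lambda>i. partial i chart y) 2 = e2"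
    using ex by (simp_all add: comb_def C sum_2)
  have U: "gram (comb C (omega du y)) = mat2 a 0 0 b"
    unfolding gram_mat2 co cb a_def b_def E(2) ..
  have dC: "det C > 0" using C(2) area_pos[of y] by (metis mult.commute zero_less_mult_pos zero_less_one)
  have ed: "det C * edens s du t y
      = dens s (mat2 (metric y e1 e1 t) (metric y e1 e2 t) (metric y e1 e2 t) (metric y e2 e2 t)) (mat2 a 0 0 b)" for s t
    unfolding edens_def gram_frame[OF C(1) ex, symmetric] U[symmetric] using dens_comb[of C] dC by simp
  have g0: "metric y e1 e1 0 = 1" "metric y e1 e2 0 = 0" "metric y e2 e2 0 = 1"
    using E(1) by (simp_all add: metric_def lor_frame_def)
  have "det C = e1$1 * e2$2 - e2$1 * e1$2" by (simp add: C(1) det_2)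
  from that[OF E this C(2) dC ex a_def b_def ab g0 ed] show thesis .
qed

text \<open>The constant depends on the ball but not on \<open>du\<close>, and the bound is relative
  to the density at time 0. Together with finite energy this controls the difference quotients even
  where \<open>du\<close> is unbounded.\<close>

lemma edens_lipschitz:
  assumes s: "s > 1"
  obtains K t1 where "K \<ge> 0" "t1 > 0" "\<And>t y du z. \<bar>t\<bar> \<le> t1 \<Longrightarrow> norm y \<le> R \<Longrightarrow> tangent_map (du (chart y)) (chart y) z \<Longrightarrow>
     \<bar>edens s du t y - edens s du 0 y\<bar> \<le> K * \<bar>t\<bar> * edens s du 0 y"
proof -
  obtain B where B: "B > 0" "\<And>t i y. \<bar>t\<bar> \<le> 1 \<Longrightarrow> norm y \<le> R \<Longrightarrow> norm (V t i y) \<le> B"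
    using V_bounded[of R] by metis
  define S where "S = sqrt (1 + R\<^sup>2)"
  have S: "S \<ge> 1" by (simp add: S_def)
  \<comment> \<open>With frame vectors of norm at most 2 S and displacements of norm at most 2 S B,
    the two mixed terms of \<open>metric\<close> contribute \<open>8 * S\<^sup>2 * B\<close> and the
    quadratic term \<open>4 * S\<^sup>2 * B\<^sup>2\<close>.\<close>
  define \<epsilon> where "\<epsilon> = 8 * S\<^sup>2 * B + 4 * S\<^sup>2 * B\<^sup>2"
  have \<epsilon>: "\<epsilon> > 0" using S B by (simp add: \<epsilon>_def add_pos_pos)
  define t1 where "t1 = min 1 (1 / (4 * \<epsilon>))"
  have t1: "t1 > 0" using \<epsilon> by (simp add: t1_def)
  have K: "dens_const s * \<epsilon> \<ge> 0" using s \<epsilon> by (simp add: dens_const_def)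
  have "\<bar>edens s du t y - edens s du 0 y\<bar> \<le> dens_const s * \<epsilon> * \<bar>t\<bar> * edens s du 0 y"
    if t: "\<bar>t\<bar> \<le> t1" and y: "norm y \<le> R" and L: "tangent_map (du (chart y)) (chart y) z" for t y du z
  proof -
    let ?L = "du (chart y)"
    have tt: "\<bar>t\<bar> \<le> 1" "\<epsilon> * \<bar>t\<bar> \<le> 1/4" using t \<epsilon> by (auto simp: t1_def field_simps)
    obtain e1 e2 and C :: "real^2^2" and a b where E: "lor_frame (chart y) e1 e2" and dC: "det C > 0" and ab: "a \<ge> 0" "b \<ge> 0"
      and g0: "metric y e1 e1 0 = 1" "metric y e1 e2 0 = 0" "metric y e2 e2 0 = 1"
      and ed: "\<And>t. det C * edens s du t y
        = dens s (mat2 (metric y e1 e1 t) (metric y e1 e2 t) (metric y e1 e2 t) (metric y e2 e2 t)) (mat2 a 0 0 b)"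
      using edens_frame[of du y z, OF L] by metis
    have le: "lor (chart y) e1 = 0" "lor (chart y) e2 = 0" "lor e1 e1 = 1" "lor e2 e2 = 1" "lor e1 e2 = 0"
      using E by (auto simp: lor_frame_def)
    have Wb: "norm (displacement y e t) \<le> 2 * S * B" if "\<bar>e$1\<bar> \<le> S" "\<bar>e$2\<bar> \<le> S" for e
    proof -
      have "norm (displacement y e t) \<le> \<bar>e$1\<bar> * norm (V t 1 y) + \<bar>e$2\<bar> * norm (V t 2 y)"
        unfolding displacement_def by (rule order_trans[OF norm_triangle_ineq]) simp
      also have "\<dots> \<le> S * B + S * B" using that B(2)[OF tt(1) y] S by (intro add_mono mult_mono) auto
      finally show ?thesis by (simp add: mult_ac)
    qed
    have gb: "\<bar>metric y e e' t - lor e e'\<bar> \<le> \<epsilon> * \<bar>t\<bar>"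
      if e: "\<bar>e$1\<bar> \<le> S" "\<bar>e$2\<bar> \<le> S" "norm e \<le> 2 * S" and e': "\<bar>e'$1\<bar> \<le> S" "\<bar>e'$2\<bar> \<le> S" "norm e' \<le> 2 * S" for e e'
    proof -
      have "\<bar>lor e (displacement y e' t)\<bar> \<le> (2 * S) * (2 * S * B)"
        using lor_norm_bound[of e "displacement y e' t"] mult_mono[OF e(3) Wb[OF e'(1,2)]] S by simp
      moreover have "\<bar>lor (displacement y e t) e'\<bar> \<le> (2 * S * B) * (2 * S)"
        using lor_norm_bound[of "displacement y e t" e'] mult_mono[OF Wb[OF e(1,2)] e'(3)] S B(1) by simp
      moreover have "\<bar>t * lor (displacement y e t) (displacement y e' t)\<bar> \<le> 1 * ((2 * S * B) * (2 * S * B))"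
      proof -
        have "\<bar>lor (displacement y e t) (displacement y e' t)\<bar> \<le> (2 * S * B) * (2 * S * B)"
          using lor_norm_bound[of "displacement y e t" "displacement y e' t"] mult_mono[OF Wb[OF e(1,2)] Wb[OF e'(1,2)]] S B(1) by simp
        then show ?thesis unfolding abs_mult using tt(1) by (intro mult_mono) auto
      qed
      ultimately have "\<bar>lor e (displacement y e' t) + lor (displacement y e t) e' + t * lor (displacement y e t) (displacement y e' t)\<bar>
          \<le> (2 * S) * (2 * S * B) + (2 * S * B) * (2 * S) + 1 * ((2 * S * B) * (2 * S * B))"
        by (intro order_trans[OF abs_triangle_ineq add_mono] order_trans[OF abs_triangle_ineq add_mono])
      also have "\<dots> = \<epsilon>" by (simp add: \<epsilon>_def power2_eq_square algebra_simps)
      finally have "\<bar>lor e (displacement y e' t) + lor (displacement y e t) e' + t * lor (displacement y e t) (displacement y e' t)\<bar> * \<bar>t\<bar> \<le> \<epsilon> * \<bar>t\<bar>"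
        by (rule mult_right_mono) simp
      moreover have "metric y e e' t - lor e e' = (lor e (displacement y e' t) + lor (displacement y e t) e' + t * lor (displacement y e t) (displacement y e' t)) * t"
        by (simp add: metric_def lor_simps algebra_simps)
      ultimately show ?thesis by (simp only: abs_mult)
    qed
    note f1 = frame_bounds[OF le(1,3) y, folded S_def] and f2 = frame_bounds[OF le(2,4) y, folded S_def]
    have gs: "\<bar>metric y e1 e1 t - 1\<bar> \<le> \<epsilon> * \<bar>t\<bar>" "\<bar>metric y e1 e2 t\<bar> \<le> \<epsilon> * \<bar>t\<bar>" "\<bar>metric y e2 e2 t - 1\<bar> \<le> \<epsilon> * \<bar>t\<bar>"
      using gb[OF f1 f1] gb[OF f1 f2] gb[OF f2 f2] by (simp_all add: le)
    have e0: "det C * edens s du 0 y = a powr s + b powr s"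
      unfolding ed g0 by (rule dens_one_diag[OF ab])
    have "\<bar>det C * edens s du t y - (a powr s + b powr s)\<bar> \<le> dens_const s * (\<epsilon> * \<bar>t\<bar>) * (a powr s + b powr s)"
      unfolding ed by (rule dens_lipschitz[OF s ab tt(2) gs])
    then have "det C * \<bar>edens s du t y - edens s du 0 y\<bar> \<le> det C * (dens_const s * \<epsilon> * \<bar>t\<bar> * edens s du 0 y)"
      unfolding e0[symmetric] right_diff_distrib[symmetric] abs_mult using dC by (simp add: mult_ac)
    then show ?thesis using dC by simp
  qed
  then show thesis using that K t1 by blast
qed

lemma partial_Y: "partial i Y y = partial i (\<lambda>y. \<phi> (chart y)) y *v chart y + \<phi> (chart y) *v partial i chart y"
  unfolding Y_def[abs_def] X_def
  using partial_bilinear[OF matrix_vector_bounded_bilinear smooth_differentiable[OF smooth_\<phi>] smooth_differentiable[OF smooth_chart], of i y]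
  by (simp add: add.commute)

text \<open>At t = 0 the displacement of \<open>e\<close> is d\<phi>(e) x + \<phi> e, and \<phi> e
  is orthogonal to \<open>e\<close> by skewness, so the diagonal of the metric changes at the rate 2
  l with l = <e, d\<phi>(e) x>. With s = p/2 the derivative from \<open>dens_has_derivative\<close>
  is then -p (\<tau>1 l1 + \<tau>2 l2), where \<tau>1 and \<tau>2 are the diagonal entries of
  T.\<close>

lemma edens_has_derivative:
  assumes p: "p > 2" and L: "tangent_map (du (chart y)) (chart y) z"
  shows "((\<lambda>t. edens (p/2) du t y) has_real_derivative (p/2) * wedge_d (W_form p du) \<phi> y) (at 0)"
proof -
  let ?L = "du (chart y)" and ?s = "p/2"
  have s: "?s > 1" using p by simp
  obtain e1 e2 and C :: "real^2^2" and a b where E: "lor_frame (chart y) e1 e2" "lor (?L *v e1) (?L *v e2) = 0"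
    "rot (chart y) e1 = e2" "rot (chart y) e2 = - e1"
    and C: "det C = e1$1 * e2$2 - e2$1 * e1$2" "det C * area y = 1" and dC: "det C > 0"
    and ex: "e1 = e1$1 *\<^sub>R partial 1 chart y + e1$2 *\<^sub>R partial 2 chart y"
      "e2 = e2$1 *\<^sub>R partial 1 chart y + e2$2 *\<^sub>R partial 2 chart y"
    and a: "a = lor (?L *v e1) (?L *v e1)" and b: "b = lor (?L *v e2) (?L *v e2)" and ab: "a \<ge> 0" "b \<ge> 0"
    and g0: "metric y e1 e1 0 = 1" "metric y e1 e2 0 = 0" "metric y e2 e2 0 = 1"
    and ed: "\<And>s t. det C * edens s du t y
      = dens s (mat2 (metric y e1 e1 t) (metric y e1 e2 t) (metric y e1 e2 t) (metric y e2 e2 t)) (mat2 a 0 0 b)"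
    by (rule edens_frame[of du y z, OF L]) (rule that)
  let ?\<phi> = "\<lambda>i. partial i (\<lambda>y. \<phi> (chart y)) y"
  let ?l = "\<lambda>e. lor e ((e$1 *\<^sub>R ?\<phi> 1 + e$2 *\<^sub>R ?\<phi> 2) *v chart y)"
  have V0: "V 0 i y = partial i Y y" for i by (simp add: V_def \<sigma>_def)
  have W0: "displacement y e 0 = (e$1 *\<^sub>R ?\<phi> 1 + e$2 *\<^sub>R ?\<phi> 2) *v chart y + \<phi> (chart y) *v e"
    if "e = e$1 *\<^sub>R partial 1 chart y + e$2 *\<^sub>R partial 2 chart y" for e
  proof -
    have "\<phi> (chart y) *v e = \<phi> (chart y) *v (e$1 *\<^sub>R partial 1 chart y + e$2 *\<^sub>R partial 2 chart y)"
      using that by simp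
    then show ?thesis
      by (simp add: displacement_def V0 partial_Y matrix_vector_mult_add_rdistrib scaleR_matrix_vector_assoc[symmetric]
          matrix_vector_right_distrib matrix_vector_mult_scaleR scaleR_add_right)
  qed
  have sk: "lor e (\<phi> (chart y) *v e) = 0" for e using so21_skew section_so21 chart_hyp by blast
  have lW: "lor e1 (displacement y e1 0) = ?l e1" "lor e2 (displacement y e2 0) = ?l e2"
    unfolding W0[OF ex(1)] W0[OF ex(2)] lor_simps sk by simp_all
  have d11: "(metric y e1 e1 has_real_derivative 2 * ?l e1) (at 0)" "(metric y e2 e2 has_real_derivative 2 * ?l e2) (at 0)"
    using metric_has_derivative[of y e1 e1] metric_has_derivative[of y e2 e2] lW lor_sym[of "displacement y e1 0" e1] lor_sym[of "displacement y e2 0" e2] by simp_all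
  have D: "((\<lambda>t. det C * edens ?s du t y) has_real_derivative
      (a powr ?s + b powr ?s) * ((2 * ?l e1 + 2 * ?l e2) / 2) - ?s * (a powr ?s * (2 * ?l e1) + b powr ?s * (2 * ?l e2))) (at 0)"
    unfolding ed by (rule dens_has_derivative[OF s ab g0 d11(1) metric_has_derivative d11(2)])
  have so: "?\<phi> i \<in> so21" for i
    using section_so21 chart_hyp by (intro so21_partial smooth_differentiable[OF smooth_\<phi>]) auto
  have "(e1$1 * e2$2 - e2$1 * e1$2) * area y = 1" using C by simp
  note w = wedge_d_frame[where \<phi> = \<phi> and du = du, OF L p E this ex so a b refl refl]
  have "(a powr ?s + b powr ?s) * ((2 * ?l e1 + 2 * ?l e2) / 2) - ?s * (a powr ?s * (2 * ?l e1) + b powr ?s * (2 * ?l e2))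
     = det C * (?s * wedge_d (W_form p du) \<phi> y)"
  proof -
    define w' where "w' = (a powr ?s - (a powr ?s + b powr ?s) / p) * ?l e1 + (b powr ?s - (a powr ?s + b powr ?s) / p) * ?l e2"
    have "det C * (?s * wedge_d (W_form p du) \<phi> y) = - p * (det C * area y) * w'"
      unfolding w w'_def by simp
    also have "\<dots> = - p * w'" by (simp add: C(2))
    also have "\<dots> = (a powr ?s + b powr ?s) * ((2 * ?l e1 + 2 * ?l e2) / 2) - ?s * (a powr ?s * (2 * ?l e1) + b powr ?s * (2 * ?l e2))"
    proof -
      have "p * (u / p) = u" for u using p by simp
      then show ?thesis unfolding w'_def by (simp add: algebra_simps add_divide_distrib)
    qed
    finally show ?thesis ..
  qed
  with D have "((\<lambda>t. det C * edens ?s du t y) has_real_derivative det C * (?s * wedge_d (W_form p du) \<phi> y)) (at 0)"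
    by (simp only:)
  from DERIV_cmult[OF this, of "inverse (det C)"] show ?thesis using dC by (simp add: mult.assoc[symmetric])
qed

end

section \<open>Lifts and their energy\<close>

definition edens0 :: "real \<Rightarrow> (real^3 \<Rightarrow> real^3^3) \<Rightarrow> real^2 \<Rightarrow> real" where
  "edens0 s du y = dens s (gram (\<lambda>i. partial i chart y)) (gram (omega du y))"

lemma weak_differential_tangent_map:
  "weak_differential u du \<Longrightarrow> x \<in> hyp \<Longrightarrow> u x \<in> hyp \<Longrightarrow> tangent_map (du x) x (u x)"
  by (auto simp: weak_differential_def tangent_map_def)

lemma weak_differential_omega:
  "weak_differential u du \<Longrightarrow> weak_partial i (\<lambda>y. u (chart y)) (\<lambda>y. omega du y i)"
  by (simp add: weak_differential_def omega_def)

lemma omega_measurable: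
  "weak_differential u du \<Longrightarrow> (\<lambda>y. omega du y i) \<in> borel_measurable borel"
  using weak_differential_omega weak_partial_locally_integrable(2) locally_integrable_measurable by blast

lemma lor_measurable:
  assumes "f \<in> borel_measurable M" "g \<in> borel_measurable M"
  shows "(\<lambda>y. lor (f y) (g y)) \<in> borel_measurable M"
  by (rule borel_measurable_continuous_Pair[OF assms])
    (intro bounded_bilinear.continuous_on[OF lor_bounded_bilinear] continuous_intros)

lemma dens_gram_measurable:
  assumes [measurable]: "\<And>i. (\<lambda>y. P y i) \<in> borel_measurable borel" "\<And>i. (\<lambda>y. R y i) \<in> borel_measurable borel"
  shows "(\<lambda>y. dens s (gram (P y)) (gram (R y))) \<in> borel_measurable borel"
proof -
  have [measurable]: "(\<lambda>y. lor (P y i) (P y j)) \<in> borel_measurable borel" "(\<lambda>y. lor (R y i) (R y j)) \<in> borel_measurable borel" for i j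
    by (intro lor_measurable assms)+
  show ?thesis unfolding dens_def mdisc_def det_2 by (simp add: gram_def)
qed

lemma edens0_measurable: "weak_differential u du \<Longrightarrow> edens0 s du \<in> borel_measurable borel"
  unfolding edens0_def[abs_def]
  by (intro dens_gram_measurable omega_measurable borel_measurable_continuous_onI smooth_partial_continuous smooth_chart)

lemma gram_isometry: "B \<in> SO_plus \<Longrightarrow> gram (\<lambda>i. B *v P i) = gram P"
  by (simp add: gram_def SO_plus_lor)

text \<open>Weak derivatives are unique almost everywhere and isometries of the target preserve
  \<open>lor\<close>. It shows that the density does not depend on the lift or on the representative
  of its differential.\<close>

lemma AE_gram_omega_isometry:
  assumes u: "weak_differential u du" and u': "weak_differential u' du'"
    and B: "B \<in> SO_plus" "\<And>x. x \<in> hyp \<Longrightarrow> u' x = B *v u x"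
  shows "AE y in lborel. gram (omega du' y) = gram (omega du y)"
proof -
  have "(\<lambda>y. u' (chart y)) = (\<lambda>y. B *v u (chart y))" using B(2) chart_hyp by auto
  then have "AE y in lborel. omega du' y i = B *v omega du y i" for i
    using weak_partial_unique[of i "\<lambda>y. u' (chart y)"] weak_differential_omega[OF u', of i]
      weak_partial_matrix[OF weak_differential_omega[OF u, of i], of B] by simp
  then have "AE y in lborel. \<forall>i. omega du' y i = B *v omega du y i"
    by (simp add: AE_all_countable)
  then show ?thesis
  proof (rule AE_mp, intro AE_I2 impI)
    fix y assume "\<forall>i. omega du' y i = B *v omega du y i"
    then have "omega du' y = (\<lambda>i. B *v omega du y i)" by auto
    then show "gram (omega du' y) = gram (omega du y)" using gram_isometry[OF B(1)] by simp
  qed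
qed

context surface begin

lemma energy_eq:
  assumes p: "p > 2" and u: "weak_differential u du" "u ` hyp \<subseteq> hyp"
  shows "energy p \<Gamma> du = (\<integral>\<^sup>+ y. ennreal (edens0 (p/2) du y) * indicator D y \<partial>lborel)"
  unfolding energy_def surface_nn_integral_def
proof (rule nn_integral_cong)
  fix y
  have "tangent_map (du (chart y)) (chart y) (u (chart y))"
    using weak_differential_tangent_map[OF u(1) chart_hyp] u(2) chart_hyp by blast
  from energy_density(1)[of du, OF this p]
  show "ennreal (trace (mat_powr (Q (du (chart y))) p) / sqrt (1 + (norm y)\<^sup>2)) * indicator (dirichlet \<Gamma>) (chart y)
      = ennreal (edens0 (p/2) du y) * indicator D y"
    by (simp add: edens0_def area_def D_def indicator_def)
qed

text \<open>The Sobolev class is defined by the norm of \<open>du\<close>, the functional by the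
  eigenvalues. One inequality makes the competitors admissible, the other makes the energy of the
  minimizer finite.\<close>

lemma sobolev_energy_le:
  assumes p: "p > 2" and u: "weak_differential u du" "u ` hyp \<subseteq> hyp"
  shows "surface_nn_integral \<Gamma> (\<lambda>x. trace (du x ** adj (du x)) powr (p/2)) \<le> ennreal (2 powr (p/2)) * energy p \<Gamma> du" (is ?t1)
    and "energy p \<Gamma> du \<le> 2 * surface_nn_integral \<Gamma> (\<lambda>x. trace (du x ** adj (du x)) powr (p/2))" (is ?t2)
proof -
  let ?E = "\<lambda>y. trace (mat_powr (Q (du (chart y))) p) / sqrt (1 + (norm y)\<^sup>2)" and ?S = "\<lambda>y. trace (du (chart y) ** adj (du (chart y))) powr (p/2) / sqrt (1 + (norm y)\<^sup>2)"
  have t: "tangent_map (du (chart y)) (chart y) (u (chart y))" for y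
    using weak_differential_tangent_map[OF u(1) chart_hyp] u(2) chart_hyp by blast
  have pos: "sqrt (1 + (norm (y::real^2))\<^sup>2) > 0" for y by (simp add: add_pos_nonneg)
  note ed = energy_density[of du, OF t p]
  have mE: "(\<lambda>y. ennreal (?E y) * indicator (dirichlet \<Gamma>) (chart y)) \<in> borel_measurable lborel"
  proof -
    have "(\<lambda>y. ennreal (?E y) * indicator (dirichlet \<Gamma>) (chart y))
      = (\<lambda>y. ennreal (edens0 (p/2) du y) * indicator D y)"
      using ed(1) by (auto simp: edens0_def area_def D_def indicator_def)
    then show ?thesis using edens0_measurable[OF u(1), of "p/2"] D_borel by simp
  qed
  have mS: "(\<lambda>y. ennreal (?S y) * indicator (dirichlet \<Gamma>) (chart y)) \<in> borel_measurable lborel"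
  proof -
    have [measurable]: "(\<lambda>y. lor (omega du y i) (omega du y j)) \<in> borel_measurable borel" for i j
      by (intro lor_measurable omega_measurable[OF u(1)])
    have [measurable]: "(\<lambda>y. lor (partial i chart y) (partial j chart y)) \<in> borel_measurable borel" for i j
      by (intro borel_measurable_continuous_onI bounded_bilinear.continuous_on[OF lor_bounded_bilinear]
          smooth_partial_continuous smooth_chart)
    have [measurable]: "(\<lambda>y. trace (du (chart y) ** adj (du (chart y)))) \<in> borel_measurable borel"
      unfolding ed(5) mdisc_def det_2 by (simp add: gram_def)
    have e: "indicator (dirichlet \<Gamma>) (chart y) = (indicator D y :: ennreal)" for y by (simp add: D_def indicator_def)
    show ?thesis unfolding e by measurable
  qed
  show ?t1 unfolding energy_def surface_nn_integral_def
    unfolding nn_integral_cmult[OF mE, symmetric]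
  proof (rule nn_integral_mono)
    fix y :: "real^2"
    have "?S y
      \<le> 2 powr (p/2) * ?E y"
      using divide_right_mono[OF ed(2)[of y], of "sqrt (1 + (norm y)\<^sup>2)"] pos[of y] by simp
    then have "ennreal (?S y)
      \<le> ennreal (2 powr (p/2)) * ennreal (?E y)"
      by (subst ennreal_mult'[symmetric]) (auto intro: ennreal_leI)
    then show "ennreal (?S y) * indicator (dirichlet \<Gamma>) (chart y)
      \<le> ennreal (2 powr (p/2)) * (ennreal (?E y) * indicator (dirichlet \<Gamma>) (chart y))"
      by (auto simp: indicator_def)
  qed
  show ?t2 unfolding energy_def surface_nn_integral_def
    unfolding nn_integral_cmult[OF mS, symmetric]
  proof (rule nn_integral_mono)
    fix y :: "real^2"
    have "?E y
      \<le> 2 * ?S y"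
      using divide_right_mono[OF ed(3)[of y], of "sqrt (1 + (norm y)\<^sup>2)"] pos[of y] by simp
    then have "ennreal (?E y)
      \<le> ennreal 2 * ennreal (?S y)"
      by (subst ennreal_mult'[symmetric]) (auto intro: ennreal_leI)
    then show "ennreal (?E y) * indicator (dirichlet \<Gamma>) (chart y)
      \<le> 2 * (ennreal (?S y) * indicator (dirichlet \<Gamma>) (chart y))"
      by (auto simp: indicator_def)
  qed
qed

text \<open>At one point the two maps differ by an element of the group, and uniqueness of lifts on
  the connected \<open>hyp\<close> propagates this. Used for two lifts of \<open>u\<close>, and for
  a lift and its composite with a deck transformation of the domain.\<close>

lemma lifts_differ_by_deck:
  assumes f: "continuous_on hyp f" "f ` hyp \<subseteq> hyp" and g: "continuous_on hyp g" "g ` hyp \<subseteq> hyp"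
    and eq: "\<And>x. x \<in> hyp \<Longrightarrow> \<pi> (f x) = \<pi> (g x)"
  obtains B where "B \<in> \<Gamma>" "\<And>x. x \<in> hyp \<Longrightarrow> g x = B *v f x"
proof -
  have "\<pi> (f (chart 0)) = \<pi> (g (chart 0))" "f (chart 0) \<in> hyp" "g (chart 0) \<in> hyp"
    using eq chart_hyp f g by auto
  then obtain B where B: "B \<in> \<Gamma>" "g (chart 0) = B *v f (chart 0)" using fibres by blast
  have "g x = B *v f x" if x: "x \<in> hyp" for x
  proof (rule covering_space_lift_unique[OF cov, where T = hyp and f = "\<lambda>x. \<pi> (f x)" and a = "chart 0" and ?g1.0 = g and ?g2.0 = "\<lambda>x. B *v f x"])
    show "continuous_on hyp (\<lambda>x. \<pi> (f x))" using continuous_on_compose2[OF continuous_\<pi> f] .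
    show "continuous_on hyp (\<lambda>x. B *v f x)"
      by (rule linear_continuous_on_compose[OF f(1) matrix_vector_mul_linear])
    show "(\<lambda>x. B *v f x) \<in> hyp \<rightarrow> hyp" using \<Gamma>_hyp B(1) f(2) by auto
    show "(\<lambda>x. \<pi> (f x)) \<in> hyp \<rightarrow> M" using \<pi>_image f(2) by auto
    show "\<pi> (f x) = \<pi> (B *v f x)" if "x \<in> hyp" for x using \<pi>_act[OF B(1)] f(2) that by auto
  qed (use B g eq x connected_hyp chart_hyp in auto)
  then show thesis using that B(1) by blast
qed

text \<open>Continuity is local, and locally the covering has a continuous section \<open>r\<close>,
  through which \<open>F\<close> factors.\<close>

lemma continuous_on_homotopy_from_cover:
  fixes F :: "real \<times> 'm \<Rightarrow> 'n::topological_space"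
  assumes "continuous_on ({0..1} \<times> hyp) (\<lambda>z. F (fst z, \<pi> (snd z)))"
  shows "continuous_on ({0..1} \<times> M) F"
  unfolding continuous_on_eq_continuous_within
proof
  fix z :: "real \<times> 'm" assume z: "z \<in> {0..1} \<times> M"
  then obtain x where x: "x \<in> hyp" "snd z = \<pi> x" using \<pi>_image by auto
  obtain T U r where T: "x \<in> T" "openin (top_of_set hyp) T" "\<pi> x \<in> U" "openin (top_of_set M) U" "homeomorphism T U \<pi> r"
    using covering_space_local_homeomorphism[OF cov x(1)] by metis
  obtain S where S: "open S" "U = M \<inter> S" using T(4) by (auto simp: openin_open)
  have r: "continuous_on U r" "r ` U = T" "\<And>m. m \<in> U \<Longrightarrow> \<pi> (r m) = m"
    using T(5) by (auto simp: homeomorphism_def)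
  have TH: "T \<subseteq> hyp" using T(2) openin_imp_subset by blast
  have "continuous_on ({0..1} \<times> U) (\<lambda>z. (fst z, r (snd z)))"
    by (intro continuous_intros continuous_on_compose2[OF r(1)]) auto
  then have "continuous_on ({0..1} \<times> U) (\<lambda>z. F (fst (fst z, r (snd z)), \<pi> (snd (fst z, r (snd z)))))"
    by (rule continuous_on_compose2[OF assms]) (use r TH in auto)
  then have "continuous_on ({0..1} \<times> U) F"
    by (rule continuous_on_eq) (use r in auto)
  moreover have zU: "z \<in> {0..1} \<times> U" using z x T(3) by (auto simp: mem_Times_iff)
  ultimately have "continuous (at z within {0..1} \<times> U) F"
    unfolding continuous_on_eq_continuous_within by blast
  moreover have "at z within {0..1} \<times> M = at z within {0..1} \<times> U"
    by (rule at_within_nhd[of _ "UNIV \<times> S"]) (use zU S in \<open>auto intro: open_Times\<close>)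
  ultimately show "continuous (at z within {0..1} \<times> M) F" by simp
qed

end

section \<open>The first variation of the energy\<close>

locale variation_pair = variation M \<pi>M \<Gamma> \<phi> + N: surface N \<pi>N \<Lambda>
  for M :: "'m::t2_space set" and \<pi>M and \<Gamma> and \<phi> and N :: "'n::t2_space set" and \<pi>N and \<Lambda> +
  fixes p :: real and u :: "'m \<Rightarrow> 'n" and ut :: "real^3 \<Rightarrow> real^3" and du :: "real^3 \<Rightarrow> real^3^3"
  assumes p: "p > 2" and lift: "lift_of \<pi>M \<pi>N u ut" and du: "weak_differential ut du"
begin

lemma ut: "continuous_on hyp ut" "ut ` hyp \<subseteq> hyp" "\<And>x. x \<in> hyp \<Longrightarrow> \<pi>N (ut x) = u (\<pi>M x)"
  using lift by (auto simp: lift_of_def)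

lemma tangent_du: "tangent_map (du (chart y)) (chart y) (ut (chart y))"
  using weak_differential_tangent_map[OF du chart_hyp] ut(2) chart_hyp by blast

lemma lift_gram_unique:
  assumes "lift_of \<pi>M \<pi>N u ut'" "weak_differential ut' du'"
  shows "AE y in lborel. gram (omega du' y) = gram (omega du y)"
proof -
  have ut': "continuous_on hyp ut'" "ut' ` hyp \<subseteq> hyp" "\<And>x. x \<in> hyp \<Longrightarrow> \<pi>N (ut' x) = u (\<pi>M x)"
    using assms(1) by (auto simp: lift_of_def)
  obtain B where "B \<in> \<Lambda>" "\<And>x. x \<in> hyp \<Longrightarrow> ut' x = B *v ut x"
    using N.lifts_differ_by_deck[OF ut(1,2) ut'(1,2)] ut(3) ut'(3) by metis
  then show ?thesis using AE_gram_omega_isometry[OF du assms(2)] N.\<Gamma>_SO by blast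
qed

lemma energy_unique:
  assumes "lift_of \<pi>M \<pi>N u ut'" "weak_differential ut' du'"
  shows "energy p \<Gamma> du' = energy p \<Gamma> du"
proof -
  have im: "ut' ` hyp \<subseteq> hyp" using assms(1) by (simp add: lift_of_def)
  show ?thesis
    unfolding energy_eq[OF p assms(2) im] energy_eq[OF p du ut(2)]
    by (rule nn_integral_cong_AE, rule AE_mp[OF lift_gram_unique[OF assms]], intro AE_I2 impI) (simp add: edens0_def)
qed

lemma J_eq_energy: "J p \<Gamma> \<pi>M \<pi>N u = energy p \<Gamma> du"
  unfolding J_def
  by (rule antisym, rule Inf_lower, use lift du in blast, rule Inf_greatest, use energy_unique in force)

lemma energy_finite:
  assumes "sobolev_map p \<Gamma> \<pi>M \<pi>N u"
  shows "energy p \<Gamma> du < \<infinity>"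
proof -
  obtain ut' du' where *: "lift_of \<pi>M \<pi>N u ut'" "weak_differential ut' du'"
    "surface_nn_integral \<Gamma> (\<lambda>x. trace (du' x ** adj (du' x)) powr (p/2)) < \<infinity>"
    using assms by (auto simp: sobolev_map_def)
  have "ut' ` hyp \<subseteq> hyp" using *(1) by (simp add: lift_of_def)
  then have "energy p \<Gamma> du' < \<infinity>"
    using sobolev_energy_le(2)[OF p *(2)] *(3) by (simp add: ennreal_mult_less_top order_le_less_trans)
  then show ?thesis using energy_unique[OF *(1,2)] by simp
qed

lemma edens_0: "edens s du 0 y = edens0 s du y"
  by (simp add: edens_def edens0_def \<theta>_0)

lemma edens_measurable [measurable]: "edens s du t \<in> borel_measurable borel"
  unfolding edens_def[abs_def]
  by (intro dens_gram_measurable omega_measurable[OF du] borel_measurable_continuous_onI smooth_partial_continuous smooth_\<theta>_chart)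

text \<open>The lift of \<open>u\<close> is equivariant up to isometries of the target, hence the integrand is invariant.\<close>
lemma edens_invariant:
  assumes A: "A \<in> \<Gamma>"
  shows "AE y in lborel. det (jac (act A) y) * edens s du t (act A y) = edens s du t y"
proof -
  let ?A' = "matrix_inv A"
  have A': "?A' \<in> \<Gamma>" using A \<Gamma>_inv by blast
  have cA: "chart (act A y) = A *v chart y" for y using A \<Gamma>_SO chart_act by blast
  have "continuous_on hyp (\<lambda>x. ut (A *v x))"
    by (rule continuous_on_compose2[OF ut(1)])
      (use \<Gamma>_hyp[OF A] in \<open>auto intro!: linear_continuous_on matrix_vector_mul_bounded_linear\<close>)
  moreover have "(\<lambda>x. ut (A *v x)) ` hyp \<subseteq> hyp" using \<Gamma>_hyp[OF A] ut(2) by blast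
  moreover have "\<pi>N (ut x) = \<pi>N (ut (A *v x))" if "x \<in> hyp" for x
    using ut(3) \<pi>_act[OF A that] \<Gamma>_hyp[OF A that] that by simp
  ultimately obtain B where B: "B \<in> \<Lambda>" "\<And>x. x \<in> hyp \<Longrightarrow> ut (A *v x) = B *v ut x"
    using N.lifts_differ_by_deck[OF ut(1,2), of "\<lambda>x. ut (A *v x)"] by metis
  have BS: "B \<in> SO_plus" using B N.\<Gamma>_SO by blast
  \<comment> \<open>The weak derivative of \<open>ut\<close> after \<open>A\<close> according to the
    chain rule. As this map equals \<open>B\<close> after \<open>ut\<close>, uniqueness of weak
    derivatives identifies \<open>w'\<close> almost everywhere with \<open>B\<close> applied to
    \<open>omega du\<close>.\<close>
  define w' where "w' k y = comb (jac (act A) y) (omega du (act A y)) k" for k y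
  have jj: "jac (act A) (act ?A' z) ** jac (act ?A') z = mat 1" for z
  proof -
    have "(\<lambda>y. act A (act ?A' y)) = (\<lambda>y. y)" using act_inverse(1)[OF A] by auto
    then have "jac (\<lambda>y. y) z = jac (act A) (act ?A' z) ** jac (act ?A') z"
      using jac_compose[OF smooth_act smooth_act, of A ?A' z] by simp
    moreover have "jac (\<lambda>y. y) z = mat 1"
      using partial_eqI[OF has_derivative_ident, of _ z] by (simp add: jac_def vec_eq_iff mat_def axis_def)
    ultimately show ?thesis by simp
  qed
  have cc: "comb C (comb C' P) = comb (C' ** C) P" for C C' P
    by (simp add: comb_def fun_eq_iff forall_2 matrix_matrix_mult_def sum_2 algebra_simps)
  have c1: "comb (mat 1) P = P" for P
    by (auto simp: comb_def fun_eq_iff forall_2 mat_def sum_2)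
  have pull: "omega du z i = (\<Sum>k\<in>UNIV. (partial i (act ?A') z $ k) *\<^sub>R w' k (act ?A' z))" for z i
  proof -
    have "omega du z i = comb (jac (act ?A') z) (comb (jac (act A) (act ?A' z)) (omega du (act A (act ?A' z)))) i"
      by (simp add: cc jj c1 act_inverse(1)[OF A])
    then show ?thesis
      unfolding comb_def[of "jac (act ?A') z"] w'_def[symmetric] by (simp add: jac_def)
  qed
  have dif: "diffeo (act ?A') (act A)"
  proof -
    have "matrix_inv ?A' = A"
    proof -
      have "matrix_inv ?A' = (A ** ?A') ** matrix_inv ?A'" using A \<Gamma>_SO SO_plus_inverse(1)[of A] by auto
      also have "\<dots> = A ** (?A' ** matrix_inv ?A')" by (simp add: matrix_mul_assoc)
      also have "\<dots> = A" using A' \<Gamma>_SO SO_plus_inverse(1)[of ?A'] by auto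
      finally show ?thesis .
    qed
    then show ?thesis using diffeo_act[OF A'] by simp
  qed
  have "weak_partial k (\<lambda>y. ut (chart (act A y))) (w' k)" for k
    by (rule weak_partial_diffeo[OF dif weak_differential_omega[OF du] pull])
  moreover have "(\<lambda>y. ut (chart (act A y))) = (\<lambda>y. B *v ut (chart y))" using B(2) chart_hyp cA by auto
  ultimately have "weak_partial k (\<lambda>y. B *v ut (chart y)) (w' k)" for k by simp
  then have "AE y in lborel. w' k y = B *v omega du y k" for k
    by (rule weak_partial_unique) (rule weak_partial_matrix[OF weak_differential_omega[OF du]])
  then have "AE y in lborel. \<forall>k. w' k y = B *v omega du y k" by (simp add: AE_all_countable)
  then show ?thesis
  proof (rule AE_mp, intro AE_I2 impI)
    fix y assume y: "\<forall>k. w' k y = B *v omega du y k"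
    let ?P = "\<lambda>y i. partial i (\<lambda>y. \<theta> t (chart y)) y"
    have "gram (comb (jac (act A) y) (omega du (act A y))) = gram (omega du y)"
    proof -
      have "comb (jac (act A) y) (omega du (act A y)) = (\<lambda>k. B *v omega du y k)"
        using y by (auto simp: w'_def)
      then show ?thesis using gram_isometry[OF BS] by simp
    qed
    moreover have "comb (jac (act A) y) (?P (act A y)) = (\<lambda>k. A *v ?P y k)"
    proof
      fix k
      have "partial k (\<lambda>y. \<theta> t (chart (act A y))) y = (\<Sum>j\<in>UNIV. (partial k (act A) y $ j) *\<^sub>R ?P (act A y) j)"
        by (rule partial_compose(1)[OF smooth_differentiable[OF smooth_\<theta>_chart] smooth_differentiable[OF smooth_act]])
      moreover have "(\<lambda>y. \<theta> t (chart (act A y))) = (\<lambda>y. A *v \<theta> t (chart y))"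
        using cA \<theta>_equivariant[OF A chart_hyp] by auto
      moreover have "partial k (\<lambda>y. A *v \<theta> t (chart y)) y = A *v ?P y k"
        by (rule partial_linear[OF matrix_vector_mul_bounded_linear smooth_differentiable[OF smooth_\<theta>_chart]])
      ultimately show "comb (jac (act A) y) (?P (act A y)) k = A *v ?P y k"
        by (simp add: comb_def jac_def)
    qed
    moreover have "gram (\<lambda>k. A *v ?P y k) = gram (?P y)"
      by (rule gram_isometry) (use A \<Gamma>_SO in blast)
    moreover have d: "det (jac (act A) y) > 0" using diffeo_act[OF A] unfolding diffeo_def by blast
    moreover have "dens s (gram (comb (jac (act A) y) (?P (act A y)))) (gram (comb (jac (act A) y) (omega du (act A y))))
        = \<bar>det (jac (act A) y)\<bar> * dens s (gram (?P (act A y))) (gram (omega du (act A y)))"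
      by (rule dens_comb) (use d in simp)
    ultimately show "det (jac (act A) y) * edens s du t (act A y) = edens s du t y"
      unfolding edens_def by (simp only: abs_of_pos)
  qed
qed

section \<open>The competitors\<close>

definition \<Psi> :: "real \<Rightarrow> real^2 \<Rightarrow> real^2" where "\<Psi> t = inv (\<Theta> t)"

text \<open>The competitor \<open>u \<circ> \<theta>\<^sub>t\<^sup>-\<^sup>1\<close>: its lift, its weak differential (the tangent vector \<open>v\<close> is first
  projected to the tangent plane at \<open>x\<close>), and the map of \<open>M\<close> itself.\<close>
definition vt :: "real \<Rightarrow> real^3 \<Rightarrow> real^3" where "vt t x = ut (chart (\<Psi> t (proj x)))"

definition dv :: "real \<Rightarrow> real^3 \<Rightarrow> real^3^3" where
  "dv t x = matrix (\<lambda>v. \<Sum>i\<in>UNIV.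
     (matrix_inv (jac (\<Theta> t) (\<Psi> t (proj x))) *v proj (v + lor x v *\<^sub>R x)) $ i *\<^sub>R omega du (\<Psi> t (proj x)) i)"

definition v :: "real \<Rightarrow> 'm \<Rightarrow> 'n" where "v t m = \<pi>N (vt t (SOME x. x \<in> hyp \<and> \<pi>M x = m))"

lemma dv_mult:
  "dv t x *v w = (\<Sum>i\<in>UNIV.
     (matrix_inv (jac (\<Theta> t) (\<Psi> t (proj x))) *v proj (w + lor x w *\<^sub>R x)) $ i *\<^sub>R omega du (\<Psi> t (proj x)) i)"
  (is "_ = ?F w")
proof -
  have pl: "proj (a + b) = proj a + proj b" "proj (c *\<^sub>R a) = c *\<^sub>R proj a" for a b c
    by (simp_all add: vec_eq_iff forall_2)
  have "linear ?F"
  proof (rule linearI)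
    fix a b :: "real^3" and c :: real
    have 1: "proj ((a + b) + lor x (a + b) *\<^sub>R x) = proj (a + lor x a *\<^sub>R x) + proj (b + lor x b *\<^sub>R x)"
      by (simp add: pl lor_simps algebra_simps)
    have 2: "proj (c *\<^sub>R a + lor x (c *\<^sub>R a) *\<^sub>R x) = c *\<^sub>R proj (a + lor x a *\<^sub>R x)"
      by (simp add: pl lor_simps algebra_simps)
    show "?F (a + b) = ?F a + ?F b"
      unfolding 1 by (simp add: matrix_vector_right_distrib scaleR_add_left sum.distrib)
    show "?F (c *\<^sub>R a) = c *\<^sub>R ?F a"
      unfolding 2 by (simp add: matrix_vector_mult_scaleR scaleR_sum_right)
  qed
  from matrix_works[OF this[folded linear_matrix_vector_mul_eq]] show ?thesis unfolding dv_def .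
qed

context
  fixes t :: real
  assumes dif: "diffeo (\<Theta> t) (inv (\<Theta> t))"
begin

lemma \<Theta>\<Psi>: "\<Theta> t (\<Psi> t y) = y" "\<Psi> t (\<Theta> t y) = y"
  using dif by (auto simp: diffeo_def \<Psi>_def)

lemma det_\<Theta>: "det (jac (\<Theta> t) z) > 0" using dif by (simp add: diffeo_def)

lemma \<Psi>_act: "A \<in> \<Gamma> \<Longrightarrow> \<Psi> t (act A y) = act A (\<Psi> t y)"
  using \<Theta>\<Psi> \<Theta>_act by metis

lemma jac_inverse: "matrix_inv (jac (\<Theta> t) z) ** jac (\<Theta> t) z = mat 1"
proof -
  have "\<exists>A'. jac (\<Theta> t) z ** A' = mat 1 \<and> A' ** jac (\<Theta> t) z = mat 1"
    using det_\<Theta>[of z] invertible_det_nz[of "jac (\<Theta> t) z"] by (simp add: invertible_def)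
  then show ?thesis unfolding matrix_inv_def by (rule someI_ex[THEN conjunct2])
qed

text \<open>The chain rule for u = v \<circ> \<theta> in coordinates, in the implicit form in which
  \<open>weak_partial_diffeo\<close> takes the new derivative.\<close>

lemma omega_dv: "omega du z i = comb (jac (\<Theta> t) z) (omega (dv t) (\<Theta> t z)) i"
proof -
  let ?J = "jac (\<Theta> t) z" and ?I = "matrix_inv (jac (\<Theta> t) z)"
  have pr: "proj (partial k chart y) = axis k 1" for k y
    by (simp add: vec_eq_iff forall_2 partial_chart_12)
  have o: "omega (dv t) (\<Theta> t z) k = (\<Sum>j\<in>UNIV. ?I $ j $ k *\<^sub>R omega du z j)" for k
  proof -
    have "?I *v axis k 1 = (\<chi> j. ?I $ j $ k)"
      by (simp add: vec_eq_iff matrix_vector_mult_def axis_def if_distrib sum.delta cong: if_cong)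
    then show ?thesis
      unfolding omega_def[of "dv t"] dv_mult by (simp add: tangent_partial_chart pr \<Theta>\<Psi>)
  qed
  have "comb ?J (omega (dv t) (\<Theta> t z)) i = (\<Sum>j\<in>UNIV. (?I ** ?J) $ j $ i *\<^sub>R omega du z j)"
    by (simp add: comb_def o matrix_matrix_mult_def sum_2 algebra_simps)
  also have "\<dots> = omega du z i"
    unfolding jac_inverse using exhaust_2[of i] by (auto simp: mat_def sum_2)
  finally show ?thesis ..
qed

lemma weak_differential_dv: "weak_differential (vt t) (dv t)"
  unfolding weak_differential_def
proof (intro conjI ballI allI)
  fix x assume x: "x \<in> hyp"
  have "proj (x + lor x x *\<^sub>R x) = 0" using hyp_lor[OF x] by (simp add: vec_eq_iff forall_2)
  then show "dv t x *v x = 0" by (simp add: dv_mult)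
  fix w
  have "lor (omega du (\<Psi> t (proj x)) i) (vt t x) = 0" for i
    using tangent_du[of "\<Psi> t (proj x)"] by (simp add: tangent_map_def tangent_def omega_def vt_def)
  then show "dv t x *v w \<in> tangent (vt t x)"
    by (simp add: dv_mult tangent_def sum_2 lor_simps)
next
  fix k
  have "weak_partial k (\<lambda>y. ut (chart (inv (\<Theta> t) y))) (\<lambda>y. omega (dv t) y k)"
    by (rule weak_partial_diffeo[OF dif weak_differential_omega[OF du]])
      (simp add: omega_dv comb_def jac_def)
  then show "weak_partial k (\<lambda>y. vt t (chart y)) (\<lambda>y. dv t (chart y) *v partial k chart y)"
    by (simp add: vt_def \<Psi>_def omega_def)
qed

lemma vt_continuous: "continuous_on hyp (vt t)"
proof -
  have c\<Psi>: "continuous_on UNIV (\<Psi> t)" unfolding \<Psi>_def by (rule diffeo_continuous_inverse[OF dif])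
  have "continuous_on hyp (\<lambda>x. chart (\<Psi> t (proj x)))"
    by (intro continuous_on_compose2[OF continuous_chart[of UNIV]] continuous_on_compose2[OF c\<Psi>] continuous_proj) auto
  then show ?thesis unfolding vt_def[abs_def]
    by (rule continuous_on_compose2[OF ut(1)]) (use chart_hyp in auto)
qed

lemma vt_hyp: "vt t ` hyp \<subseteq> hyp"
  using ut(2) chart_hyp by (auto simp: vt_def)

lemma v_\<pi>: "x \<in> hyp \<Longrightarrow> v t (\<pi>M x) = \<pi>N (vt t x)"
proof -
  assume x: "x \<in> hyp"
  let ?z = "SOME z. z \<in> hyp \<and> \<pi>M z = \<pi>M x"
  obtain A where A: "A \<in> \<Gamma>" "?z = A *v x" using some_preimage[OF x] .
  have "proj ?z = act A (proj x)" using A(2) x by (simp add: act_def chart_proj)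
  then have "chart (\<Psi> t (proj ?z)) = A *v chart (\<Psi> t (proj x))"
    using \<Psi>_act[OF A(1)] chart_act A(1) \<Gamma>_SO by (metis subsetD)
  then have "\<pi>N (vt t ?z) = \<pi>N (vt t x)"
    using ut(3) chart_hyp \<pi>_act[OF A(1) chart_hyp] \<Gamma>_hyp[OF A(1) chart_hyp] by (simp add: vt_def)
  then show ?thesis by (simp add: v_def)
qed

lemma lift_v: "lift_of \<pi>M \<pi>N (v t) (vt t)"
  using vt_continuous vt_hyp v_\<pi> by (simp add: lift_of_def)

lemma continuous_X: "continuous_on hyp X"
proof -
  have "continuous_on hyp (\<lambda>x. Y (proj x))"
    by (intro continuous_on_compose2[OF smooth_continuous[OF smooth_Y, of UNIV]] continuous_proj) auto
  then show ?thesis by (rule continuous_on_eq) (simp add: Y_def chart_proj)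
qed

text \<open>The homotopy \<open>s \<mapsto> u \<circ> \<theta>\<^sub>t\<^sup>-\<^sup>1 \<circ> \<theta>\<^sub>s\<^sub>t\<close> joins the competitor to \<open>u\<close>.\<close>
lemma homotopic_v: "homotopic_with_canon (\<lambda>_. True) M N u (v t)"
proof -
  define H where "H z = v t (\<pi>M (\<theta> (fst z * t) (SOME x. x \<in> hyp \<and> \<pi>M x = snd z)))" for z :: "real \<times> 'm"
  have H: "H (s, \<pi>M x) = \<pi>N (vt t (\<theta> (s * t) x))" if x: "x \<in> hyp" for s x
  proof -
    let ?z = "SOME z. z \<in> hyp \<and> \<pi>M z = \<pi>M x"
    obtain A where A: "A \<in> \<Gamma>" "?z = A *v x" using some_preimage[OF x] .
    have "\<pi>M (\<theta> (s * t) ?z) = \<pi>M (\<theta> (s * t) x)"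
      unfolding A(2) \<theta>_equivariant[OF A(1) x] by (rule \<pi>_act[OF A(1) \<theta>_hyp[OF x]])
    then show ?thesis using v_\<pi>[OF \<theta>_hyp[OF x]] by (simp add: H_def)
  qed
  have c\<theta>: "continuous_on ({0..1} \<times> hyp) (\<lambda>z. \<theta> (fst z * t) (snd z))"
    unfolding \<theta>_def
    by (intro continuous_intros bounded_bilinear.continuous_on[OF lor_bounded_bilinear]
        continuous_on_compose2[OF continuous_X]) auto
  have "continuous_on ({0..1} \<times> hyp) (\<lambda>z. vt t (\<theta> (fst z * t) (snd z)))"
    by (rule continuous_on_compose2[OF vt_continuous c\<theta>]) (use \<theta>_hyp in auto)
  then have "continuous_on ({0..1} \<times> hyp) (\<lambda>z. \<pi>N (vt t (\<theta> (fst z * t) (snd z))))"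
    by (rule continuous_on_compose2[OF N.continuous_\<pi>]) (use \<theta>_hyp vt_hyp in auto)
  then have "continuous_on ({0..1} \<times> hyp) (\<lambda>z. H (fst z, \<pi>M (snd z)))"
    by (rule continuous_on_eq) (auto simp: H)
  then have cH: "continuous_on ({0..1} \<times> M) H" by (rule continuous_on_homotopy_from_cover)
  have "\<exists>h. continuous_map (prod_topology (top_of_set {0..1::real}) (top_of_set M)) (top_of_set N) h \<and>
      (\<forall>m\<in>topspace (top_of_set M). h (0, m) = v t m) \<and> (\<forall>m\<in>topspace (top_of_set M). h (1, m) = u m)"
  proof (intro exI[of _ H] conjI ballI)
    have "H (s, m) \<in> N" if m: "m \<in> M" for s m
    proof -
      obtain x where x: "x \<in> hyp" "m = \<pi>M x" using \<pi>_image m by blast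
      have "vt t (\<theta> (s * t) x) \<in> hyp" using vt_hyp \<theta>_hyp[OF x(1)] by blast
      then show ?thesis using H[OF x(1)] x(2) N.\<pi>_image by auto
    qed
    then show "continuous_map (prod_topology (top_of_set {0..1}) (top_of_set M)) (top_of_set N) H"
      using cH by (auto simp: continuous_map_in_subtopology)
  next
    fix m assume "m \<in> topspace (top_of_set M)"
    then obtain x where x: "x \<in> hyp" "m = \<pi>M x" using \<pi>_image by auto
    show "H (0, m) = v t m" using H[OF x(1), of 0] v_\<pi>[OF x(1)] x(2) by (simp add: \<theta>_0)
    have "\<Psi> t (proj (\<theta> t x)) = proj x" using \<Theta>\<Psi>(2)[of "proj x"] by (simp add: \<Theta>_def chart_proj x(1))
    then show "H (1, m) = u m" using H[OF x(1), of 1] ut(3)[OF x(1)] x by (simp add: vt_def chart_proj)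
  qed
  then have "homotopic_with_canon (\<lambda>_. True) M N (v t) u" by (subst homotopic_with) auto
  then show ?thesis by (rule homotopic_with_symD)
qed

text \<open>Substituting \<open>\<Theta> t\<close> restores \<open>u\<close> with the pulled back
  metric but replaces \<open>D\<close> by its preimage. Since \<open>\<Theta> t\<close> commutes
  with \<Gamma>, two translates of this preimage meet only in the preimage of
  \<open>overlap\<close>, so \<open>fold_into_D\<close> applies.\<close>

lemma energy_v_le: "energy p \<Gamma> (dv t) \<le> (\<integral>\<^sup>+ y. ennreal (edens (p/2) du t y) * indicator D y \<partial>lborel)"
proof -
  let ?s = "p/2"
  have [measurable]: "\<Theta> t \<in> borel_measurable borel"
    using smooth_continuous[OF smooth_\<Theta>] borel_measurable_continuous_onI by blast
  have [measurable]: "edens0 ?s (dv t) \<in> borel_measurable borel" by (rule edens0_measurable[OF weak_differential_dv])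
  have pb: "det (jac (\<Theta> t) z) * edens0 ?s (dv t) (\<Theta> t z) = edens ?s du t z" for z
  proof -
    have "(\<lambda>k. partial k (\<lambda>y. \<theta> t (chart y)) z) = comb (jac (\<Theta> t) z) (\<lambda>i. partial i chart (\<Theta> t z))"
      using partial_chart_compose[OF smooth_\<Theta>, of _ t z] by (auto simp: chart_\<Theta> comb_def jac_def)
    moreover have "omega du z = comb (jac (\<Theta> t) z) (omega (dv t) (\<Theta> t z))" using omega_dv by auto
    ultimately show ?thesis
      unfolding edens_def edens0_def using dens_comb[of "jac (\<Theta> t) z"] det_\<Theta>[of z] by simp
  qed
  have "energy p \<Gamma> (dv t) = (\<integral>\<^sup>+ y. ennreal (edens0 ?s (dv t) y) * indicator D y \<partial>lborel)"
    by (rule energy_eq[OF p weak_differential_dv vt_hyp])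
  also have "\<dots> = (\<integral>\<^sup>+ z. ennreal (det (jac (\<Theta> t) z)) * (ennreal (edens0 ?s (dv t) (\<Theta> t z)) * indicator D (\<Theta> t z)) \<partial>lborel)"
    by (rule nn_integral_diffeo[OF dif]) measurable
  also have "\<dots> = (\<integral>\<^sup>+ z. ennreal (edens ?s du t z) * indicator (\<Theta> t -` D) z \<partial>lborel)"
  proof (rule nn_integral_cong)
    fix z
    show "ennreal (det (jac (\<Theta> t) z)) * (ennreal (edens0 ?s (dv t) (\<Theta> t z)) * indicator D (\<Theta> t z))
        = ennreal (edens ?s du t z) * indicator (\<Theta> t -` D) z"
      unfolding pb[symmetric] using det_\<Theta>[of z]
      by (simp add: ennreal_mult' mult.assoc[symmetric] indicator_def)
  qed
  also have "\<dots> \<le> (\<integral>\<^sup>+ y. ennreal (edens ?s du t y) * indicator D y \<partial>lborel)"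
  proof (rule fold_into_D)
    show "\<Theta> t -` D \<in> sets borel" using measurable_sets_borel[of "\<Theta> t" borel D] by simp
    show "AE y in lborel. ennreal (det (jac (act A) y)) * ennreal (edens ?s du t (act A y)) = ennreal (edens ?s du t y)"
      if A: "A \<in> \<Gamma>" for A
    proof (rule AE_mp[OF edens_invariant[OF A, of ?s t]], intro AE_I2 impI)
      fix y assume "det (jac (act A) y) * edens ?s du t (act A y) = edens ?s du t y"
      moreover have "det (jac (act A) y) > 0" using diffeo_act[OF A] unfolding diffeo_def by blast
      ultimately show "ennreal (det (jac (act A) y)) * ennreal (edens ?s du t (act A y)) = ennreal (edens ?s du t y)"
        by (metis ennreal_mult' less_imp_le)
    qed
    obtain S where S: "S \<in> null_sets lborel" "{y. \<not> y \<notin> overlap} \<subseteq> S"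
      using overlap_null by (auto elim!: AE_E simp: null_sets_def)
    have "AE y in lborel. y \<notin> \<Theta> t -` S" by (rule AE_not_in[OF diffeo_null_preimage[OF dif S(1)]])
    then show "AE y in lborel. \<forall>A\<in>\<Gamma>. \<forall>B\<in>\<Gamma>. act A y \<in> \<Theta> t -` D \<longrightarrow> act B y \<in> \<Theta> t -` D \<longrightarrow> A = B"
    proof (rule AE_mp, intro AE_I2 impI ballI)
      fix y A B assume y: "y \<notin> \<Theta> t -` S" and AB: "A \<in> \<Gamma>" "B \<in> \<Gamma>" "act A y \<in> \<Theta> t -` D" "act B y \<in> \<Theta> t -` D"
      then have "act A (\<Theta> t y) \<in> D" "act B (\<Theta> t y) \<in> D" by (simp_all add: \<Theta>_act)
      moreover have "\<Theta> t y \<notin> overlap" using y S(2) by auto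
      ultimately show "A = B" using AB unfolding overlap_def by blast
    qed
  qed measurable
  finally show ?thesis .
qed

end

section \<open>Vanishing of the first variation\<close>

lemma edens_0_nonneg: "edens (p/2) du 0 y \<ge> 0"
proof -
  have "trace (mat_powr (Q (du (chart y))) p) * area y = edens (p/2) du 0 y"
    using energy_density(1)[where du = du, OF tangent_du p] by (simp add: edens_0 edens0_def)
  moreover have "trace (mat_powr (Q (du (chart y))) p) \<ge> 0"
    by (rule energy_density(4)[where du = du, OF tangent_du p])
  ultimately show ?thesis using area_pos[of y] by (metis less_imp_le mult_nonneg_nonneg)
qed

text \<open>The first variation of the energy exists and is, up to a factor, the pairing of \<open>W\<close> with
  \<open>d\<phi>\<close>. It vanishes because the difference quotients are nonnegative for \<open>t > 0\<close> and nonpositive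
  for \<open>t < 0\<close>.\<close>
lemma first_variation_zero:
  assumes min: "minimizer p \<Gamma> M \<pi>M N \<pi>N f u"
  shows "has_bochner_integral lborel (\<lambda>y. indicator D y * wedge_d (W_form p du) \<phi> y) 0"
proof -
  let ?s = "p/2" and ?e = "\<lambda>t y. edens (p/2) du t y"
  let ?w = "\<lambda>y. wedge_d (W_form p du) \<phi> y"
  have sob: "sobolev_map p \<Gamma> \<pi>M \<pi>N u" and hom: "homotopic_with_canon (\<lambda>_. True) M N f u"
    and le: "\<And>v. sobolev_map p \<Gamma> \<pi>M \<pi>N v \<Longrightarrow> homotopic_with_canon (\<lambda>_. True) M N f v \<Longrightarrow> J p \<Gamma> \<pi>M \<pi>N u \<le> J p \<Gamma> \<pi>M \<pi>N v"
    using min by (auto simp: minimizer_def)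
  have s: "?s > 1" using p by simp
  obtain R where R: "D \<subseteq> cball 0 R" using D_bounded by blast
  obtain t0 where t0: "t0 > 0" "\<And>t. \<bar>t\<bar> < t0 \<Longrightarrow> diffeo (\<Theta> t) (inv (\<Theta> t))" using diffeo_\<Theta> by metis
  obtain K t1 where K: "K \<ge> 0" "t1 > 0" "\<And>t y. \<bar>t\<bar> \<le> t1 \<Longrightarrow> norm y \<le> R \<Longrightarrow> \<bar>?e t y - ?e 0 y\<bar> \<le> K * \<bar>t\<bar> * ?e 0 y"
    using edens_lipschitz[OF s, of R] tangent_du by metis
  have e0: "?e 0 y \<ge> 0" for y by (rule edens_0_nonneg)
  have E0: "energy p \<Gamma> du = (\<integral>\<^sup>+ y. ennreal (indicator D y * ?e 0 y) \<partial>lborel)"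
    unfolding energy_eq[OF p du ut(2)] edens_0
    by (rule nn_integral_cong) (auto simp: indicator_def)
  have int0: "integrable lborel (\<lambda>y. indicator D y * ?e 0 y)"
    using energy_finite[OF sob] E0 e0 by (intro integrableI_nonneg) (auto simp: AE_I2)
  have bd: "\<bar>indicator D y * (?e t y - ?e 0 y)\<bar> \<le> K * \<bar>t\<bar> * (indicator D y * ?e 0 y)" if "\<bar>t\<bar> \<le> t1" for t y
    using K(3)[OF that, of y] R by (auto simp: indicator_def)
  have intd: "integrable lborel (\<lambda>y. indicator D y * (?e t y - ?e 0 y))" if "\<bar>t\<bar> \<le> t1" for t
  proof (rule Bochner_Integration.integrable_bound[OF integrable_mult_right[OF int0, of "K * \<bar>t\<bar>"]])
    show "AE y in lborel. norm (indicator D y * (?e t y - ?e 0 y)) \<le> norm (K * \<bar>t\<bar> * (indicator D y * ?e 0 y))"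
      using bd[OF that] K(1) e0 by (intro AE_I2) (simp add: abs_mult)
  qed measurable
  \<comment> \<open>The condition \<open>K * \<bar>t\<bar> \<le> 1\<close> keeps the density at time
    \<open>t\<close> nonnegative on \<open>D\<close>, so that the \<open>ennreal\<close> integral
    bounding the energy of the competitor equals the real integral.\<close>
  have nonneg: "0 \<le> (LINT y|lborel. indicator D y * (?e t y - ?e 0 y))"
    if t: "\<bar>t\<bar> < t0" "\<bar>t\<bar> \<le> t1" "K * \<bar>t\<bar> \<le> 1" for t
  proof -
    note dif = t0(2)[OF t(1)]
    have int: "integrable lborel (\<lambda>y. indicator D y * ?e t y)"
      using Bochner_Integration.integrable_add[OF intd[OF t(2)] int0] by (simp add: algebra_simps)
    have et: "0 \<le> indicator D y * ?e t y" for y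
    proof -
      have "\<bar>indicator D y * (?e t y - ?e 0 y)\<bar> \<le> 1 * (indicator D y * ?e 0 y)"
        using bd[OF t(2), of y] mult_right_mono[OF t(3), of "indicator D y * ?e 0 y"] e0[of y] by simp
      then show ?thesis by (auto simp: indicator_def abs_le_iff split: if_splits)
    qed
    have Et: "(\<integral>\<^sup>+ y. ennreal (?e t y) * indicator D y \<partial>lborel) = ennreal (LINT y|lborel. indicator D y * ?e t y)"
    proof -
      have "(\<integral>\<^sup>+ y. ennreal (?e t y) * indicator D y \<partial>lborel) = (\<integral>\<^sup>+ y. ennreal (indicator D y * ?e t y) \<partial>lborel)"
        by (rule nn_integral_cong) (auto simp: indicator_def)
      also have "\<dots> = ennreal (LINT y|lborel. indicator D y * ?e t y)"
        by (rule nn_integral_eq_integral[OF int]) (use et in auto)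
      finally show ?thesis .
    qed
    have fin: "energy p \<Gamma> (dv t) < \<infinity>"
      using energy_v_le[OF dif] unfolding Et by (simp add: order_le_less_trans)
    have "surface_nn_integral \<Gamma> (\<lambda>x. trace (dv t x ** adj (dv t x)) powr (p/2)) < \<infinity>"
      using sobolev_energy_le(1)[OF p weak_differential_dv[OF dif] vt_hyp[OF dif]] fin
      by (simp add: ennreal_mult_less_top order_le_less_trans)
    then have "sobolev_map p \<Gamma> \<pi>M \<pi>N (v t)"
      using lift_v[OF dif] weak_differential_dv[OF dif] by (auto simp: sobolev_map_def)
    moreover have "homotopic_with_canon (\<lambda>_. True) M N f (v t)"
      using hom homotopic_v[OF dif] by (rule homotopic_with_trans)
    ultimately have "J p \<Gamma> \<pi>M \<pi>N u \<le> J p \<Gamma> \<pi>M \<pi>N (v t)" by (rule le)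
    also have "\<dots> \<le> energy p \<Gamma> (dv t)"
      unfolding J_def using lift_v[OF dif] weak_differential_dv[OF dif] by (intro Inf_lower) blast
    also have "\<dots> \<le> ennreal (LINT y|lborel. indicator D y * ?e t y)" using energy_v_le[OF dif] unfolding Et .
    finally have "energy p \<Gamma> du \<le> ennreal (LINT y|lborel. indicator D y * ?e t y)" unfolding J_eq_energy .
    moreover have "energy p \<Gamma> du = ennreal (LINT y|lborel. indicator D y * ?e 0 y)"
      unfolding E0 by (rule nn_integral_eq_integral[OF int0]) (use e0 in auto)
    ultimately have "(LINT y|lborel. indicator D y * ?e 0 y) \<le> (LINT y|lborel. indicator D y * ?e t y)"
      using et by (simp add: ennreal_le_iff integral_nonneg_AE)
    then show ?thesis using int int0 by (simp add: right_diff_distrib)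
  qed
  \<comment> \<open>Halving \<open>t0\<close> gives the strict inequality required for
    invertibility, and \<open>K + 1\<close> in the denominator also covers K = 0.\<close>
  define t2 where "t2 = min (t0 / 2) (min t1 (1 / (K + 1)))"
  have t2: "t2 > 0" using t0 K by (simp add: t2_def)
  have small: "\<bar>t\<bar> < t0" "\<bar>t\<bar> \<le> t1" "K * \<bar>t\<bar> \<le> 1" if "\<bar>t\<bar> \<le> t2" for t
  proof -
    show "\<bar>t\<bar> < t0" "\<bar>t\<bar> \<le> t1" using that t0 by (auto simp: t2_def)
    have "\<bar>t\<bar> \<le> 1 / (K + 1)" using that by (simp add: t2_def)
    then have "K * \<bar>t\<bar> \<le> (K + 1) * (1 / (K + 1))" using K(1) by (intro mult_mono) auto
    then show "K * \<bar>t\<bar> \<le> 1" using K(1) by simp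
  qed
  have lim: "integrable lborel (\<lambda>y. indicator D y * (?s * ?w y)) \<and>
      (\<lambda>n. LINT y|lborel. indicator D y * ((?e (c n) y - ?e 0 y) / c n)) \<longlonglongrightarrow> (LINT y|lborel. indicator D y * (?s * ?w y))"
    if c: "c \<longlonglongrightarrow> 0" "\<And>n. c n \<noteq> 0" "\<And>n. \<bar>c n\<bar> \<le> t2" for c :: "nat \<Rightarrow> real"
  proof -
    have pt: "(\<lambda>n. (?e (c n) y - ?e 0 y) / c n) \<longlonglongrightarrow> ?s * ?w y" for y
    proof -
      have "((\<lambda>h. (?e (0 + h) y - ?e 0 y) / h) \<longlongrightarrow> ?s * ?w y) (at 0)"
        using edens_has_derivative[where du = du, OF p tangent_du] unfolding DERIV_def .
      moreover have "filterlim c (at 0) sequentially" using c(1,2) by (simp add: filterlim_at)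
      ultimately have "(\<lambda>n. (?e (0 + c n) y - ?e 0 y) / c n) \<longlonglongrightarrow> ?s * ?w y" by (rule filterlim_compose)
      then show ?thesis by simp
    qed
    have lim': "AE y in lborel. (\<lambda>n. indicator D y * ((?e (c n) y - ?e 0 y) / c n)) \<longlonglongrightarrow> indicator D y * (?s * ?w y)"
      using pt by (intro AE_I2 tendsto_mult tendsto_const)
    \<comment> \<open>\<open>W_form\<close> is built from pointwise descriptions; its measurability
      is inherited from the difference quotients, of which the integrand is the limit.\<close>
    have m: "(\<lambda>y. indicator D y * (?s * ?w y)) \<in> borel_measurable lborel"
    proof (rule borel_measurable_LIMSEQ_real)
      show "(\<lambda>n. indicator D y * ((?e (c n) y - ?e 0 y) / c n)) \<longlonglongrightarrow> indicator D y * (?s * ?w y)" for y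
        by (rule tendsto_mult[OF tendsto_const pt])
    qed measurable
    have b: "AE y in lborel. norm (indicator D y * ((?e (c n) y - ?e 0 y) / c n)) \<le> K * (indicator D y * ?e 0 y)" for n
    proof (rule AE_I2)
      fix y
      have "\<bar>indicator D y * (?e (c n) y - ?e 0 y)\<bar> / \<bar>c n\<bar> \<le> (K * \<bar>c n\<bar> * (indicator D y * ?e 0 y)) / \<bar>c n\<bar>"
        using bd[OF small(2)[OF c(3)]] by (rule divide_right_mono) simp
      then show "norm (indicator D y * ((?e (c n) y - ?e 0 y) / c n)) \<le> K * (indicator D y * ?e 0 y)"
        using c(2)[of n] by (simp add: abs_mult)
    qed
    have mn: "(\<lambda>y. indicator D y * ((?e (c n) y - ?e 0 y) / c n)) \<in> borel_measurable lborel" for n by measurable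
    show ?thesis
      using integrable_dominated_convergence[OF m mn integrable_mult_right[OF int0, of K] lim' b]
        integral_dominated_convergence[OF m mn integrable_mult_right[OF int0, of K] lim' b] by blast
  qed
  have quot: "(LINT y|lborel. indicator D y * ((?e t y - ?e 0 y) / t)) = (LINT y|lborel. indicator D y * (?e t y - ?e 0 y)) / t" for t
  proof -
    have "(\<lambda>y. indicator D y * ((?e t y - ?e 0 y) / t)) = (\<lambda>y. indicator D y * (?e t y - ?e 0 y) / t)" by auto
    then show ?thesis by (simp only: integral_divide_zero)
  qed
  define c where "c n = t2 / real (Suc n)" for n
  have cpos: "c n > 0" and cle: "c n \<le> t2" for n
    using t2 by (simp_all add: c_def divide_le_eq)
  have c0: "c \<longlonglongrightarrow> 0"
    using tendsto_mult_right[OF LIMSEQ_inverse_real_of_nat, of t2] by (simp add: c_def[abs_def] divide_inverse mult.commute)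
  have cne: "c n \<noteq> 0" and cab: "\<bar>c n\<bar> \<le> t2" for n using cpos[of n] cle[of n] by auto
  have L1: "integrable lborel (\<lambda>y. indicator D y * (?s * ?w y))"
    "(\<lambda>n. LINT y|lborel. indicator D y * ((?e (c n) y - ?e 0 y) / c n)) \<longlonglongrightarrow> (LINT y|lborel. indicator D y * (?s * ?w y))"
    using lim[OF c0 cne cab] by blast+
  have L2: "(\<lambda>n. LINT y|lborel. indicator D y * ((?e (- c n) y - ?e 0 y) / (- c n))) \<longlonglongrightarrow> (LINT y|lborel. indicator D y * (?s * ?w y))"
  proof (rule lim[THEN conjunct2])
    show "(\<lambda>n. - c n) \<longlonglongrightarrow> 0" using tendsto_minus[OF c0] by simp
  qed (use cne cab in simp_all)
  have "0 \<le> (LINT y|lborel. indicator D y * (?s * ?w y))"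
  proof (rule LIMSEQ_le_const[OF L1(2)], intro exI allI impI)
    fix n
    from nonneg[OF small[OF cab]] show "0 \<le> (LINT y|lborel. indicator D y * ((?e (c n) y - ?e 0 y) / c n))"
      unfolding quot using cpos[of n] by simp
  qed
  moreover have "(LINT y|lborel. indicator D y * (?s * ?w y)) \<le> 0"
  proof (rule LIMSEQ_le_const2[OF L2], intro exI allI impI)
    fix n
    have "\<bar>- c n\<bar> \<le> t2" using cab by simp
    from nonneg[OF small[OF this]] show "(LINT y|lborel. indicator D y * ((?e (- c n) y - ?e 0 y) / (- c n))) \<le> 0"
      unfolding quot using cpos[of n] by (simp add: divide_nonneg_neg)
  qed
  ultimately have "has_bochner_integral lborel (\<lambda>y. indicator D y * (?s * ?w y)) 0"
    using L1(1) by (simp add: has_bochner_integral_iff)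
  then have "has_bochner_integral lborel (\<lambda>y. inverse ?s * (indicator D y * (?s * ?w y))) (inverse ?s * 0)"
    by (rule has_bochner_integral_mult_right)
  then show ?thesis using p by (simp add: mult_ac)
qed

end

theorem proposition4p8:
  fixes M :: "'m::t2_space set" and N :: "'n::t2_space set"
    and \<pi>M :: "real^3 \<Rightarrow> 'm" and \<pi>N :: "real^3 \<Rightarrow> 'n"
    and \<Gamma> \<Lambda> :: "(real^3^3) set"
    and f u :: "'m \<Rightarrow> 'n" and p :: real
    and ut :: "real^3 \<Rightarrow> real^3" and du :: "real^3 \<Rightarrow> real^3^3"
  assumes "closed_hyperbolic_surface M \<pi>M \<Gamma>"
    and "closed_hyperbolic_surface N \<pi>N \<Lambda>"
    and "p > 2"
    and "minimizer p \<Gamma> M \<pi>M N \<pi>N f u"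
    and "lift_of \<pi>M \<pi>N u ut"
    and "weak_differential ut du"
  shows "weakly_closed \<Gamma> (W_form p du)"
  unfolding weakly_closed_def
proof (intro allI impI)
  fix \<phi> assume \<phi>: "smooth_section \<Gamma> \<phi>"
  interpret variation_pair M \<pi>M \<Gamma> \<phi> N \<pi>N \<Lambda> p u ut du
    by unfold_locales (fact assms \<phi>)+
  have "(\<lambda>y. indicator (dirichlet \<Gamma>) (chart y) * wedge_d (W_form p du) \<phi> y)
      = (\<lambda>y. indicator D y * wedge_d (W_form p du) \<phi> y)"
    by (auto simp: D_def indicator_def)
  then show "has_bochner_integral lborel (\<lambda>y. indicator (dirichlet \<Gamma>) (chart y) * wedge_d (W_form p du) \<phi> y) 0"
    using first_variation_zero[OF assms(4)] by simp
qed

end
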